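(* Let $\mathbb{B}$ be the unit ball in $\mathbb{C}^n$ and $A=\{\zeta\in\mathbb{C}: 1<|\zeta|<e\}$. Let $\varphi_0,\varphi_1\in C^{1,1}(\bar{\mathbb{B}})$ be plurisubharmonic functions in $\mathbb{B}$ with $\varphi_0=\varphi_1=0$ on $\partial\mathbb{B}$ (the geodesic end points). Then the Perron-Bremermann envelope $$\Phi(z,\zeta)=\sup\{u(z,\zeta) : u\in\mathcal{F}(\Psi,\mathbb{B}\times A)\}$$ admits second-order partial derivatives almost everywhere with respect to the variable $z\in\mathbb{B}$ which are locally bounded, uniformly with respect to $\zeta\in A$; that is, for any compact subset $K\subset\mathbb{B}$ there exists a constant $C$, depending on $K$, $\varphi_0$ and $\varphi_1$, such that $$\|D_z^2\Phi\|_{L^\infty(K\times A)}\le C.$$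
   Context: $\Psi$ is the function on $\partial(\mathbb{B}\times A)$ given by $\Psi=0$ on $\partial\mathbb{B}\times\bar A$, $\Psi(z,\zeta)=\varphi_0(z)$ for $|\zeta|=1$, and $\Psi(z,\zeta)=\varphi_1(z)$ for $|\zeta|=e$. $\mathcal{F}(\Psi,\mathbb{B}\times A)$ is the family of functions $u\in PSH(\mathbb{B}\times A)\cap C^0(\bar{\mathbb{B}}\times\bar A)$ with $u\le\Psi$ on $\partial(\mathbb{B}\times A)$. $D^2_z\Phi$ denotes the (real) second-order derivative of $\Phi(\cdot,\zeta)$ in the variable $z$. *)

theory Defs
  imports "HOL-Analysis.Analysis" "HOL-Probability.Essential_Supremum"
begin

text \<open>The complex scalar multiplication is a parameter \<open>sm\<close>, since the library has no class of
  complex vector spaces: it is \<open>(*s)\<close> on \<open>complex ^ 'n\<close> and \<open>prod_scale\<close> on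
  \<open>(complex ^ 'n) \<times> complex\<close>. For real-valued (hence nowhere \<open>-\<infinity>\<close>) functions the
  circle means of a plurisubharmonic function are automatically finite, so demanding integrability
  only excludes the default value 0 of a divergent integral.\<close>

definition plurisubharmonic_on ::
    "(complex \<Rightarrow> 'a \<Rightarrow> 'a) \<Rightarrow> 'a::real_normed_vector set \<Rightarrow> ('a \<Rightarrow> real) \<Rightarrow> bool" where
  "plurisubharmonic_on sm \<Omega> u \<longleftrightarrow>
     open \<Omega> \<and>
     (\<forall>c. openin (top_of_set \<Omega>) {x \<in> \<Omega>. u x < c}) \<and>
     (\<forall>a b. (\<forall>\<xi>. norm \<xi> \<le> 1 \<longrightarrow> a + sm \<xi> b \<in> \<Omega>) \<longrightarrow>
        (\<lambda>\<theta>. u (a + sm (cis \<theta>) b)) absolutely_integrable_on {0..2 * pi} \<and>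
        u a \<le> integral {0..2 * pi} (\<lambda>\<theta>. u (a + sm (cis \<theta>) b)) / (2 * pi))"

definition prod_scale :: "complex \<Rightarrow> (complex ^ 'n) \<times> complex \<Rightarrow> (complex ^ 'n) \<times> complex" where
  "prod_scale c p = (c *s fst p, c * snd p)"

text \<open>Used for the closed ball, which is convex with nonempty interior: there the derivative
  within the set is unique, also at boundary points.\<close>

definition C11_on :: "'a::euclidean_space set \<Rightarrow> ('a \<Rightarrow> real) \<Rightarrow> bool" where
  "C11_on S f \<longleftrightarrow>
     (\<exists>f' :: 'a \<Rightarrow> 'a \<Rightarrow>\<^sub>L real.
        (\<forall>x\<in>S. (f has_derivative blinfun_apply (f' x)) (at x within S)) \<and>
        (\<exists>L. L-lipschitz_on S f'))"

definition annulus :: "complex set" where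
  "annulus = {\<zeta>. 1 < norm \<zeta> \<and> norm \<zeta> < exp 1}"

text \<open>Only the values on the frontier of \<open>ball 0 1 \<times> annulus\<close> matter; the clauses overlap
  where \<open>norm z = 1\<close>, and agree there as soon as \<open>\<phi>0\<close> and \<open>\<phi>1\<close> vanish on the unit sphere.\<close>

definition boundary_data ::
    "(complex ^ 'n \<Rightarrow> real) \<Rightarrow> (complex ^ 'n \<Rightarrow> real) \<Rightarrow> (complex ^ 'n) \<times> complex \<Rightarrow> real" where
  "boundary_data \<phi>0 \<phi>1 = (\<lambda>(z, \<zeta>).
     if norm z = 1 then 0 else if norm \<zeta> = 1 then \<phi>0 z
     else if norm \<zeta> = exp 1 then \<phi>1 z else 0)"

definition perron_family ::
    "((complex ^ 'n) \<times> complex \<Rightarrow> real) \<Rightarrow> ((complex ^ 'n) \<times> complex) set \<Rightarrow>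
     ((complex ^ 'n) \<times> complex \<Rightarrow> real) set" where
  "perron_family \<psi> D =
     {u. plurisubharmonic_on prod_scale D u \<and> continuous_on (closure D) u \<and>
         (\<forall>p\<in>frontier D. u p \<le> \<psi> p)}"

definition perron_envelope ::
    "(complex ^ 'n \<Rightarrow> real) \<Rightarrow> (complex ^ 'n \<Rightarrow> real) \<Rightarrow> (complex ^ 'n) \<times> complex \<Rightarrow> real" where
  "perron_envelope \<phi>0 \<phi>1 p =
     (SUP u \<in> perron_family (boundary_data \<phi>0 \<phi>1) (ball 0 1 \<times> annulus). u p)"

definition partial_deriv :: "'a::euclidean_space \<Rightarrow> ('a \<Rightarrow> real) \<Rightarrow> 'a \<Rightarrow> real" where
  "partial_deriv i f x = deriv (\<lambda>t. f (x + t *\<^sub>R i)) 0"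

text \<open>Existence of all second-order real partial derivatives at \<open>x\<close>; without it the values of
  \<open>partial_deriv\<close> below are unspecified.\<close>

definition has_second_partials_at :: "('a::euclidean_space \<Rightarrow> real) \<Rightarrow> 'a \<Rightarrow> bool" where
  "has_second_partials_at f x \<longleftrightarrow>
     (\<forall>i\<in>Basis. \<forall>j\<in>Basis.
        (\<forall>\<^sub>F y in nhds x. (\<lambda>t. f (y + t *\<^sub>R j)) differentiable at 0) \<and>
        (\<lambda>t. partial_deriv j f (x + t *\<^sub>R i)) differentiable at 0)"

definition hessian :: "('a::euclidean_space \<Rightarrow> real) \<Rightarrow> 'a \<Rightarrow> 'a \<Rightarrow> 'a" where
  "hessian f x h =
     (\<Sum>i\<in>Basis. (\<Sum>j\<in>Basis. (h \<bullet> j) * partial_deriv i (partial_deriv j f) x) *\<^sub>R i)"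

definition C2_test_function :: "'a::euclidean_space set \<Rightarrow> ('a \<Rightarrow> real) \<Rightarrow> bool" where
  "C2_test_function \<Omega> \<psi> \<longleftrightarrow>
     (\<exists>g :: 'a \<Rightarrow> 'a. \<exists>H :: 'a \<Rightarrow> 'a \<Rightarrow>\<^sub>L 'a.
        (\<forall>x. (\<psi> has_derivative (\<lambda>h. g x \<bullet> h)) (at x)) \<and>
        (\<forall>x. (g has_derivative blinfun_apply (H x)) (at x)) \<and>
        continuous_on UNIV H) \<and>
     compact (closure {x. \<psi> x \<noteq> 0}) \<and> closure {x. \<psi> x \<noteq> 0} \<subseteq> \<Omega>"

text \<open>The almost everywhere defined second partial derivatives of \<open>f\<close> are also its
  distributional ones, i.e. the distributional Hessian has no singular part. For
  locally integrable functions, \<open>C\<^sup>2\<close> and smooth test functions give the same notion.\<close>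

definition second_partials_weak_on :: "'a::euclidean_space set \<Rightarrow> ('a \<Rightarrow> real) \<Rightarrow> bool" where
  "second_partials_weak_on \<Omega> f \<longleftrightarrow>
     (\<forall>i\<in>Basis. \<forall>j\<in>Basis. \<forall>\<psi>. C2_test_function \<Omega> \<psi> \<longrightarrow>
        set_integrable lebesgue \<Omega> (\<lambda>x. f x * partial_deriv i (partial_deriv j \<psi>) x) \<and>
        set_integrable lebesgue \<Omega> (\<lambda>x. partial_deriv i (partial_deriv j f) x * \<psi> x) \<and>
        (LINT x:\<Omega>|lebesgue. f x * partial_deriv i (partial_deriv j \<psi>) x) =
        (LINT x:\<Omega>|lebesgue. partial_deriv i (partial_deriv j f) x * \<psi> x))"

end

theory Submission
  imports Defs "HOL-Complex_Analysis.Complex_Analysis"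
begin

text \<open>The method of Bedford and Taylor. For \<open>x\<close>, \<open>y\<close> with midpoint \<open>m\<close> in a compact part of the ball let
  \<open>S\<^sub>x\<close>, \<open>S\<^sub>y\<close> be the automorphisms of the ball taking \<open>m\<close> to \<open>x\<close> and to \<open>y\<close> (through the origin).
  Since the automorphisms depend smoothly on their parameter and \<open>\<phi>0\<close>, \<open>\<phi>1\<close> are \<open>C\<^sup>1\<^sup>,\<^sup>1\<close>,
  \<open>(u1 (S\<^sub>x z, \<zeta>) + u2 (S\<^sub>y z, \<zeta>)) / 2 - C \<bar>x - y\<bar>\<^sup>2\<close> belongs to the Perron family whenever \<open>u1\<close>, \<open>u2\<close> do.
  Evaluating at \<open>z = m\<close> shows that the envelope is semiconcave in \<open>z\<close>, uniformly in \<open>\<zeta>\<close>.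
  Sub-mean values on complex discs turn this upper bound for second differences into a lower one,
  so the first partial derivatives in \<open>z\<close> are locally Lipschitz. The second ones then exist almost
  everywhere by the one-dimensional theorem of Lebesgue, are bounded, and are the weak ones.\<close>

subsection \<open>Lipschitz functions are differentiable almost everywhere\<close>

text \<open>Plurisubharmonicity is defined by sub-means over flat discs in complex lines, but an
  automorphism bends such a disc into an analytic one. So continuous plurisubharmonic functions must
  first be shown to satisfy the sub-mean inequality on analytic discs. Passing through the origin
  lets one family \<open>ball_aut a\<close> with \<open>ball_aut a 0 = a\<close> suffice; the
  penalty C |x - y|^2 comes from second differences of \<open>\<phi>0 (ball_aut a w)\<close> and
  \<open>\<phi>1 (ball_aut a w)\<close> in a, uniformly in w up to the unit sphere. The
  automorphisms act on z alone, so \<zeta> stays a parameter and no constant depends on it.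
  Differentiability of the envelope is the goal, so its regularity is measured by second differences
  and midpoint convexity; derivatives are extracted only after two-sided bounds are known. The bound
  over K x annulus needs exceptional sets that are null in the product and functions that are
  jointly measurable. This is why the almost everywhere results treat one direction v in an
  arbitrary open set: v may be taken as a z-direction of the product.\<close>

lemma emeasure_disjoint_union_le:
  assumes C: "countable C" and disj: "disjoint_family_on X C"
    and XM: "\<And>i. i \<in> C \<Longrightarrow> X i \<in> sets M" and XN: "\<And>i. i \<in> C \<Longrightarrow> X i \<in> sets N"
    and le: "\<And>i. i \<in> C \<Longrightarrow> c * emeasure M (X i) \<le> d * emeasure N (X i)"
  shows "c * emeasure M (\<Union>i\<in>C. X i) \<le> d * emeasure N (\<Union>i\<in>C. X i)"
proof -
  have "c * emeasure M (\<Union>i\<in>C. X i) = (\<integral>\<^sup>+i. c * emeasure M (X i) \<partial>count_space C)"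
    using emeasure_UN_countable[OF XM C disj] by (simp add: nn_integral_cmult)
  also have "\<dots> \<le> (\<integral>\<^sup>+i. d * emeasure N (X i) \<partial>count_space C)"
    using le by (intro nn_integral_mono) simp
  also have "\<dots> = d * emeasure N (\<Union>i\<in>C. X i)"
    using emeasure_UN_countable[OF XN C disj] by (simp add: nn_integral_cmult)
  finally show ?thesis .
qed

lemma cball_interval_real: "a \<le> b \<Longrightarrow> cball ((a+b)/2) ((b-a)/2) = {a..b::real}"
  by (auto simp: dist_real_def abs_if field_simps split: if_splits)

text \<open>Vitali's theorem for closed balls, since a closed interval is a ball about its centre. A
  point may lie anywhere in its covering intervals, end points included.\<close>

lemma Vitali_covering_intervals:
  fixes K :: "(real \<times> real) set"
  assumes K: "\<And>i. i \<in> K \<Longrightarrow> fst i < snd i"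
    and cov: "\<And>x d. x \<in> S \<Longrightarrow> 0 < d \<Longrightarrow> \<exists>i\<in>K. fst i \<le> x \<and> x \<le> snd i \<and> snd i - fst i < d"
  obtains C where "countable C" "C \<subseteq> K" "disjoint_family_on (\<lambda>i. {fst i..snd i}) C"
    "negligible (S - (\<Union>i\<in>C. {fst i..snd i}))"
proof -
  let ?c = "\<lambda>i. (fst i + snd i) / 2" and ?r = "\<lambda>i. (snd i - fst i) / 2"
  have cb: "cball (?c i) (?r i) = {fst i..snd i}" if "i \<in> K" for i
    using cball_interval_real[of "fst i" "snd i"] K[OF that] by simp
  have r: "0 < ?r i" if "i \<in> K" for i using K[OF that] by simp
  have c: "\<exists>i. i \<in> K \<and> x \<in> cball (?c i) (?r i) \<and> ?r i < d" if xd: "x \<in> S" "0 < d" for x d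
  proof -
    obtain i where i: "i \<in> K" "fst i \<le> x" "x \<le> snd i" "snd i - fst i < d" using cov[OF xd] by blast
    have "x \<in> cball (?c i) (?r i)" unfolding cb[OF i(1)] using i by simp
    moreover have "?r i < d" using i K[OF i(1)] by (simp add: field_simps)
    ultimately show ?thesis using i(1) by blast
  qed
  obtain C where C: "countable C" "C \<subseteq> K"
     "pairwise (\<lambda>i j. disjnt (cball (?c i) (?r i)) (cball (?c j) (?r j))) C"
     "negligible(S - (\<Union>i \<in> C. cball (?c i) (?r i)))"
    by (rule Vitali_covering_theorem_cballs[OF r c])
  have cbC: "cball (?c i) (?r i) = {fst i..snd i}" if "i \<in> C" for i using cb C(2) that by blast
  have "disjoint_family_on (\<lambda>i. {fst i..snd i}) C"
    unfolding disjoint_family_on_def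
  proof (intro ballI impI)
    fix i j assume ij: "i \<in> C" "j \<in> C" "i \<noteq> j"
    then have "disjnt (cball (?c i) (?r i)) (cball (?c j) (?r j))" using C(3) by (auto simp: pairwise_def)
    then show "{fst i..snd i} \<inter> {fst j..snd j} = {}" unfolding cbC[OF ij(1)] cbC[OF ij(2)] disjnt_def .
  qed
  moreover have "(\<Union>i \<in> C. cball (?c i) (?r i)) = (\<Union>i\<in>C. {fst i..snd i})"
    using cbC by (intro SUP_cong) auto
  ultimately show ?thesis using C(4) by (intro that[OF C(1,2)]) simp_all
qed

text \<open>Two nested Vitali coverings are compared by the Stieltjes measure mu of
  \<open>f\<close>: intervals of slope below p inside \<open>U\<close>, then intervals of slope
  above q inside the first ones. Hence q |second| <= mu(second) <= mu(first) <= p |first| <= p |U|.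
  As \<open>S\<close> is not assumed measurable, the conclusion is about a cover
  \<open>T\<close>.\<close>

lemma slope_gap_outer_step:
  fixes f :: "real \<Rightarrow> real"
  assumes mono: "mono f" and cont: "continuous_on UNIV f" and p: "0 < p" and pq: "p < q"
    and U: "open U" "bounded U" "S \<subseteq> U"
    and low: "\<And>x d. x \<in> S \<Longrightarrow> 0 < d \<Longrightarrow> \<exists>a b. a < b \<and> a \<le> x \<and> x \<le> b \<and> b - a < d \<and> f b - f a < p * (b - a)"
    and upp: "\<And>x d. x \<in> S \<Longrightarrow> 0 < d \<Longrightarrow> \<exists>a b. a < b \<and> a \<le> x \<and> x \<le> b \<and> b - a < d \<and> q * (b - a) < f b - f a"
  shows "\<exists>T. T \<in> lmeasurable \<and> S \<subseteq> T \<and> q * measure lebesgue T \<le> p * measure lebesgue U"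
proof -
  let ?I = "\<lambda>i. {fst i..snd i :: real}"
  let ?M = "interval_measure f"
  have sub: "\<exists>d>0. \<forall>a b. a \<le> x \<longrightarrow> x \<le> b \<longrightarrow> b - a < d \<longrightarrow> {a..b} \<subseteq> V" if "open V" "x \<in> V" for x :: real and V
  proof -
    obtain e where e: "e > 0" "ball x e \<subseteq> V" by (rule openE[OF \<open>open V\<close> \<open>x \<in> V\<close>])
    have "{a..b} \<subseteq> V" if "a \<le> x" "x \<le> b" "b - a < e" for a b
      using that e(2) by (auto simp: dist_real_def subset_iff)
    then show ?thesis using e(1) by (intro exI[of _ e]) simp
  qed
  define K where "K = {i. fst i < snd i \<and> ?I i \<subseteq> U \<and> f (snd i) - f (fst i) < p * (snd i - fst i)}"
  have K1: "\<exists>i\<in>K. fst i \<le> x \<and> x \<le> snd i \<and> snd i - fst i < d" if xS: "x \<in> S" and "0 < d" for x d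
  proof -
    have "x \<in> U" using xS U(3) by blast
    obtain e where e: "e > 0" "\<And>a b. a \<le> x \<Longrightarrow> x \<le> b \<Longrightarrow> b - a < e \<Longrightarrow> {a..b} \<subseteq> U"
      using sub[OF U(1) \<open>x \<in> U\<close>] by blast
    obtain a b where ab: "a < b" "a \<le> x" "x \<le> b" "b - a < min d e" "f b - f a < p * (b - a)"
      using low[OF xS, of "min d e"] \<open>0 < d\<close> e(1) by auto
    then have "(a, b) \<in> K" using e(2)[of a b] by (simp add: K_def)
    then show ?thesis using ab by (intro bexI[of _ "(a,b)"]) auto
  qed
  have K0: "fst i < snd i" if "i \<in> K" for i using that by (simp add: K_def)
  obtain C where C: "countable C" "C \<subseteq> K" "disjoint_family_on ?I C" "negligible(S - (\<Union>i \<in> C. ?I i))"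
    by (rule Vitali_covering_intervals[OF K0 K1])
  \<comment> \<open>The second covering has to stay inside an open set, so the intervals are
    replaced by their interiors; this loses only countably many end points.\<close>
  define V where "V = (\<Union>i\<in>C. {fst i<..<snd i})"
  have V: "open V" by (auto simp: V_def)
  have VI: "V \<subseteq> (\<Union>i\<in>C. ?I i)" unfolding V_def by (rule UN_mono) auto
  have "S - V \<subseteq> (S - (\<Union>i\<in>C. ?I i)) \<union> (fst ` C \<union> snd ` C)"
  proof
    fix x assume x: "x \<in> S - V"
    show "x \<in> (S - (\<Union>i\<in>C. ?I i)) \<union> (fst ` C \<union> snd ` C)"
    proof (cases "\<exists>i\<in>C. x \<in> ?I i")
      case True
      then obtain i where i: "i \<in> C" "x \<in> ?I i" by blast
      moreover have "x \<notin> {fst i<..<snd i}" using x i(1) by (auto simp: V_def)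
      ultimately have "x = fst i \<or> x = snd i" by auto
      then show ?thesis using i(1) by blast
    qed (use x in blast)
  qed
  moreover have "negligible (fst ` C \<union> snd ` C)"
    using C(1) by (intro countable_imp_null_set_lborel[THEN null_sets_completionI, folded negligible_iff_null_sets]) auto
  ultimately have SV: "negligible (S - V)"
    using C(4) by (meson negligible_Un negligible_subset)
  define K' where "K' = {i. fst i < snd i \<and> ?I i \<subseteq> V \<and> q * (snd i - fst i) < f (snd i) - f (fst i)}"
  have K'1: "\<exists>i\<in>K'. fst i \<le> x \<and> x \<le> snd i \<and> snd i - fst i < d" if xS: "x \<in> S \<inter> V" and "0 < d" for x d
  proof -
    have "x \<in> V" "x \<in> S" using xS by auto
    obtain e where e: "e > 0" "\<And>a b. a \<le> x \<Longrightarrow> x \<le> b \<Longrightarrow> b - a < e \<Longrightarrow> {a..b} \<subseteq> V"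
      using sub[OF V \<open>x \<in> V\<close>] by blast
    obtain a b where ab: "a < b" "a \<le> x" "x \<le> b" "b - a < min d e" "q * (b - a) < f b - f a"
      using upp[OF \<open>x \<in> S\<close>, of "min d e"] \<open>0 < d\<close> e(1) by auto
    then have "(a, b) \<in> K'" using e(2)[of a b] by (simp add: K'_def)
    then show ?thesis using ab by (intro bexI[of _ "(a,b)"]) auto
  qed
  have K'0: "fst i < snd i" if "i \<in> K'" for i using that by (simp add: K'_def)
  obtain C' where C': "countable C'" "C' \<subseteq> K'" "disjoint_family_on ?I C'" "negligible(S \<inter> V - (\<Union>i \<in> C'. ?I i))"
    by (rule Vitali_covering_intervals[OF K'0 K'1])
  have C'V: "(\<Union>i\<in>C'. ?I i) \<subseteq> V"
    using C'(2) by (intro UN_least) (auto simp: K'_def)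
  have CU: "(\<Union>i\<in>C. ?I i) \<subseteq> U"
    using C(2) by (intro UN_least) (auto simp: K_def)
  have em: "emeasure ?M {a..b} = ennreal (f b - f a)" if "a \<le> b" for a b
    using that mono cont by (intro emeasure_interval_measure_Icc) (auto simp: mono_def)
  have 1: "ennreal q * emeasure lborel (\<Union>i\<in>C'. ?I i) \<le> 1 * emeasure ?M (\<Union>i\<in>C'. ?I i)"
    proof (rule emeasure_disjoint_union_le[OF C'(1,3)])
    fix i assume "i \<in> C'"
    then have i: "fst i < snd i" "q * (snd i - fst i) < f (snd i) - f (fst i)"
      using C'(2) by (auto simp: K'_def)
    then show "ennreal q * emeasure lborel (?I i) \<le> 1 * emeasure ?M (?I i)"
      using p pq by (simp add: em ennreal_mult[symmetric] ennreal_leI)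
  qed auto
  have 2: "1 * emeasure ?M (\<Union>i\<in>C. ?I i) \<le> ennreal p * emeasure lborel (\<Union>i\<in>C. ?I i)"
    proof (rule emeasure_disjoint_union_le[OF C(1,3)])
    fix i assume "i \<in> C"
    then have i: "fst i < snd i" "f (snd i) - f (fst i) < p * (snd i - fst i)"
      using C(2) by (auto simp: K_def)
    then show "1 * emeasure ?M (?I i) \<le> ennreal p * emeasure lborel (?I i)"
      using p pq by (simp add: em ennreal_mult[symmetric] ennreal_leI)
  qed auto
  have Ib: "(\<Union>i\<in>D. ?I i) \<in> sets borel" if "countable D" for D
    using that by (intro sets.countable_UN'') auto
  have 3: "emeasure ?M (\<Union>i\<in>C'. ?I i) \<le> emeasure ?M (\<Union>i\<in>C. ?I i)"
    using C'V VI Ib[OF C(1)] by (intro emeasure_mono) auto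
  have 4: "emeasure lborel (\<Union>i\<in>C. ?I i) \<le> emeasure lborel U"
    using CU U(1) by (intro emeasure_mono) auto
  have "ennreal q * emeasure lborel (\<Union>i\<in>C'. ?I i) \<le> emeasure ?M (\<Union>i\<in>C'. ?I i)"
    using 1 by simp
  also have "\<dots> \<le> emeasure ?M (\<Union>i\<in>C. ?I i)" by (rule 3)
  also have "\<dots> \<le> ennreal p * emeasure lborel (\<Union>i\<in>C. ?I i)" using 2 by simp
  also have "\<dots> \<le> ennreal p * emeasure lborel U" using 4 by (intro mult_left_mono) auto
  finally have "ennreal q * emeasure lborel (\<Union>i\<in>C'. ?I i) \<le> ennreal p * emeasure lborel U" .
  moreover define B where "B = (\<Union>i\<in>C'. ?I i)"
  ultimately have 5: "ennreal q * emeasure lborel B \<le> ennreal p * emeasure lborel U" by simp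
  have Ufin: "U \<in> lmeasurable" using U by (simp add: lmeasurable_open)
  have B: "B \<in> sets borel" using Ib C' by (simp add: B_def)
  have BU: "B \<subseteq> U" using C'V VI CU by (simp add: B_def)
  have Bm: "B \<in> lmeasurable"
    using B BU Ufin U(2) bounded_subset[OF U(2) BU] by (intro bounded_set_imp_lmeasurable) auto
  have 6: "q * measure lebesgue B \<le> p * measure lebesgue U"
  proof -
    have "emeasure lborel B = ennreal (measure lebesgue B)"
      using emeasure_eq_measure2[OF Bm] B by simp
    moreover have "emeasure lborel U = ennreal (measure lebesgue U)"
      using emeasure_eq_measure2[OF Ufin] U(1) by simp
    ultimately have "ennreal (q * measure lebesgue B) \<le> ennreal (p * measure lebesgue U)"
      using 5 p pq by (simp add: ennreal_mult)
    then show ?thesis using p by (subst (asm) ennreal_le_iff) auto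
  qed
  \<comment> \<open>The part of \<open>S\<close> missed by \<open>B\<close> is null, so adding it
    yields a genuine cover of the same measure.\<close>
  define Z where "Z = (S - V) \<union> (S \<inter> V - B)"
  have Z: "negligible Z" using SV C'(4) by (auto simp: Z_def B_def)
  have "B \<union> Z \<in> lmeasurable" "measure lebesgue (B \<union> Z) = measure lebesgue B"
    using Bm Z by (auto simp: negligible_imp_measurable measure_Un_null_set negligible_iff_null_sets fmeasurableD)
  then show ?thesis using 6 by (intro exI[of _ "B \<union> Z"]) (auto simp: Z_def)
qed

text \<open>Let m be the outer measure of \<open>S\<close>, computed from bounded open covers. The
  covering step applied to covers whose measure approaches m gives q m <= p m, and p < q forces m =
  0.\<close>

lemma slope_gap_negligible:
  fixes f :: "real \<Rightarrow> real"
  assumes mono: "mono f" and cont: "continuous_on UNIV f" and p: "0 < p" and pq: "p < q" and S: "bounded S"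
    and low: "\<And>x d. x \<in> S \<Longrightarrow> 0 < d \<Longrightarrow> \<exists>a b. a < b \<and> a \<le> x \<and> x \<le> b \<and> b - a < d \<and> f b - f a < p * (b - a)"
    and upp: "\<And>x d. x \<in> S \<Longrightarrow> 0 < d \<Longrightarrow> \<exists>a b. a < b \<and> a \<le> x \<and> x \<le> b \<and> b - a < d \<and> q * (b - a) < f b - f a"
  shows "negligible S"
proof -
  define A where "A = measure lebesgue ` {U. open U \<and> bounded U \<and> S \<subseteq> U}"
  obtain R where "S \<subseteq> ball 0 R" using S bounded_subset_ballD by blast
  then have ne: "A \<noteq> {}" by (auto simp: A_def intro!: exI[of _ "ball 0 R"])
  have bb: "bdd_below A" by (rule bdd_belowI[of _ 0]) (auto simp: A_def)
  define m where "m = Inf A"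
  have m0: "0 \<le> m" unfolding m_def using ne by (intro cInf_greatest) (auto simp: A_def)
  have step: "q * m \<le> p * a" if a: "a \<in> A" for a
  proof -
    obtain U where U: "open U" "bounded U" "S \<subseteq> U" "a = measure lebesgue U" using a by (auto simp: A_def)
    obtain T where T: "T \<in> lmeasurable" "S \<subseteq> T" "q * measure lebesgue T \<le> p * measure lebesgue U"
      using slope_gap_outer_step[OF mono cont p pq U(1,2,3) low upp] by blast
    have "m \<le> measure lebesgue T + e" if "e > 0" for e
    proof -
      obtain W where W: "open W" "T \<subseteq> W" "W - T \<in> lmeasurable" "emeasure lebesgue (W - T) < ennreal e"
        using sets_lebesgue_outer_open[OF fmeasurableD[OF T(1)] \<open>e > 0\<close>] by blast
      have "W = T \<union> (W - T)" using W by blast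
      then have Wm: "W \<in> lmeasurable" using T W by (metis fmeasurable.Un)
      have "measure lebesgue W \<le> measure lebesgue T + measure lebesgue (W - T)"
        using \<open>W = T \<union> (W - T)\<close> T W by (metis fmeasurableD measure_Un_le)
      moreover have "measure lebesgue (W - T) < e"
        using W(3,4) \<open>e > 0\<close> by (simp add: emeasure_eq_measure2 ennreal_less_iff)
      ultimately have We: "measure lebesgue W < measure lebesgue T + e" by simp
      \<comment> \<open>Intersecting with \<open>U\<close> makes the open cover bounded, as
        membership in \<open>A\<close> requires.\<close>
      have "m \<le> measure lebesgue (W \<inter> U)"
        unfolding m_def using W U T by (intro cInf_lower bb) (auto simp: A_def)
      also have "\<dots> \<le> measure lebesgue W"
        using W U Wm by (intro measure_mono_fmeasurable) auto
      finally show ?thesis using We by simp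
    qed
    then have "m \<le> measure lebesgue T" by (rule field_le_epsilon)
    then have "q * m \<le> q * measure lebesgue T" using p pq by simp
    then show ?thesis using T U by simp
  qed
  have "q * m / p \<le> m"
    unfolding m_def using step ne p
    by (intro cInf_greatest) (auto simp: m_def field_simps)
  then have "m * (q - p) \<le> 0" using p by (simp add: field_simps)
  then have "m = 0" using m0 pq by (simp add: mult_le_0_iff)
  show ?thesis
    unfolding negligible_outer
  proof (intro allI impI)
    fix e :: real assume "e > 0"
    then obtain a where "a \<in> A" "a < e" using \<open>m = 0\<close> ne bb m_def cInf_lessD by metis
    then show "\<exists>T. S \<subseteq> T \<and> T \<in> lmeasurable \<and> measure lebesgue T < e"
      by (auto simp: A_def lmeasurable_open)
  qed
qed


text \<open>Lebesgue's theorem. \<open>low p x\<close> and \<open>upp q x\<close> say that x lies in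
  arbitrarily short intervals of slope below p, respectively above q. Rational p < q and a natural
  bound R cut the bad points into countably many bounded sets, each negligible by the slope
  gap.\<close>

lemma lipschitz_mono_differentiable_ae:
  fixes f :: "real \<Rightarrow> real"
  assumes mono: "mono f" and lip: "L-lipschitz_on UNIV f"
  shows "negligible {x. \<not> f differentiable at x}"
proof -
  have cont: "continuous_on UNIV f" using lip by (rule lipschitz_on_continuous_on)
  have slope0: "0 \<le> f b - f a" if "a \<le> b" for a b using mono that by (simp add: mono_def)
  have slopeL: "f b - f a \<le> L * (b - a)" if "a \<le> b" for a b
    using lipschitz_onD[OF lip, of b a] that by (simp add: dist_real_def)
  define low where "low p x \<longleftrightarrow> (\<forall>d>0. \<exists>a b. a < b \<and> a \<le> x \<and> x \<le> b \<and> b - a < d \<and> f b - f a < p * (b - a))" for p x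
  define upp where "upp q x \<longleftrightarrow> (\<forall>d>0. \<exists>a b. a < b \<and> a \<le> x \<and> x \<le> b \<and> b - a < d \<and> q * (b - a) < f b - f a)" for q x
  define E where "E p q R = {x. low p x \<and> upp q x \<and> \<bar>x\<bar> < real R}" for p q R
  have lowpos: "0 < p" if "low p x" for p x
  proof -
    have "(0::real) < 1" by simp
    then obtain a b where ab: "a < b" "f b - f a < p * (b - a)" using \<open>low p x\<close> unfolding low_def by meson
    then have "0 < p * (b - a)" using slope0[of a b] by linarith
    then show ?thesis using ab(1) by (simp add: zero_less_mult_iff)
  qed
  have uppL: "q < L" if "upp q x" for q x
  proof -
    have "(0::real) < 1" by simp
    then obtain a b where ab: "a < b" "q * (b - a) < f b - f a" using \<open>upp q x\<close> unfolding upp_def by meson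
    then have "q * (b - a) < L * (b - a)" using slopeL[of a b] by linarith
    then show ?thesis using ab(1) by simp
  qed
  have negE: "negligible (E p q R)" if "p < q" for p q R
  proof (cases "0 < p")
    case True
    have "bounded (E p q R)" by (rule bounded_subset[of "ball 0 (real R)"]) (auto simp: E_def)
    then show ?thesis
      by (rule slope_gap_negligible[OF mono cont True \<open>p < q\<close>]) (auto simp: E_def low_def upp_def)
  next
    case False
    then have "E p q R = {}" using lowpos by (auto simp: E_def)
    then show ?thesis by simp
  qed
  have "negligible (\<Union>(p,q,R)\<in>{(p,q,R). p \<in> \<rat> \<and> q \<in> \<rat> \<and> p < q}. E p q R)"
  proof (rule negligible_countable_Union)
    have "{(p,q,R::nat). p \<in> \<rat> \<and> q \<in> \<rat> \<and> p < (q::real)} \<subseteq> \<rat> \<times> \<rat> \<times> UNIV" by auto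
    then show "countable ((\<lambda>(p,q,R). E p q R) ` {(p,q,R). p \<in> \<rat> \<and> q \<in> \<rat> \<and> p < q})"
      by (intro countable_image, rule countable_subset) (intro countable_SIGMA countable_rat countableI_type)
  qed (use negE in auto)
  moreover have "{x. \<not> f differentiable at x} \<subseteq> (\<Union>(p,q,R)\<in>{(p,q,R). p \<in> \<rat> \<and> q \<in> \<rat> \<and> p < q}. E p q R)"
  proof (rule ccontr)
    assume "\<not> ?thesis"
    then obtain x where nd: "\<not> f differentiable at x"
      and x: "\<And>p q R. p \<in> \<rat> \<Longrightarrow> q \<in> \<rat> \<Longrightarrow> p < q \<Longrightarrow> x \<notin> E p q R" by blast
    have x': "\<not> (low p x \<and> upp q x)" if pq: "p \<in> \<rat>" "q \<in> \<rat>" "p < q" for p q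
    proof -
      obtain R where "\<bar>x\<bar> < real R" using reals_Archimedean2 by blast
      then show ?thesis using x[OF pq, of R] by (simp add: E_def)
    qed
    \<comment> \<open>The lower derivate at \<open>x\<close>; the Lipschitz bound makes it finite.
      Every rational above \<open>l\<close> satisfies \<open>low\<close>, and since x has no
      rational gap, \<open>upp\<close> fails for every larger rational, which presses the slopes
      down to \<open>l\<close>.\<close>
    define l where "l = Sup {p. \<not> low p x}"
    have ne: "{p. \<not> low p x} \<noteq> {}" using lowpos[of 0 x] by auto
    have lowmono: "low p' x" if "low p x" "p \<le> p'" for p p'
      unfolding low_def
    proof (intro allI impI)
      fix d :: real assume "d > 0"
      then obtain a b where "a < b \<and> a \<le> x \<and> x \<le> b \<and> b - a < d \<and> f b - f a < p * (b - a)"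
        using \<open>low p x\<close> unfolding low_def by blast
      moreover have "p * (b - a) \<le> p' * (b - a)" if "a < b" using \<open>p \<le> p'\<close> that by simp
      ultimately show "\<exists>a b. a < b \<and> a \<le> x \<and> x \<le> b \<and> b - a < d \<and> f b - f a < p' * (b - a)"
        by (intro exI[of _ a] exI[of _ b]) linarith
    qed
    have lowL: "low (L + 1) x"
      unfolding low_def
    proof (intro allI impI)
      fix d :: real assume "d > 0"
      have "f (x + d/2) - f x < (L + 1) * (d / 2)"
        using slopeL[of x "x + d/2"] \<open>d > 0\<close> by (simp add: field_simps)
      then show "\<exists>a b. a < b \<and> a \<le> x \<and> x \<le> b \<and> b - a < d \<and> f b - f a < (L + 1) * (b - a)"
        using \<open>d > 0\<close> by (intro exI[of _ x] exI[of _ "x + d/2"]) auto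
    qed
    have bd: "bdd_above {p. \<not> low p x}"
    proof (rule bdd_aboveI[of _ "L + 1"])
      fix p assume "p \<in> {p. \<not> low p x}"
      then show "p \<le> L + 1" using lowmono[OF lowL, of p] by force
    qed
    have lo: "\<exists>d>0. \<forall>a b. a < b \<longrightarrow> a \<le> x \<longrightarrow> x \<le> b \<longrightarrow> b - a < d \<longrightarrow> (l - e) * (b - a) \<le> f b - f a" if e: "e > 0" for e
    proof -
      have "l - e < Sup {p. \<not> low p x}" using e by (simp add: l_def)
      then obtain p where "\<not> low p x" "l - e < p" using less_cSup_iff[OF ne bd] by auto
      then have "\<not> low (l - e) x" using lowmono[of "l - e" p] by auto
      then show ?thesis unfolding low_def by (meson not_le)
    qed
    have hi: "\<exists>d>0. \<forall>a b. a < b \<longrightarrow> a \<le> x \<longrightarrow> x \<le> b \<longrightarrow> b - a < d \<longrightarrow> f b - f a \<le> (l + e) * (b - a)" if e: "e > 0" for e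
    proof -
      obtain p where p: "p \<in> \<rat>" "l < p" "p < l + e/2" using Rats_dense_in_real[of l "l + e/2"] e by auto
      obtain q where q: "q \<in> \<rat>" "l + e/2 < q" "q < l + e" using Rats_dense_in_real[of "l+e/2" "l + e"] e by auto
      have "low p x"
      proof (rule ccontr)
        assume "\<not> low p x"
        then have "p \<le> l" unfolding l_def by (intro cSup_upper bd) simp
        then show False using p by simp
      qed
      then have "\<not> upp q x" using x'[OF p(1) q(1)] p q by simp
      then obtain d where d: "d > 0" "\<And>a b. a < b \<Longrightarrow> a \<le> x \<Longrightarrow> x \<le> b \<Longrightarrow> b - a < d \<Longrightarrow> f b - f a \<le> q * (b - a)"
        unfolding upp_def by (meson not_le)
      show ?thesis
      proof (intro exI[of _ d] conjI allI impI)
        fix a b assume ab: "a < b" "a \<le> x" "x \<le> b" "b - a < d"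
        have "q * (b - a) \<le> (l + e) * (b - a)" using q ab by simp
        then show "f b - f a \<le> (l + e) * (b - a)" using d(2)[OF ab] by linarith
      qed (use d in simp)
    qed
    have "((\<lambda>y. (f y - f x) / (y - x)) \<longlongrightarrow> l) (at x)"
    proof (rule tendstoI)
      fix e :: real assume "e > 0"
      then obtain d1 d2 where d: "d1 > 0" "d2 > 0"
         "\<And>a b. a < b \<Longrightarrow> a \<le> x \<Longrightarrow> x \<le> b \<Longrightarrow> b - a < d1 \<Longrightarrow> (l - e/2) * (b - a) \<le> f b - f a"
         "\<And>a b. a < b \<Longrightarrow> a \<le> x \<Longrightarrow> x \<le> b \<Longrightarrow> b - a < d2 \<Longrightarrow> f b - f a \<le> (l + e/2) * (b - a)"
        using lo[of "e/2"] hi[of "e/2"] by auto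
      have "dist ((f y - f x) / (y - x)) l < e" if y: "y \<noteq> x" "dist y x < d1" "dist y x < d2" for y
      proof -
        define a b where "a = min x y" and "b = max x y"
        have ab: "a < b" "a \<le> x" "x \<le> b" "b - a < d1" "b - a < d2"
          using y by (auto simp: a_def b_def dist_real_def min_less_iff_conj min_def[of x y] max_def[of x y] split: if_splits)
        have eq: "(f y - f x) / (y - x) = (f b - f a) / (b - a)"
          using y(1) by (auto simp: a_def b_def min_def max_def field_simps)
        have "l - e/2 \<le> (f b - f a) / (b - a)" "(f b - f a) / (b - a) \<le> l + e/2"
          using d(3)[OF ab(1-4)] d(4)[OF ab(1-3,5)] ab(1) by (simp_all add: field_simps)
        then show ?thesis unfolding eq dist_real_def using \<open>e > 0\<close> by linarith
      qed
      then show "\<forall>\<^sub>F y in at x. dist ((f y - f x) / (y - x)) l < e"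
        unfolding eventually_at using d(1,2) by (intro exI[of _ "min d1 d2"]) auto
    qed
    then have "(f has_real_derivative l) (at x)" by (simp add: has_field_derivative_iff)
    then show False using nd real_differentiable_def by blast
  qed
  ultimately show ?thesis using negligible_subset by blast
qed

text \<open>Adding L x makes the function monotone, keeps it Lipschitz and does not change where it
  is differentiable.\<close>

lemma lipschitz_differentiable_ae:
  fixes f :: "real \<Rightarrow> real"
  assumes lip: "L-lipschitz_on UNIV f"
  shows "negligible {x. \<not> f differentiable at x}"
proof -
  let ?g = "\<lambda>x. f x + L * x"
  have L: "0 \<le> L" using lip by (rule lipschitz_on_nonneg)
  have "mono ?g"
  proof (rule monoI)
    fix x y :: real assume "x \<le> y"
    then show "?g x \<le> ?g y" using lipschitz_onD[OF lip, of x y] by (auto simp: dist_real_def algebra_simps abs_if split: if_splits)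
  qed
  moreover have "(L + L)-lipschitz_on UNIV ?g"
    by (intro lipschitz_on_add lip, rule lipschitz_onI) (use L in \<open>auto simp: dist_real_def abs_mult simp flip: right_diff_distrib\<close>)
  ultimately have "negligible {x. \<not> ?g differentiable at x}" by (rule lipschitz_mono_differentiable_ae)
  moreover have "f differentiable at x" if "?g differentiable at x" for x
  proof -
    have "(\<lambda>x. ?g x - L * x) differentiable at x" using that by (rule differentiable_diff) (auto intro!: derivative_intros)
    moreover have "(\<lambda>x. ?g x - L * x) = f" by auto
    ultimately show ?thesis by metis
  qed
  ultimately show ?thesis by (smt (verit) Collect_mono negligible_subset)
qed

text \<open>Only the behaviour near each point matters: clamping the argument to a rational interval
  on which \<open>h\<close> is Lipschitz gives a globally Lipschitz function.\<close>

lemma locally_lipschitz_differentiable_ae: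
  fixes h :: "real \<Rightarrow> real"
  assumes loc: "\<And>t. t \<in> S \<Longrightarrow> \<exists>d>0. \<exists>L. L-lipschitz_on {t-d..t+d} h"
  shows "negligible {t\<in>S. \<not> h differentiable at t}"
proof -
  define A where "A = {(a,b). a \<in> \<rat> \<and> b \<in> \<rat> \<and> a < b \<and> (\<exists>L. L-lipschitz_on {a..b::real} h)}"
  let ?g = "\<lambda>(a,b) t. h (max a (min b t))"
  have "negligible (\<Union>i\<in>A. {t. \<not> ?g i differentiable at t})"
  proof (rule negligible_countable_Union)
    have "A \<subseteq> \<rat> \<times> \<rat>" by (auto simp: A_def)
    then show "countable ((\<lambda>i. {t. \<not> ?g i differentiable at t}) ` A)"
      by (intro countable_image, rule countable_subset) (intro countable_SIGMA countable_rat)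
  next
    fix X assume "X \<in> (\<lambda>i. {t. \<not> ?g i differentiable at t}) ` A"
    then obtain a b L where ab: "a < b" "L-lipschitz_on {a..b} h" "X = {t. \<not> ?g (a,b) differentiable at t}"
      by (auto simp: A_def)
    have "L-lipschitz_on UNIV (?g (a,b))"
    proof (rule lipschitz_onI)
      fix s t :: real
      have "dist (h (max a (min b s))) (h (max a (min b t))) \<le> L * dist (max a (min b s)) (max a (min b t))"
        using ab(1) by (intro lipschitz_onD[OF ab(2)]) auto
      also have "\<dots> \<le> L * dist s t"
        using lipschitz_on_nonneg[OF ab(2)] by (intro mult_left_mono) (auto simp: dist_real_def min_def max_def)
      finally show "dist (?g (a,b) s) (?g (a,b) t) \<le> L * dist s t" by simp
    qed (rule lipschitz_on_nonneg[OF ab(2)])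
    then show "negligible X" unfolding ab(3) by (rule lipschitz_differentiable_ae)
  qed
  moreover have "{t\<in>S. \<not> h differentiable at t} \<subseteq> (\<Union>i\<in>A. {t. \<not> ?g i differentiable at t})"
  proof clarsimp
    fix t assume t: "t \<in> S" "\<not> h differentiable at t"
    obtain d L where d: "d > 0" "L-lipschitz_on {t-d..t+d} h" using loc[OF t(1)] by blast
    obtain a where a: "a \<in> \<rat>" "t - d < a" "a < t" using Rats_dense_in_real[of "t-d" t] d by auto
    obtain b where b: "b \<in> \<rat>" "t < b" "b < t + d" using Rats_dense_in_real[of t "t+d"] d by auto
    have "L-lipschitz_on {a..b} h" by (rule lipschitz_on_subset[OF d(2)]) (use a b in auto)
    then have "(a,b) \<in> A" using a b by (auto simp: A_def)
    moreover have "\<not> ?g (a,b) differentiable at t"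
    proof
      assume "?g (a,b) differentiable at t"
      then have "h differentiable at t"
        unfolding differentiable_def
      proof (elim exE)
        fix D assume D: "(?g (a,b) has_derivative D) (at t)"
        have "(h has_derivative D) (at t)"
          by (rule has_derivative_transform_within_open[OF D, of "{a<..<b}"]) (use a b in auto)
        then show "\<exists>D. (h has_derivative D) (at t)" by blast
      qed
      then show False using t by simp
    qed
    ultimately show "\<exists>i\<in>A. \<not> ?g i differentiable at t" by blast
  qed
  ultimately show ?thesis using negligible_subset by blast
qed

section \<open>Directional derivatives in several variables: measurability and null sets\<close>

text \<open>Differentiability along \<open>v\<close> is the Cauchy criterion for the difference
  quotients. Along a line these are continuous at small nonzero increments, so rational increments
  suffice and the criterion is a countable combination of Borel conditions. At a point of \<Omega>
  the extension by zero affects only large increments.\<close>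

lemma directional_nondifferentiable_borel:
  fixes G :: "'a::euclidean_space \<Rightarrow> real"
  assumes \<Omega>: "open \<Omega>" and g: "(\<lambda>x. if x \<in> \<Omega> then G x else 0) \<in> borel_measurable borel"
    and lip: "\<And>x. x \<in> \<Omega> \<Longrightarrow> \<exists>d>0. \<exists>L. L-lipschitz_on {-d..d} (\<lambda>t. G (x + t *\<^sub>R v))"
  shows "{x \<in> \<Omega>. \<not> (\<lambda>t. G (x + t *\<^sub>R v)) differentiable at 0} \<in> sets borel"
proof -
  define g where "g x = (if x \<in> \<Omega> then G x else 0)" for x
  have gm [measurable]: "g \<in> borel_measurable borel" using g by (simp add: g_def[abs_def])
  have [measurable]: "\<Omega> \<in> sets borel" using \<Omega> by simp
  define q where "q x t = (g (x + t *\<^sub>R v) - g x) / t" for x and t :: real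
  have qm [measurable]: "(\<lambda>x. q x t) \<in> borel_measurable borel" for t unfolding q_def by measurable
  define P where "P x \<longleftrightarrow> (\<forall>k::nat. \<exists>m::nat. \<forall>(s::rat) (t::rat). 0 < \<bar>real_of_rat s\<bar> \<and> \<bar>real_of_rat s\<bar> < 1 / real (Suc m) \<and> 0 < \<bar>real_of_rat t\<bar> \<and> \<bar>real_of_rat t\<bar> < 1 / real (Suc m) \<longrightarrow>
      \<bar>q x (real_of_rat s) - q x (real_of_rat t)\<bar> \<le> 1 / real (Suc k))" for x
  have "Measurable.pred borel P" unfolding P_def by measurable
  then have meas: "{x \<in> \<Omega>. \<not> P x} \<in> sets borel" by measurable
  have eq: "(\<lambda>t. G (x + t *\<^sub>R v)) differentiable at 0 \<longleftrightarrow> P x" if x: "x \<in> \<Omega>" for x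
  proof -
    obtain d0 where d0: "d0 > 0" "ball x d0 \<subseteq> \<Omega>" using \<Omega> x openE by metis
    obtain d1 L where d1: "d1 > 0" "L-lipschitz_on {-d1..d1} (\<lambda>t. G (x + t *\<^sub>R v))" using lip[OF x] by blast
    define d where "d = min (d0 / (norm v + 1)) d1"
    have nv: "0 < norm v + 1" by (simp add: add_nonneg_pos)
    have d: "d > 0" "d \<le> d1" using d0 d1 nv by (auto simp: d_def)
    have inO: "x + t *\<^sub>R v \<in> \<Omega>" if t: "\<bar>t\<bar> < d" for t
    proof -
      have "norm (t *\<^sub>R v) \<le> \<bar>t\<bar> * (norm v + 1)" by (simp add: mult_left_mono)
      also have "\<dots> < d0 / (norm v + 1) * (norm v + 1)" using t nv by (intro mult_strict_right_mono) (auto simp: d_def)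
      also have "\<dots> = d0" using nv by simp
      finally show ?thesis using d0(2) by (auto simp: dist_norm)
    qed
    have qG: "q x t = (G (x + t *\<^sub>R v) - G x) / t" if "\<bar>t\<bar> < d" for t
      using inO[OF that] x by (simp add: q_def g_def)
    have cG: "continuous_on {-d1..d1} (\<lambda>t. G (x + t *\<^sub>R v))" using d1(2) by (rule lipschitz_on_continuous_on)
    have cq: "isCont (q x) t" if t: "0 < \<bar>t\<bar>" "\<bar>t\<bar> < d" for t
    proof -
      have "isCont (\<lambda>t. G (x + t *\<^sub>R v)) t"
      proof (rule continuous_on_interior[OF cG])
        have "- d1 < t \<and> t < d1" using t d by linarith
        then show "t \<in> interior {-d1..d1}" by simp
      qed
      then have "isCont (\<lambda>t. (G (x + t *\<^sub>R v) - G x) / t) t" using t by (intro continuous_intros) auto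
      moreover have "\<forall>\<^sub>F t in nhds t. (G (x + t *\<^sub>R v) - G x) / t = q x t"
      proof -
        have "- d < t \<and> t < d" using t by linarith
        then have "\<forall>\<^sub>F t in nhds t. t \<in> {-d<..<d}" by (intro eventually_nhds_in_open) auto
        then show ?thesis by eventually_elim (auto simp: qG)
      qed
      ultimately show ?thesis by (simp add: isCont_cong)
    qed
    show ?thesis
    proof
      assume "(\<lambda>t. G (x + t *\<^sub>R v)) differentiable at 0"
      then obtain D where "DERIV (\<lambda>t. G (x + t *\<^sub>R v)) 0 :> D" using real_differentiable_def by blast
      then have lim: "((\<lambda>t. (G (x + t *\<^sub>R v) - G x) / t) \<longlongrightarrow> D) (at 0)" by (simp add: has_field_derivative_iff)
      show "P x"
        unfolding P_def
      proof
        fix k :: nat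
        obtain e where e: "e > 0" "\<And>t. t \<noteq> 0 \<Longrightarrow> \<bar>t\<bar> < e \<Longrightarrow> \<bar>(G (x + t *\<^sub>R v) - G x) / t - D\<bar> < 1 / (2 * real (Suc k))"
          using lim[unfolded LIM_def, rule_format, of "1 / (2 * real (Suc k))"] by (auto simp: dist_real_def)
        obtain m where m: "1 / real (Suc m) < min e d" using nat_approx_posE[of "min e d"] e d by auto
        show "\<exists>m::nat. \<forall>(s::rat) (t::rat). 0 < \<bar>real_of_rat s\<bar> \<and> \<bar>real_of_rat s\<bar> < 1 / real (Suc m) \<and> 0 < \<bar>real_of_rat t\<bar> \<and> \<bar>real_of_rat t\<bar> < 1 / real (Suc m) \<longrightarrow>
            \<bar>q x (real_of_rat s) - q x (real_of_rat t)\<bar> \<le> 1 / real (Suc k)"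
        proof (intro exI[of _ m] allI impI)
          fix s t :: rat
          assume st: "0 < \<bar>real_of_rat s\<bar> \<and> \<bar>real_of_rat s\<bar> < 1 / real (Suc m) \<and> 0 < \<bar>real_of_rat t\<bar> \<and> \<bar>real_of_rat t\<bar> < 1 / real (Suc m)"
          have 1: "\<bar>q x r - D\<bar> < 1 / (2 * real (Suc k))" if r: "0 < \<bar>r\<bar>" "\<bar>r\<bar> < 1 / real (Suc m)" for r
            using e(2)[of r] qG[of r] r m by auto
          have "\<bar>q x (real_of_rat s) - q x (real_of_rat t)\<bar> \<le> 1 / (2 * real (Suc k)) + 1 / (2 * real (Suc k))"
            using 1[of "real_of_rat s"] 1[of "real_of_rat t"] st by linarith
          also have "\<dots> = 1 / real (Suc k)" by (simp add: field_simps)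
          finally show "\<bar>q x (real_of_rat s) - q x (real_of_rat t)\<bar> \<le> 1 / real (Suc k)" .
        qed
      qed
    next
      assume P: "P x"
      \<comment> \<open>Passage from rational to real increments: by continuity of the quotient at
        t, a rational close to t has almost the same quotient, and it can be kept nonzero and of
        modulus below \<open>e\<close>.\<close>
      have cauchy: "\<exists>e>0. \<forall>s t. 0 < \<bar>s\<bar> \<longrightarrow> \<bar>s\<bar> < e \<longrightarrow> 0 < \<bar>t\<bar> \<longrightarrow> \<bar>t\<bar> < e \<longrightarrow> \<bar>q x s - q x t\<bar> < \<epsilon>" if \<epsilon>: "\<epsilon> > 0" for \<epsilon>
      proof -
        obtain k where k: "1 / real (Suc k) < \<epsilon> / 3" using nat_approx_posE[of "\<epsilon>/3"] \<epsilon> by auto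
        obtain m where m: "\<And>s t::rat. 0 < \<bar>real_of_rat s\<bar> \<Longrightarrow> \<bar>real_of_rat s\<bar> < 1 / real (Suc m) \<Longrightarrow> 0 < \<bar>real_of_rat t\<bar> \<Longrightarrow> \<bar>real_of_rat t\<bar> < 1 / real (Suc m) \<Longrightarrow>
            \<bar>q x (real_of_rat s) - q x (real_of_rat t)\<bar> \<le> 1 / real (Suc k)" using P unfolding P_def by blast
        define e where "e = min d (1 / real (Suc m))"
        have e: "e > 0" using d by (simp add: e_def)
        have appr: "\<exists>r::rat. 0 < \<bar>real_of_rat r\<bar> \<and> \<bar>real_of_rat r\<bar> < 1 / real (Suc m) \<and> \<bar>q x (real_of_rat r) - q x t\<bar> < \<epsilon> / 3"
          if t: "0 < \<bar>t\<bar>" "\<bar>t\<bar> < e" for t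
        proof -
          have "isCont (q x) t" using cq[of t] t by (simp add: e_def)
          then obtain \<delta> where \<delta>: "\<delta> > 0" "\<And>s. \<bar>s - t\<bar> < \<delta> \<Longrightarrow> \<bar>q x s - q x t\<bar> < \<epsilon> / 3"
            unfolding continuous_at_eps_delta using \<epsilon> by (metis dist_real_def divide_pos_pos zero_less_numeral)
          define \<delta>' where "\<delta>' = min \<delta> (min \<bar>t\<bar> (e - \<bar>t\<bar>))"
          have "t - \<delta>' < t" using \<delta> t by (simp add: \<delta>'_def)
          then obtain r where r: "t - \<delta>' < real_of_rat r" "real_of_rat r < t" using of_rat_dense by blast
          have r': "\<bar>real_of_rat r - t\<bar> < \<delta>'" using r by linarith
          then have "\<bar>real_of_rat r - t\<bar> < \<bar>t\<bar>" "\<bar>real_of_rat r - t\<bar> < e - \<bar>t\<bar>" by (auto simp: \<delta>'_def)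
          then have "0 < \<bar>real_of_rat r\<bar>" "\<bar>real_of_rat r\<bar> < e" by linarith+
          then show ?thesis using \<delta>(2)[of "real_of_rat r"] r' by (intro exI[of _ r]) (auto simp: \<delta>'_def e_def)
        qed
        show ?thesis
        proof (intro exI[of _ e] conjI allI impI e)
          fix s t assume "0 < \<bar>s\<bar>" "\<bar>s\<bar> < e" "0 < \<bar>t\<bar>" "\<bar>t\<bar> < e"
          then obtain a b where ab: "0 < \<bar>real_of_rat a\<bar>" "\<bar>real_of_rat a\<bar> < 1 / real (Suc m)" "\<bar>q x (real_of_rat a) - q x s\<bar> < \<epsilon> / 3"
            "0 < \<bar>real_of_rat b\<bar>" "\<bar>real_of_rat b\<bar> < 1 / real (Suc m)" "\<bar>q x (real_of_rat b) - q x t\<bar> < \<epsilon> / 3" using appr by metis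
          show "\<bar>q x s - q x t\<bar> < \<epsilon>" using m[OF ab(1,2,4,5)] ab(3,6) k by linarith
        qed
      qed
      define X where "X n = d / real (Suc (Suc n))" for n
      have X: "0 < X n" "X n < d" for n using d by (auto simp: X_def field_simps intro!: add_pos_nonneg)
      have X0: "X \<longlonglongrightarrow> 0"
        unfolding X_def using LIMSEQ_Suc[OF LIMSEQ_inverse_real_of_nat, THEN tendsto_mult_left, of d] by (simp add: divide_inverse)
      have "Cauchy (\<lambda>n. q x (X n))"
      proof (rule metric_CauchyI)
        fix \<epsilon> :: real assume "\<epsilon> > 0"
        then obtain e where e: "e > 0" "\<And>s t. 0 < \<bar>s\<bar> \<Longrightarrow> \<bar>s\<bar> < e \<Longrightarrow> 0 < \<bar>t\<bar> \<Longrightarrow> \<bar>t\<bar> < e \<Longrightarrow> \<bar>q x s - q x t\<bar> < \<epsilon>"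
          using cauchy by metis
        obtain M where M: "\<And>n. n \<ge> M \<Longrightarrow> \<bar>X n\<bar> < e" using X0[unfolded LIMSEQ_iff, rule_format, OF e(1)] by auto
        show "\<exists>M. \<forall>m\<ge>M. \<forall>n\<ge>M. dist (q x (X m)) (q x (X n)) < \<epsilon>"
        proof (intro exI[of _ M] allI impI)
          fix m n assume "m \<ge> M" "n \<ge> M"
          then show "dist (q x (X m)) (q x (X n)) < \<epsilon>"
            using e(2)[of "X m" "X n"] M[of m] M[of n] X[of m] X[of n] by (simp add: dist_real_def)
        qed
      qed
      then obtain D where D: "(\<lambda>n. q x (X n)) \<longlonglongrightarrow> D" using Cauchy_convergent convergent_def by blast
      have "((\<lambda>t. (G (x + t *\<^sub>R v) - G x) / t) \<longlongrightarrow> D) (at 0)"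
        unfolding LIM_def
      proof (intro allI impI)
        fix \<epsilon> :: real assume "\<epsilon> > 0"
        obtain e where e: "e > 0" "\<And>s t. 0 < \<bar>s\<bar> \<Longrightarrow> \<bar>s\<bar> < e \<Longrightarrow> 0 < \<bar>t\<bar> \<Longrightarrow> \<bar>t\<bar> < e \<Longrightarrow> \<bar>q x s - q x t\<bar> < \<epsilon>/2"
          using cauchy[of "\<epsilon>/2"] \<open>\<epsilon> > 0\<close> by auto
        obtain M1 where M1: "\<And>n. n \<ge> M1 \<Longrightarrow> \<bar>X n\<bar> < e" using X0[unfolded LIMSEQ_iff, rule_format, OF e(1)] by auto
        obtain M2 where M2: "\<And>n. n \<ge> M2 \<Longrightarrow> \<bar>q x (X n) - D\<bar> < \<epsilon>/2" using D[unfolded LIMSEQ_iff, rule_format, of "\<epsilon>/2"] \<open>\<epsilon> > 0\<close> by auto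
        let ?n = "max M1 M2"
        show "\<exists>s>0. \<forall>t. t \<noteq> 0 \<and> dist t 0 < s \<longrightarrow> dist ((G (x + t *\<^sub>R v) - G x) / t) D < \<epsilon>"
        proof (intro exI[of _ "min e d"] conjI allI impI)
          fix t :: real assume t: "t \<noteq> 0 \<and> dist t 0 < min e d"
          have "\<bar>q x t - q x (X ?n)\<bar> < \<epsilon>/2" using e(2)[of t "X ?n"] t M1[of ?n] X[of ?n] by auto
          moreover have "\<bar>q x (X ?n) - D\<bar> < \<epsilon>/2" using M2[of ?n] by auto
          ultimately have "\<bar>q x t - D\<bar> < \<epsilon>" by linarith
          then show "dist ((G (x + t *\<^sub>R v) - G x) / t) D < \<epsilon>" using qG[of t] t by (simp add: dist_real_def)
        qed (use e d in auto)
      qed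
      then have "DERIV (\<lambda>t. G (x + t *\<^sub>R v)) 0 :> D" by (simp add: has_field_derivative_iff)
      then show "(\<lambda>t. G (x + t *\<^sub>R v)) differentiable at 0" using real_differentiable_def by blast
    qed
  qed
  have "{x \<in> \<Omega>. \<not> (\<lambda>t. G (x + t *\<^sub>R v)) differentiable at 0} = {x \<in> \<Omega>. \<not> P x}" using eq by blast
  then show ?thesis using meas by simp
qed

text \<open>Averaging the translates of the exceptional set along \<open>v\<close> reduces the claim to the
  one-dimensional theorem, without splitting the space into lines.\<close>

lemma directional_nondifferentiable_null:
  fixes G :: "'a::euclidean_space \<Rightarrow> real"
  assumes \<Omega>: "open \<Omega>" and g: "(\<lambda>x. if x \<in> \<Omega> then G x else 0) \<in> borel_measurable borel"
    and lip: "\<And>x. x \<in> \<Omega> \<Longrightarrow> \<exists>d>0. \<exists>L. L-lipschitz_on {-d..d} (\<lambda>t. G (x + t *\<^sub>R v))"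
  shows "{x \<in> \<Omega>. \<not> (\<lambda>t. G (x + t *\<^sub>R v)) differentiable at 0} \<in> null_sets lborel" (is "?N \<in> _")
proof -
  have N [measurable]: "?N \<in> sets borel" by (rule directional_nondifferentiable_borel[OF assms])
  \<comment> \<open>Each line in direction \<open>v\<close> meets the exceptional set in a null set
    of parameters, whether or not its base point x lies in \<Omega>.\<close>
  have slice: "AE t in lborel. x + t *\<^sub>R v \<notin> ?N" for x
  proof -
    define S where "S = {t. x + t *\<^sub>R v \<in> \<Omega>}"
    define h where "h t = G (x + t *\<^sub>R v)" for t
    have "negligible {t\<in>S. \<not> h differentiable at t}"
    proof (rule locally_lipschitz_differentiable_ae)
      fix t assume "t \<in> S"
      then obtain d L where d: "d > 0" "L-lipschitz_on {-d..d} (\<lambda>s. G (x + t *\<^sub>R v + s *\<^sub>R v))" using lip[of "x + t *\<^sub>R v"] by (auto simp: S_def)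
      have "L-lipschitz_on {t-d..t+d} h"
      proof (rule lipschitz_onI)
        fix a b assume "a \<in> {t-d..t+d}" "b \<in> {t-d..t+d}"
        then show "dist (h a) (h b) \<le> L * dist a b"
          using lipschitz_onD[OF d(2), of "a - t" "b - t"] by (simp add: h_def dist_real_def algebra_simps)
      qed (rule lipschitz_on_nonneg[OF d(2)])
      then show "\<exists>d>0. \<exists>L. L-lipschitz_on {t-d..t+d} h" using d by blast
    qed
    moreover have "{t. x + t *\<^sub>R v \<in> ?N} \<subseteq> {t\<in>S. \<not> h differentiable at t}"
    proof clarsimp
      fix t assume t: "x + t *\<^sub>R v \<in> \<Omega>" and nd: "\<not> (\<lambda>s. G (x + t *\<^sub>R v + s *\<^sub>R v)) differentiable at 0"
      have "\<not> h differentiable at t"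
      proof
        assume "h differentiable at t"
        then obtain D where "DERIV h t :> D" using real_differentiable_def by blast
        then have "DERIV (\<lambda>s. h (s + t)) 0 :> D" using DERIV_shift[of h D 0 t] by simp
        then have "DERIV (\<lambda>s. G (x + t *\<^sub>R v + s *\<^sub>R v)) 0 :> D" by (simp add: h_def algebra_simps)
        then show False using nd real_differentiable_def by blast
      qed
      then show "t \<in> S \<and> \<not> h differentiable at t" using t by (simp add: S_def)
    qed
    ultimately have neg: "negligible {t. x + t *\<^sub>R v \<in> ?N}" using negligible_subset by blast
    have vi: "{t. x + t *\<^sub>R v \<in> ?N} = (\<lambda>t. x + t *\<^sub>R v) -` ?N \<inter> space borel" by auto
    have me: "(\<lambda>t. x + t *\<^sub>R v) \<in> measurable borel borel" by measurable
    have "{t. x + t *\<^sub>R v \<in> ?N} \<in> sets borel" unfolding vi by (rule measurable_sets[OF me N])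
    moreover note neg
    ultimately have "{t. x + t *\<^sub>R v \<in> ?N} \<in> null_sets lborel"
      by (simp add: negligible_iff_null_sets null_sets_completion_iff)
    then show ?thesis by (intro AE_I') auto
  qed
  have tr: "(\<integral>\<^sup>+x. indicator ?N (x + t *\<^sub>R v) \<partial>lborel) = emeasure lborel ?N" for t :: real
  proof -
    have "emeasure lborel ?N = (\<integral>\<^sup>+x. indicator ?N x \<partial>(distr lborel borel ((+) (t *\<^sub>R v))))"
      using N by (simp only: lborel_distr_plus) (simp add: nn_integral_indicator)
    also have "\<dots> = (\<integral>\<^sup>+x. indicator ?N (t *\<^sub>R v + x) \<partial>lborel)"
      by (rule nn_integral_distr) measurable
    finally show ?thesis by (simp add: add.commute)
  qed
  have [measurable]: "(\<lambda>p. indicator {0..1} (fst p) * indicator ?N (snd p + fst p *\<^sub>R v) :: ennreal) \<in> borel_measurable (lborel \<Otimes>\<^sub>M lborel)"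
  proof -
    have "(\<lambda>p. snd p + fst p *\<^sub>R v) \<in> measurable (lborel \<Otimes>\<^sub>M lborel) borel" by measurable
    then have "(\<lambda>p. indicator ?N (snd p + fst p *\<^sub>R v) :: ennreal) \<in> borel_measurable (lborel \<Otimes>\<^sub>M lborel)"
      by (rule measurable_compose) measurable
    then show ?thesis by measurable
  qed
  have "emeasure lborel ?N = (\<integral>\<^sup>+t. indicator {0..1::real} t * emeasure lborel ?N \<partial>lborel)"
    by (subst nn_integral_multc) auto
  also have "\<dots> = (\<integral>\<^sup>+t. (\<integral>\<^sup>+x. indicator {0..1::real} t * indicator ?N (x + t *\<^sub>R v) \<partial>lborel) \<partial>lborel)"
  proof (intro nn_integral_cong)
    fix t :: real
    have "(\<lambda>x. x + t *\<^sub>R v) \<in> measurable lborel borel" by measurable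
    then have "(\<lambda>x. indicator ?N (x + t *\<^sub>R v) :: ennreal) \<in> borel_measurable lborel"
      by (rule measurable_compose) measurable
    then show "indicator {0..1} t * emeasure lborel ?N = (\<integral>\<^sup>+x. indicator {0..1} t * indicator ?N (x + t *\<^sub>R v) \<partial>lborel)"
      by (simp only: nn_integral_cmult tr)
  qed
  also have "\<dots> = (\<integral>\<^sup>+x. (\<integral>\<^sup>+t. indicator {0..1::real} t * indicator ?N (x + t *\<^sub>R v) \<partial>lborel) \<partial>lborel)"
    using lborel_pair.Fubini'[of "\<lambda>t x. indicator {0..1::real} t * indicator ?N (x + t *\<^sub>R v)"] by (simp add: case_prod_beta)
  also have "\<dots> = (\<integral>\<^sup>+x. 0 \<partial>(lborel :: 'a measure))"
  proof (intro nn_integral_cong)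
    fix x :: 'a
    have "(\<integral>\<^sup>+t. indicator {0..1::real} t * indicator ?N (x + t *\<^sub>R v) \<partial>lborel) = (\<integral>\<^sup>+t. 0 \<partial>(lborel :: real measure))"
      using slice[of x] by (intro nn_integral_cong_AE) (auto elim!: eventually_mono simp: indicator_def)
    then show "(\<integral>\<^sup>+t. indicator {0..1::real} t * indicator ?N (x + t *\<^sub>R v) \<partial>lborel) = 0" by simp
  qed
  finally have "emeasure lborel ?N = 0" by simp
  then show ?thesis by (simp add: null_sets_def)
qed

text \<open>At points of non-differentiability \<open>deriv\<close> is an unspecified but fixed number, so no
  exceptional set appears here.\<close>

lemma directional_deriv_borel:
  fixes G :: "'a::euclidean_space \<Rightarrow> real"
  assumes \<Omega>: "open \<Omega>" and g: "(\<lambda>x. if x \<in> \<Omega> then G x else 0) \<in> borel_measurable borel"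
    and lip: "\<And>x. x \<in> \<Omega> \<Longrightarrow> \<exists>d>0. \<exists>L. L-lipschitz_on {-d..d} (\<lambda>t. G (x + t *\<^sub>R v))"
  shows "(\<lambda>x. if x \<in> \<Omega> then deriv (\<lambda>t. G (x + t *\<^sub>R v)) 0 else 0) \<in> borel_measurable borel"
proof -
  let ?N = "{x \<in> \<Omega>. \<not> (\<lambda>t. G (x + t *\<^sub>R v)) differentiable at 0}"
  have N [measurable]: "?N \<in> sets borel" by (rule directional_nondifferentiable_borel[OF assms])
  have O [measurable]: "\<Omega> \<in> sets borel" using \<Omega> by simp
  define g where "g x = (if x \<in> \<Omega> then G x else 0)" for x
  have gm [measurable]: "g \<in> borel_measurable borel" using g by (simp add: g_def[abs_def])
  define q where "q n x = (g (x + inverse (real (Suc n)) *\<^sub>R v) - g x) / inverse (real (Suc n))" for n x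
  have [measurable]: "q n \<in> borel_measurable borel" for n unfolding q_def by measurable
  \<comment> \<open>Where no derivative exists, the predicate under the choice operator in
    \<open>deriv\<close> is constantly false, so the default value of \<open>deriv\<close> is
    exactly this number.\<close>
  define c where "c = (SOME D::real. False)"
  have "(\<lambda>x. if x \<in> \<Omega> then (if x \<in> ?N then c else lim (\<lambda>n. q n x)) else 0) \<in> borel_measurable borel"
    by measurable
  moreover have eq: "(if x \<in> ?N then c else lim (\<lambda>n. q n x)) = deriv (\<lambda>t. G (x + t *\<^sub>R v)) 0" if x: "x \<in> \<Omega>" for x
  proof (cases "x \<in> ?N")
    case True
    then have "\<And>D. \<not> DERIV (\<lambda>t. G (x + t *\<^sub>R v)) 0 :> D" using real_differentiable_def by blast
    then show ?thesis using True by (simp add: deriv_def c_def)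
  next
    case False
    then obtain D where D: "DERIV (\<lambda>t. G (x + t *\<^sub>R v)) 0 :> D" using x real_differentiable_def by blast
    then have lim: "((\<lambda>t. (G (x + t *\<^sub>R v) - G x) / t) \<longlongrightarrow> D) (at 0)" by (simp add: has_field_derivative_iff)
    have "filterlim (\<lambda>n. inverse (real (Suc n))) (at 0) sequentially"
      using LIMSEQ_inverse_real_of_nat by (auto simp: filterlim_at)
    from filterlim_compose[OF lim this]
    have "(\<lambda>n. (G (x + inverse (real (Suc n)) *\<^sub>R v) - G x) / inverse (real (Suc n))) \<longlonglongrightarrow> D" .
    moreover have "\<forall>\<^sub>F n in sequentially. (G (x + inverse (real (Suc n)) *\<^sub>R v) - G x) / inverse (real (Suc n)) = q n x"
    proof -
      have "(\<lambda>n. x + inverse (real (Suc n)) *\<^sub>R v) \<longlonglongrightarrow> x + 0 *\<^sub>R v"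
        by (intro tendsto_intros LIMSEQ_inverse_real_of_nat)
      then have "\<forall>\<^sub>F n in sequentially. x + inverse (real (Suc n)) *\<^sub>R v \<in> \<Omega>"
        using \<Omega> x by (intro topological_tendstoD) auto
      then show ?thesis by eventually_elim (use x in \<open>simp add: q_def g_def\<close>)
    qed
    ultimately have "(\<lambda>n. q n x) \<longlonglongrightarrow> D" by (rule Lim_transform_eventually)
    then show ?thesis using False D x by (auto simp: limI DERIV_imp_deriv)
  qed
  have "(\<lambda>x. if x \<in> \<Omega> then (if x \<in> ?N then c else lim (\<lambda>n. q n x)) else 0) = (\<lambda>x. if x \<in> \<Omega> then deriv (\<lambda>t. G (x + t *\<^sub>R v)) 0 else 0)"
  proof
    fix x
    show "(if x \<in> \<Omega> then (if x \<in> ?N then c else lim (\<lambda>n. q n x)) else 0) = (if x \<in> \<Omega> then deriv (\<lambda>t. G (x + t *\<^sub>R v)) 0 else 0)"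
    proof (cases "x \<in> \<Omega>")
      case True
      then show ?thesis unfolding if_P[OF True] by (rule eq)
    next
      case False
      then show ?thesis unfolding if_not_P[OF False] by simp
    qed
  qed
  ultimately show ?thesis by (simp only:)
qed

subsection \<open>Integration by parts\<close>

text \<open>The Lipschitz constant and the admissible step are uniform on each smaller ball, but
  only along \<open>v\<close>: this is what dominates the difference quotients of \<open>G\<close>
  in that direction on the support of a test function.\<close>

definition unit_ball_dir_lipschitz :: "'a::euclidean_space \<Rightarrow> ('a \<Rightarrow> real) \<Rightarrow> bool" where
  "unit_ball_dir_lipschitz v G \<longleftrightarrow> continuous_on (ball 0 1) G \<and>
     (\<forall>\<rho><1. \<exists>r>0. \<exists>L\<ge>0. \<forall>x\<in>cball 0 \<rho>. \<forall>t. \<bar>t\<bar> \<le> r \<longrightarrow> \<bar>G (x + t *\<^sub>R v) - G x\<bar> \<le> L * \<bar>t\<bar>)"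

lemma lipschitz_on_line_at:
  fixes G :: "'a::real_normed_vector \<Rightarrow> real"
  assumes r: "0 < r" and e: "0 < e" and v: "norm v = 1"
    and L: "0 \<le> L" and b: "\<And>y t. y \<in> cball x e \<Longrightarrow> \<bar>t\<bar> \<le> r \<Longrightarrow> \<bar>G (y + t *\<^sub>R v) - G y\<bar> \<le> L * \<bar>t\<bar>"
  shows "\<exists>d>0. \<exists>L. L-lipschitz_on {-d..d} (\<lambda>t. G (x + t *\<^sub>R v))"
proof -
  define d where "d = min (r/2) e"
  have d: "0 < d" using r e by (simp add: d_def)
  have "L-lipschitz_on {-d..d} (\<lambda>t. G (x + t *\<^sub>R v))"
  proof (rule lipschitz_onI)
    fix s t assume st: "s \<in> {-d..d}" "t \<in> {-d..d}"
    have "\<bar>t\<bar> \<le> e" "\<bar>s - t\<bar> \<le> r" using st unfolding d_def by (auto simp: abs_le_iff)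
    then have "\<bar>G ((x + t *\<^sub>R v) + (s - t) *\<^sub>R v) - G (x + t *\<^sub>R v)\<bar> \<le> L * \<bar>s - t\<bar>"
      using v by (intro b) (auto simp: dist_norm)
    then show "dist (G (x + s *\<^sub>R v)) (G (x + t *\<^sub>R v)) \<le> L * dist s t"
      by (simp add: dist_real_def algebra_simps)
  qed (rule L)
  then show ?thesis using d by blast
qed

lemma unit_ball_dir_lipschitz_line:
  assumes G: "unit_ball_dir_lipschitz v G" and v: "norm v = 1" and x: "x \<in> ball 0 1"
  shows "\<exists>d>0. \<exists>L. L-lipschitz_on {-d..d} (\<lambda>t. G (x + t *\<^sub>R v))"
proof -
  define \<rho> where "\<rho> = (1 + norm x) / 2"
  have "\<rho> < 1" using x by (simp add: \<rho>_def)
  then obtain r L where rL: "0 < r" "0 \<le> L" "\<And>y t. y \<in> cball 0 \<rho> \<Longrightarrow> \<bar>t\<bar> \<le> r \<Longrightarrow> \<bar>G (y + t *\<^sub>R v) - G y\<bar> \<le> L * \<bar>t\<bar>"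
    using G unfolding unit_ball_dir_lipschitz_def by metis
  have "y \<in> cball 0 \<rho>" if "y \<in> cball x ((1 - norm x)/2)" for y
    using that norm_triangle_ineq2[of y x] by (simp add: \<rho>_def dist_norm norm_minus_commute field_simps)
  then show ?thesis using rL x v by (intro lipschitz_on_line_at[of r "(1 - norm x)/2" v L]) auto
qed

lemma borel_on_ball_if:
  fixes G :: "'a::euclidean_space \<Rightarrow> real"
  assumes "continuous_on (ball 0 1) G"
  shows "(\<lambda>x. if x \<in> ball 0 1 then G x else 0) \<in> borel_measurable borel"
  by (rule borel_measurable_continuous_on_if) (use assms in auto)

text \<open>\<open>g\<close> is bounded only on smaller balls. Increments of at most (1 - \<rho>)/2
  keep all quotients of \<psi> supported in the ball of radius (1 + \<rho>)/2, which is below 1, and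
  the mean value theorem bounds them there; so convergence is dominated.\<close>

lemma difference_quotient_integral_tendsto:
  fixes g \<psi> d\<psi> :: "'a::euclidean_space \<Rightarrow> real"
  assumes gm [measurable]: "g \<in> borel_measurable borel"
    and gb: "\<And>\<rho>. \<rho> < 1 \<Longrightarrow> \<exists>B. \<forall>x\<in>cball 0 \<rho>. \<bar>g x\<bar> \<le> B"
    and \<psi>c: "continuous_on UNIV \<psi>" and d: "\<And>x. DERIV (\<lambda>t. \<psi> (x + t *\<^sub>R v)) 0 :> d\<psi> x" and dc: "continuous_on UNIV d\<psi>"
    and \<rho>: "\<rho> < 1" and supp: "\<And>x. x \<notin> cball 0 \<rho> \<Longrightarrow> \<psi> x = 0" and v: "norm v = 1"
    and X: "X \<longlonglongrightarrow> 0" "\<And>n. 0 < X n" "\<And>n. X n \<le> (1 - \<rho>) / 2"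
  shows "integrable lborel (\<lambda>x. g x * d\<psi> x)"
    and "\<And>n. integrable lborel (\<lambda>x. g x * ((\<psi> (x + X n *\<^sub>R v) - \<psi> x) / X n))"
    and "(\<lambda>n. LINT x|lborel. g x * ((\<psi> (x + X n *\<^sub>R v) - \<psi> x) / X n)) \<longlonglongrightarrow> (LINT x|lborel. g x * d\<psi> x)"
proof -
  have dz: "d\<psi> x = 0" if "x \<notin> cball 0 \<rho>" for x
  proof -
    have "\<forall>\<^sub>F t in nhds 0. \<psi> (x + t *\<^sub>R v) = 0"
    proof -
      have "open (- cball 0 \<rho> :: 'a set)" by (simp add: open_Compl)
      moreover have "((\<lambda>t. x + t *\<^sub>R v) \<longlongrightarrow> x + 0 *\<^sub>R v) (nhds 0)"
        by (intro tendsto_intros filterlim_ident)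
      ultimately have "\<forall>\<^sub>F t in nhds (0::real). x + t *\<^sub>R v \<in> - cball 0 \<rho>"
        using that by (intro topological_tendstoD) auto
      then show ?thesis by eventually_elim (use supp in auto)
    qed
    then have "DERIV (\<lambda>t. \<psi> (x + t *\<^sub>R v)) 0 :> 0"
      by (subst DERIV_cong_ev[OF refl _ refl, where g="\<lambda>t. 0"]) auto
    then show ?thesis using d DERIV_unique by blast
  qed
  have "bounded (d\<psi> ` cball 0 \<rho>)"
    using dc by (intro compact_imp_bounded compact_continuous_image) (auto elim: continuous_on_subset)
  then obtain B where B: "0 < B" "\<And>x. x \<in> cball 0 \<rho> \<Longrightarrow> \<bar>d\<psi> x\<bar> \<le> B" by (auto simp: bounded_pos)
  have B': "\<bar>d\<psi> x\<bar> \<le> B" for x using B(2)[of x] dz[of x] B(1) by (cases "x \<in> cball 0 \<rho>") auto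
  have dt: "DERIV (\<lambda>t. \<psi> (x + t *\<^sub>R v)) s :> d\<psi> (x + s *\<^sub>R v)" for x s
    using d[of "x + s *\<^sub>R v"] DERIV_shift[of "\<lambda>t. \<psi> (x + t *\<^sub>R v)" "d\<psi> (x + s *\<^sub>R v)" 0 s]
    by (simp add: algebra_simps)
  have dq: "\<bar>(\<psi> (x + t *\<^sub>R v) - \<psi> x) / t\<bar> \<le> B" if t: "0 < t" for x t
  proof -
    obtain z where "\<psi> (x + t *\<^sub>R v) - \<psi> (x + 0 *\<^sub>R v) = (t - 0) * d\<psi> (x + z *\<^sub>R v)"
      using MVT2[OF t, of "\<lambda>t. \<psi> (x + t *\<^sub>R v)" "\<lambda>s. d\<psi> (x + s *\<^sub>R v)"] dt by blast
    then show ?thesis using t B' by simp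
  qed
  define \<rho>' where "\<rho>' = (1 + \<rho>) / 2"
  have \<rho>': "\<rho>' < 1" "\<rho> \<le> \<rho>'" using \<rho> by (auto simp: \<rho>'_def)
  obtain A where A: "\<And>x. x \<in> cball 0 \<rho>' \<Longrightarrow> \<bar>g x\<bar> \<le> A" using gb[OF \<rho>'(1)] by blast
  have Xz: "\<psi> (x + X n *\<^sub>R v) - \<psi> x = 0" if "x \<notin> cball 0 \<rho>'" for x n
  proof -
    have "norm x > \<rho>'" using that by simp
    moreover have "norm x - X n \<le> norm (x + X n *\<^sub>R v)"
      using norm_triangle_ineq4[of "x + X n *\<^sub>R v" "X n *\<^sub>R v"] v X(2)[of n] by simp
    ultimately have "norm (x + X n *\<^sub>R v) > \<rho>" "norm x > \<rho>" using X(3)[of n] \<rho>' by (auto simp: \<rho>'_def field_simps)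
    then show ?thesis using supp by simp
  qed
  define w where "w x = (max A 0) * B * indicat_real (cball 0 \<rho>') x" for x :: 'a
  have wi: "integrable lborel w"
    unfolding w_def by (intro integrable_mult_right integrable_real_indicator emeasure_bounded_finite) auto
  have \<psi>m [measurable]: "\<psi> \<in> borel_measurable borel" and dm [measurable]: "d\<psi> \<in> borel_measurable borel"
    using \<psi>c dc by (auto intro: borel_measurable_continuous_onI)
  have lim: "(\<lambda>n. g x * ((\<psi> (x + X n *\<^sub>R v) - \<psi> x) / X n)) \<longlonglongrightarrow> g x * d\<psi> x" for x
  proof -
    have "((\<lambda>t. (\<psi> (x + t *\<^sub>R v) - \<psi> (x + 0 *\<^sub>R v)) / (t - 0)) \<longlongrightarrow> d\<psi> x) (at 0)"
      using d[of x] by (simp add: has_field_derivative_iff)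
    moreover have "filterlim X (at 0) sequentially" using X(1,2) by (auto simp: filterlim_at eventually_sequentially intro!: exI[of _ 0] less_imp_neq[symmetric])
    ultimately have "(\<lambda>n. (\<psi> (x + X n *\<^sub>R v) - \<psi> (x + 0 *\<^sub>R v)) / (X n - 0)) \<longlonglongrightarrow> d\<psi> x" by (rule filterlim_compose)
    then show ?thesis by (intro tendsto_mult_left) simp
  qed
  have bd: "norm (g x * ((\<psi> (x + X n *\<^sub>R v) - \<psi> x) / X n)) \<le> w x" for x n
  proof (cases "x \<in> cball 0 \<rho>'")
    case True
    have "\<bar>g x\<bar> * \<bar>(\<psi> (x + X n *\<^sub>R v) - \<psi> x) / X n\<bar> \<le> max A 0 * B"
      using A[OF True] dq[OF X(2)] by (intro mult_mono) auto
    then show ?thesis using True by (simp add: w_def abs_mult)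
  next
    case False
    then show ?thesis using Xz[OF False, of n] by (simp add: w_def)
  qed
  have m1: "(\<lambda>x. g x * d\<psi> x) \<in> borel_measurable lborel" by measurable
  have m2: "(\<lambda>x. g x * ((\<psi> (x + X n *\<^sub>R v) - \<psi> x) / X n)) \<in> borel_measurable lborel" for n by measurable
  have a1: "AE x in lborel. (\<lambda>n. g x * ((\<psi> (x + X n *\<^sub>R v) - \<psi> x) / X n)) \<longlonglongrightarrow> g x * d\<psi> x" using lim by simp
  have a2: "AE x in lborel. norm (g x * ((\<psi> (x + X n *\<^sub>R v) - \<psi> x) / X n)) \<le> w x" for n using bd by simp
  show "integrable lborel (\<lambda>x. g x * d\<psi> x)" by (rule integrable_dominated_convergence[OF m1 m2 wi a1 a2])
  show "integrable lborel (\<lambda>x. g x * ((\<psi> (x + X n *\<^sub>R v) - \<psi> x) / X n))" for n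
    by (rule integrable_dominated_convergence2[OF m1 m2 wi a1 a2])
  show "(\<lambda>n. LINT x|lborel. g x * ((\<psi> (x + X n *\<^sub>R v) - \<psi> x) / X n)) \<longlonglongrightarrow> (LINT x|lborel. g x * d\<psi> x)"
    by (rule integral_dominated_convergence[OF m1 m2 wi a1 a2])
qed

lemma lborel_integral_translate:
  fixes f :: "'a::euclidean_space \<Rightarrow> real"
  assumes [measurable]: "f \<in> borel_measurable borel"
  shows "(LINT x|lborel. f (x + c)) = (LINT x|lborel. f x)" and "integrable lborel (\<lambda>x. f (x + c)) \<longleftrightarrow> integrable lborel f"
proof -
  have "(LINT x|lborel. f x) = (LINT x|distr lborel borel ((+) c). f x)" by (simp only: lborel_distr_plus)
  also have "\<dots> = (LINT x|lborel. f (c + x))" by (rule integral_distr) measurable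
  finally show "(LINT x|lborel. f (x + c)) = (LINT x|lborel. f x)" by (simp add: add.commute)
  have "integrable lborel f \<longleftrightarrow> integrable (distr lborel borel ((+) c)) f" by (simp only: lborel_distr_plus)
  also have "\<dots> \<longleftrightarrow> integrable lborel (\<lambda>x. f (c + x))" by (rule integrable_distr_eq) measurable
  finally show "integrable lborel (\<lambda>x. f (x + c)) \<longleftrightarrow> integrable lborel f" by (simp add: add.commute)
qed

lemma unit_ball_dir_lipschitz_locally_bounded:
  assumes G: "unit_ball_dir_lipschitz v G" and \<rho>: "\<rho> < 1"
  shows "\<exists>B. \<forall>x\<in>cball 0 \<rho>. \<bar>if x \<in> ball 0 1 then G x else 0\<bar> \<le> B"
proof -
  have "continuous_on (cball 0 \<rho>) G"
    using G \<rho> unfolding unit_ball_dir_lipschitz_def by (auto elim: continuous_on_subset)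
  then have "bounded (G ` cball 0 \<rho>)" by (intro compact_imp_bounded compact_continuous_image) auto
  then obtain B where "0 < B" "\<And>x. x \<in> cball 0 \<rho> \<Longrightarrow> \<bar>G x\<bar> \<le> B" by (auto simp: bounded_pos)
  then show ?thesis by (intro exI[of _ B]) auto
qed

text \<open>Translation invariance moves the difference quotient from \<psi> to \<open>G\<close>,
  with the opposite sign. Both sides then converge by dominated convergence; on the side of
  \<open>G\<close> this uses differentiability along \<open>v\<close> almost everywhere and the
  Lipschitz bound.\<close>

lemma unit_ball_integration_by_parts:
  fixes G \<psi> d\<psi> :: "'a::euclidean_space \<Rightarrow> real"
  assumes G: "unit_ball_dir_lipschitz v G" and v: "norm v = 1"
    and \<psi>c: "continuous_on UNIV \<psi>" and d: "\<And>x. DERIV (\<lambda>t. \<psi> (x + t *\<^sub>R v)) 0 :> d\<psi> x" and dc: "continuous_on UNIV d\<psi>"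
    and \<rho>: "\<rho> < 1" and supp: "\<And>x. x \<notin> cball 0 \<rho> \<Longrightarrow> \<psi> x = 0"
  defines "g \<equiv> \<lambda>x. if x \<in> ball 0 1 then G x else 0"
    and "D \<equiv> \<lambda>x. if x \<in> ball 0 1 then deriv (\<lambda>t. G (x + t *\<^sub>R v)) 0 else 0"
  shows "integrable lborel (\<lambda>x. g x * d\<psi> x)" "integrable lborel (\<lambda>x. D x * \<psi> x)"
    "(LINT x|lborel. g x * d\<psi> x) = - (LINT x|lborel. D x * \<psi> x)"
proof -
  have gm [measurable]: "g \<in> borel_measurable borel"
    unfolding g_def using G unfolding unit_ball_dir_lipschitz_def by (intro borel_on_ball_if) auto
  have lipl: "\<exists>d>0. \<exists>L. L-lipschitz_on {-d..d} (\<lambda>t. G (x + t *\<^sub>R v))" if "x \<in> ball 0 1" for x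
    by (rule unit_ball_dir_lipschitz_line[OF G v that])
  have Dm [measurable]: "D \<in> borel_measurable borel"
    unfolding D_def by (rule directional_deriv_borel[OF open_ball gm[unfolded g_def] lipl])
  have null: "{x \<in> ball 0 1. \<not> (\<lambda>t. G (x + t *\<^sub>R v)) differentiable at 0} \<in> null_sets lborel"
    by (rule directional_nondifferentiable_null[OF open_ball gm[unfolded g_def] lipl])
  obtain r L where rL: "0 < r" "0 \<le> L" "\<And>x t. x \<in> cball 0 \<rho> \<Longrightarrow> \<bar>t\<bar> \<le> r \<Longrightarrow> \<bar>G (x + t *\<^sub>R v) - G x\<bar> \<le> L * \<bar>t\<bar>"
    using G \<rho> unfolding unit_ball_dir_lipschitz_def by metis
  \<comment> \<open>The first term keeps increments within reach of the Lipschitz bound, the second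
    keeps the shifted points inside the unit ball.\<close>
  define e where "e = min r ((1 - \<rho>) / 2)"
  have e: "0 < e" using rL \<rho> by (simp add: e_def)
  define X where "X n = e * inverse (real (Suc n))" for n
  have X0: "X \<longlonglongrightarrow> 0" unfolding X_def using tendsto_mult_left[OF LIMSEQ_inverse_real_of_nat, of e] by simp
  have Xp: "0 < X n" for n using e by (simp add: X_def)
  have Xe: "X n \<le> e" for n using e by (simp add: X_def field_simps)
  have Xr: "X n \<le> r" "X n \<le> (1 - \<rho>) / 2" for n using Xe[of n] by (auto simp: e_def)
  have gb: "\<exists>B. \<forall>x\<in>cball 0 \<sigma>. \<bar>g x\<bar> \<le> B" if "\<sigma> < 1" for \<sigma>
    using unit_ball_dir_lipschitz_locally_bounded[OF G that] unfolding g_def .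
  note DQ = difference_quotient_integral_tendsto[OF gm gb \<psi>c d dc \<rho> supp v X0 Xp Xr(2)]
  show int1: "integrable lborel (\<lambda>x. g x * d\<psi> x)" using DQ(1) by simp
  have \<psi>m [measurable]: "\<psi> \<in> borel_measurable borel" using \<psi>c by (rule borel_measurable_continuous_onI)
  have gx: "g (x - X n *\<^sub>R v) = G (x - X n *\<^sub>R v)" "g x = G x" if "x \<in> cball 0 \<rho>" for x n
  proof -
    have "norm (x - X n *\<^sub>R v) \<le> \<rho> + X n" using norm_triangle_ineq4[of x "X n *\<^sub>R v"] that v Xp[of n] by simp
    then have "norm (x - X n *\<^sub>R v) < 1" using Xr(2)[of n] \<rho> by (simp add: field_simps)
    then show "g (x - X n *\<^sub>R v) = G (x - X n *\<^sub>R v)" "g x = G x" using that \<rho> by (auto simp: g_def)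
  qed
  have "bounded (\<psi> ` cball 0 \<rho>)"
    using \<psi>c by (intro compact_imp_bounded compact_continuous_image) (auto elim: continuous_on_subset)
  then obtain A where "\<forall>x\<in>cball 0 \<rho>. \<bar>\<psi> x\<bar> \<le> A" by (auto simp: bounded_pos)
  then have A: "\<bar>\<psi> x\<bar> \<le> A" if "x \<in> cball 0 \<rho>" for x using that by blast
  have \<psi>i: "integrable lborel (\<lambda>x. h x * \<psi> x)" if hm [measurable]: "h \<in> borel_measurable borel" and hB: "\<And>x. x \<in> cball 0 \<rho> \<Longrightarrow> \<bar>h x\<bar> \<le> B" for h B
  proof (rule Bochner_Integration.integrable_bound)
    show "integrable lborel (\<lambda>x::'a. (max B 0 * max A 0) * indicat_real (cball 0 \<rho>) x)"
      by (intro integrable_mult_right integrable_real_indicator emeasure_bounded_finite) auto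
    show "AE x in lborel. norm (h x * \<psi> x) \<le> norm ((max B 0 * max A 0) * indicat_real (cball 0 \<rho>) x)"
    proof (rule AE_I2)
      fix x :: 'a
      show "norm (h x * \<psi> x) \<le> norm ((max B 0 * max A 0) * indicat_real (cball 0 \<rho>) x)"
      proof (cases "x \<in> cball 0 \<rho>")
        case True
        have "\<bar>h x\<bar> * \<bar>\<psi> x\<bar> \<le> max B 0 * max A 0" using hB[OF True] A[OF True] by (intro mult_mono) auto
        then show ?thesis using True by (simp add: abs_mult)
      qed (use supp in simp)
    qed
  qed measurable
  have "(1+\<rho>)/2 < 1" using \<rho> by simp
  from gb[OF this] obtain B1 where B1: "\<And>x. x \<in> cball 0 ((1+\<rho>)/2) \<Longrightarrow> \<bar>g x\<bar> \<le> B1" by blast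
  have shiftb: "\<bar>g (x - X n *\<^sub>R v)\<bar> \<le> B1" "\<bar>g x\<bar> \<le> B1" if "x \<in> cball 0 \<rho>" for x n
  proof -
    have "norm (x - X n *\<^sub>R v) \<le> \<rho> + X n" using norm_triangle_ineq4[of x "X n *\<^sub>R v"] that v Xp[of n] by simp
    then show "\<bar>g (x - X n *\<^sub>R v)\<bar> \<le> B1" using Xr(2)[of n] by (intro B1) (simp add: field_simps)
    show "\<bar>g x\<bar> \<le> B1" using that \<rho> by (intro B1) (simp add: field_simps)
  qed
  \<comment> \<open>Discrete integration by parts: substitute x - X n v for x in the term with the
    shifted \<psi>.\<close>
  have eqn: "(LINT x|lborel. g x * ((\<psi> (x + X n *\<^sub>R v) - \<psi> x) / X n)) = (LINT x|lborel. (g (x - X n *\<^sub>R v) - g x) / X n * \<psi> x)" for n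
  proof -
    have i1: "integrable lborel (\<lambda>x. g (x - X n *\<^sub>R v) * \<psi> x)" by (rule \<psi>i[where h="\<lambda>x. g (x - X n *\<^sub>R v)" and B=B1]) (measurable, rule shiftb)
    have i2: "integrable lborel (\<lambda>x. g x * \<psi> x)" by (rule \<psi>i[where h=g and B=B1, OF gm shiftb(2)])
    have m: "(\<lambda>x. g (x - X n *\<^sub>R v) * \<psi> x) \<in> borel_measurable borel" by measurable
    have t: "(LINT x|lborel. g x * \<psi> (x + X n *\<^sub>R v)) = (LINT x|lborel. g (x - X n *\<^sub>R v) * \<psi> x)"
      using lborel_integral_translate(1)[OF m, of "X n *\<^sub>R v"] by simp
    have i3: "integrable lborel (\<lambda>x. g x * \<psi> (x + X n *\<^sub>R v))"
      using lborel_integral_translate(2)[OF m, of "X n *\<^sub>R v"] i1 by simp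
    have "(LINT x|lborel. g x * ((\<psi> (x + X n *\<^sub>R v) - \<psi> x) / X n)) = (LINT x|lborel. (g x * \<psi> (x + X n *\<^sub>R v) - g x * \<psi> x) / X n)"
      by (simp add: algebra_simps diff_divide_distrib)
    also have "\<dots> = ((LINT x|lborel. g (x - X n *\<^sub>R v) * \<psi> x) - (LINT x|lborel. g x * \<psi> x)) / X n"
      using i2 i3 by (simp add: t)
    also have "\<dots> = (LINT x|lborel. (g (x - X n *\<^sub>R v) * \<psi> x - g x * \<psi> x) / X n)" using i1 i2 by simp
    finally show ?thesis by (simp add: algebra_simps diff_divide_distrib)
  qed
  define w where "w x = L * max A 0 * indicat_real (cball 0 \<rho>) x" for x :: 'a
  have wi: "integrable lborel w"
    unfolding w_def by (intro integrable_mult_right integrable_real_indicator emeasure_bounded_finite) auto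
  have bd: "AE x in lborel. norm ((g (x - X n *\<^sub>R v) - g x) / X n * \<psi> x) \<le> w x" for n
  proof (rule AE_I2)
    fix x :: 'a
    show "norm ((g (x - X n *\<^sub>R v) - g x) / X n * \<psi> x) \<le> w x"
    proof (cases "x \<in> cball 0 \<rho>")
      case True
      have "\<bar>G (x + (- X n) *\<^sub>R v) - G x\<bar> \<le> L * \<bar>- X n\<bar>" using Xp[of n] Xr(1)[of n] by (intro rL(3) True) auto
      then have "\<bar>g (x - X n *\<^sub>R v) - g x\<bar> / X n \<le> L" using Xp[of n] by (simp add: gx[OF True] field_simps)
      then have "\<bar>(g (x - X n *\<^sub>R v) - g x) / X n\<bar> * \<bar>\<psi> x\<bar> \<le> L * max A 0"
        using A[OF True] rL(2) Xp[of n] by (intro mult_mono) auto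
      then show ?thesis using True by (simp add: w_def abs_mult)
    qed (use supp in \<open>simp add: w_def\<close>)
  qed
  have lim: "AE x in lborel. (\<lambda>n. (g (x - X n *\<^sub>R v) - g x) / X n * \<psi> x) \<longlonglongrightarrow> - (D x * \<psi> x)"
    using AE_not_in[OF null]
  proof eventually_elim
    case (elim x)
    show ?case
    proof (cases "x \<in> cball 0 \<rho>")
      case True
      then have xb: "x \<in> ball 0 1" using \<rho> by auto
      then have "(\<lambda>t. G (x + t *\<^sub>R v)) differentiable at 0" using elim by blast
      then obtain D' where D': "DERIV (\<lambda>t. G (x + t *\<^sub>R v)) 0 :> D'" using real_differentiable_def by blast
      then have DD: "D x = D'" using xb by (simp add: D_def DERIV_imp_deriv)
      have "((\<lambda>t. (G (x + t *\<^sub>R v) - G (x + 0 *\<^sub>R v)) / (t - 0)) \<longlongrightarrow> D') (at 0)"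
        using D' by (simp add: has_field_derivative_iff)
      moreover have "filterlim (\<lambda>n. - X n) (at 0) sequentially"
        using tendsto_minus[OF X0] Xp by (auto simp: filterlim_at eventually_sequentially intro!: exI[of _ 0] less_imp_neq[symmetric])
      ultimately have "(\<lambda>n. (G (x + (- X n) *\<^sub>R v) - G (x + 0 *\<^sub>R v)) / (- X n - 0)) \<longlonglongrightarrow> D'" by (rule filterlim_compose)
      then have "(\<lambda>n. - ((g (x - X n *\<^sub>R v) - g x) / X n)) \<longlonglongrightarrow> D'" by (simp add: gx[OF True])
      from tendsto_mult_right[OF tendsto_minus[OF this], of "\<psi> x"] show ?thesis by (simp add: DD)
    qed (use supp in simp)
  qed
  have m1: "(\<lambda>x. - (D x * \<psi> x)) \<in> borel_measurable lborel" by measurable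
  have m2: "(\<lambda>x. (g (x - X n *\<^sub>R v) - g x) / X n * \<psi> x) \<in> borel_measurable lborel" for n by measurable
  have "integrable lborel (\<lambda>x. - (D x * \<psi> x))" by (rule integrable_dominated_convergence[OF m1 m2 wi lim bd])
  then show int2: "integrable lborel (\<lambda>x. D x * \<psi> x)" by simp
  have "(\<lambda>n. LINT x|lborel. (g (x - X n *\<^sub>R v) - g x) / X n * \<psi> x) \<longlonglongrightarrow> (LINT x|lborel. - (D x * \<psi> x))"
    by (rule integral_dominated_convergence[OF m1 m2 wi lim bd])
  moreover have "(\<lambda>n. LINT x|lborel. (g (x - X n *\<^sub>R v) - g x) / X n * \<psi> x) \<longlonglongrightarrow> (LINT x|lborel. g x * d\<psi> x)"
    using DQ(3) unfolding eqn .
  ultimately have "(LINT x|lborel. g x * d\<psi> x) = (LINT x|lborel. - (D x * \<psi> x))" by (rule LIMSEQ_unique[rotated])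
  then show "(LINT x|lborel. g x * d\<psi> x) = - (LINT x|lborel. D x * \<psi> x)" by simp
qed

subsection \<open>Second differences and partial derivatives\<close>

text \<open>If the difference \<open>k\<close> between \<open>g\<close> and its chord had a positive
  maximum, then at the leftmost maximiser z the value k (z - e) would be strictly smaller and k (z +
  e) not larger, against the midpoint inequality at z.\<close>

lemma midpoint_convex_imp_convex:
  fixes g :: "'a::real_normed_vector \<Rightarrow> real"
  assumes S: "convex S" and cont: "continuous_on S g"
    and mid: "\<And>x y. x \<in> S \<Longrightarrow> y \<in> S \<Longrightarrow> 2 * g (midpoint x y) \<le> g x + g y"
  shows "convex_on S g"
proof (rule convex_onI[OF _ S])
  fix t x y assume t: "0 < t" "t < (1::real)" and xy: "x \<in> S" "y \<in> S"
  define c where "c s = (1 - s) *\<^sub>R x + s *\<^sub>R y" for s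
  define k where "k s = g (c s) - ((1 - s) * g x + s * g y)" for s
  have cS: "c s \<in> S" if "s \<in> {0..1}" for s
    using convexD_alt[OF S xy] that by (simp add: c_def)
  have "continuous_on {0..1} (\<lambda>s. g (c s))"
    by (rule continuous_on_compose2[OF cont]) (auto simp: c_def intro!: continuous_intros cS[unfolded c_def])
  then have kcont: "continuous_on {0..1} k"
    unfolding k_def by (intro continuous_intros)
  have kmid: "2 * k ((s + r) / 2) \<le> k s + k r" if "s \<in> {0..1}" "r \<in> {0..1}" for s r
  proof -
    have "midpoint (c s) (c r) = c ((s + r) / 2)"
      by (simp add: c_def midpoint_def algebra_simps flip: scaleR_add_left)
    then have "2 * g (c ((s + r) / 2)) \<le> g (c s) + g (c r)" using mid[OF cS cS] that by metis
    then show ?thesis by (simp add: k_def field_simps)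
  qed
  have k01: "k 0 = 0" "k 1 = 0" by (simp_all add: k_def c_def)
  have "k t \<le> 0"
  proof (rule ccontr)
    assume "\<not> k t \<le> 0"
    obtain m where m: "m \<in> {0..1}" "\<And>s. s \<in> {0..1} \<Longrightarrow> k s \<le> k m"
      using continuous_attains_sup[OF compact_Icc _ kcont] by fastforce
    have mpos: "0 < k m" using m(2)[of t] t \<open>\<not> k t \<le> 0\<close> by auto
    define Z where "Z = {s \<in> {0..1}. k s = k m}"
    have "closed Z" unfolding Z_def
      using continuous_closed_preimage[OF kcont, of "{k m}"] by (simp add: vimage_def Int_def conj_commute)
    moreover have "Z \<noteq> {}" using m(1) by (auto simp: Z_def)
    moreover have bb: "bdd_below Z" by (rule bdd_belowI[of _ 0]) (auto simp: Z_def)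
    ultimately have z: "Inf Z \<in> Z" by (intro closed_contains_Inf)
    define z where "z = Inf Z"
    have z01: "0 \<le> z" "z \<le> 1" "k z = k m" using z by (auto simp: z_def Z_def)
    then have "z \<noteq> 0" "z \<noteq> 1" using k01 mpos by auto
    define e where "e = min z (1 - z)"
    have e: "0 < e" "z - e \<in> {0..1}" "z + e \<in> {0..1}"
      using z01 \<open>z \<noteq> 0\<close> \<open>z \<noteq> 1\<close> by (auto simp: e_def)
    have "z - e \<notin> Z" using e(1) cInf_lower[OF _ bb, of "z - e"] by (auto simp: z_def)
    then have "k (z - e) < k m" using e(2) m(2)[of "z - e"] by (auto simp: Z_def)
    moreover have "k (z + e) \<le> k m" using m(2) e(3) by blast
    ultimately show False using kmid[OF e(2,3)] z01(3) by simp
  qed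
  then show "g ((1 - t) *\<^sub>R x + t *\<^sub>R y) \<le> (1 - t) * g x + t * g y"
    by (simp add: k_def c_def)
qed

lemma quadratic_remainder_imp_DERIV:
  fixes \<phi> :: "real \<Rightarrow> real"
  assumes r: "0 < r" and rem: "\<And>t. \<bar>t\<bar> < r \<Longrightarrow> \<bar>\<phi> t - \<phi> 0 - D * t\<bar> \<le> C * t\<^sup>2"
  shows "DERIV \<phi> 0 :> D"
proof -
  have C: "0 \<le> C" using rem[of "r/2"] r
    by (smt (verit) abs_ge_zero zero_le_mult_iff zero_le_power2 zero_less_power2 power2_eq_square field_sum_of_halves mult_neg_pos zero_eq_power2)
  have "((\<lambda>t. (\<phi> t - \<phi> 0) / (t - 0) - D) \<longlongrightarrow> 0) (at 0)"
  proof (rule Lim_null_comparison)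
    show "\<forall>\<^sub>F t in at 0. norm ((\<phi> t - \<phi> 0) / (t - 0) - D) \<le> C * \<bar>t\<bar>"
      unfolding eventually_at
    proof (intro exI[of _ r] conjI ballI impI r)
      fix t :: real assume t: "t \<noteq> 0 \<and> dist t 0 < r"
      have "(\<phi> t - \<phi> 0) / (t - 0) - D = (\<phi> t - \<phi> 0 - D * t) / t" using t by (simp add: field_simps)
      then have "norm ((\<phi> t - \<phi> 0) / (t - 0) - D) = \<bar>\<phi> t - \<phi> 0 - D * t\<bar> / \<bar>t\<bar>" by simp
      also have "\<dots> \<le> C * t\<^sup>2 / \<bar>t\<bar>" using rem[of t] t by (intro divide_right_mono) auto
      also have "\<dots> = C * \<bar>t\<bar>" using t by (simp add: power2_eq_square abs_if)
      finally show "norm ((\<phi> t - \<phi> 0) / (t - 0) - D) \<le> C * \<bar>t\<bar>" .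
    qed
    show "((\<lambda>t. C * \<bar>t\<bar>) \<longlongrightarrow> 0) (at 0)" by (auto intro!: tendsto_eq_intros)
  qed
  then show ?thesis by (simp add: has_field_derivative_iff LIM_zero_iff)
qed

text \<open>The parabola 2 C t^2 has second difference exactly C (s - t)^2, so 2 C t^2 + \<phi> and
  2 C t^2 - \<phi> are both midpoint convex. Their supporting slopes at 0 cancel, because (p + q) t
  <= 4 C t^2 for small t of both signs; the two supporting lines then bound the remainder from both
  sides.\<close>

lemma second_difference_imp_quadratic_remainder:
  fixes \<phi> :: "real \<Rightarrow> real"
  assumes r: "0 < r" and cont: "continuous_on {-r..r} \<phi>"
    and sd: "\<And>s t. s \<in> {-r..r} \<Longrightarrow> t \<in> {-r..r} \<Longrightarrow> \<bar>\<phi> s + \<phi> t - 2 * \<phi> ((s + t) / 2)\<bar> \<le> C * (s - t)\<^sup>2"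
  shows "\<exists>D. \<forall>t\<in>{-r..r}. \<bar>\<phi> t - \<phi> 0 - D * t\<bar> \<le> 2 * C * t\<^sup>2"
proof -
  let ?P = "\<lambda>t. \<phi> t + 2 * C * t\<^sup>2" and ?Q = "\<lambda>t. 2 * C * t\<^sup>2 - \<phi> t"
  have sq: "s\<^sup>2 + t\<^sup>2 - 2 * ((s + t) / 2)\<^sup>2 = (s - t)\<^sup>2 / 2" for s t :: real
    by (simp add: power2_eq_square field_simps)
  have mp: "midpoint s t = (s + t) / 2" for s t :: real by (simp add: midpoint_def)
  have "convex_on {-r..r} ?P"
  proof (rule midpoint_convex_imp_convex)
    fix s t assume st: "s \<in> {-r..r}" "t \<in> {-r..r}"
    have "2 * C * (s\<^sup>2 + t\<^sup>2 - 2 * ((s + t) / 2)\<^sup>2) = C * (s - t)\<^sup>2" unfolding sq by simp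
    then show "2 * ?P (midpoint s t) \<le> ?P s + ?P t"
      using sd[OF st] unfolding mp by (simp add: algebra_simps abs_le_iff)
  qed (auto intro!: continuous_intros cont)
  moreover have "convex_on {-r..r} ?Q"
  proof (rule midpoint_convex_imp_convex)
    fix s t assume st: "s \<in> {-r..r}" "t \<in> {-r..r}"
    have "2 * C * (s\<^sup>2 + t\<^sup>2 - 2 * ((s + t) / 2)\<^sup>2) = C * (s - t)\<^sup>2" unfolding sq by simp
    then show "2 * ?Q (midpoint s t) \<le> ?Q s + ?Q t"
      using sd[OF st] unfolding mp by (simp add: algebra_simps abs_le_iff)
  qed (auto intro!: continuous_intros cont)
  moreover have "0 \<in> interior {-r..r}" using r by simp
  ultimately obtain p q where p: "\<And>t. t \<in> {-r..r} \<Longrightarrow> ?P t \<ge> ?P 0 + p * (t - 0)"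
     and q: "\<And>t. t \<in> {-r..r} \<Longrightarrow> ?Q t \<ge> ?Q 0 + q * (t - 0)"
    using convex_le_Inf_differential by meson
  have sum: "(p + q) * t \<le> 4 * C * t\<^sup>2" if "t \<in> {-r..r}" for t
    using p[OF that] q[OF that] by (simp add: algebra_simps)
  have "p + q = 0"
  proof -
    have "((\<lambda>t. 4 * C * t) \<longlongrightarrow> 4 * C * 0) (at_right 0)" "((\<lambda>t. 4 * C * t) \<longlongrightarrow> 4 * C * 0) (at_left 0)"
      by (intro tendsto_intros)+
    moreover have "\<forall>\<^sub>F t in at_right 0. p + q \<le> 4 * C * t"
      unfolding eventually_at_right_field
    proof (intro exI[of _ r] conjI allI impI r)
      fix t :: real assume t: "0 < t" "t < r"
      then have "(p + q) * t \<le> (4 * C * t) * t" using sum[of t] by (simp add: power2_eq_square)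
      then show "p + q \<le> 4 * C * t" using t by simp
    qed
    moreover have "\<forall>\<^sub>F t in at_left 0. 4 * C * t \<le> p + q"
      unfolding eventually_at_left_field
    proof (intro exI[of _ "-r"] conjI allI impI)
      fix t :: real assume t: "-r < t" "t < 0"
      then have "(p + q) * t \<le> (4 * C * t) * t" using sum[of t] by (simp add: power2_eq_square)
      then show "4 * C * t \<le> p + q" using t by (simp add: mult_le_cancel_right)
    qed (use r in simp)
    ultimately have "p + q \<le> 4 * C * 0" "4 * C * 0 \<le> p + q"
      using tendsto_lowerbound[of _ "4 * C * 0" "at_right (0::real)" "p + q"]
            tendsto_upperbound[of _ "4 * C * 0" "at_left (0::real)" "p + q"]
      by (auto simp: trivial_limit_at_right_real trivial_limit_at_left_real)
    then show ?thesis by simp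
  qed
  then have q': "q = - p" by simp
  show ?thesis
  proof (intro exI[of _ p] ballI)
    fix t assume t: "t \<in> {-r..r}"
    show "\<bar>\<phi> t - \<phi> 0 - p * t\<bar> \<le> 2 * C * t\<^sup>2"
      using p[OF t] q[OF t] by (simp add: q' abs_le_iff)
  qed
qed

lemma second_difference_imp_partial_deriv:
  fixes f :: "'a::euclidean_space \<Rightarrow> real"
  assumes cont: "continuous_on S f" and r: "0 < r" and xr: "cball x r \<subseteq> S" and j: "norm j = 1"
    and sd: "\<And>x y. x \<in> S \<Longrightarrow> y \<in> S \<Longrightarrow> \<bar>f x + f y - 2 * f (midpoint x y)\<bar> \<le> C * (norm (x - y))\<^sup>2"
  shows "DERIV (\<lambda>t. f (x + t *\<^sub>R j)) 0 :> partial_deriv j f x"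
    and "\<And>t. \<bar>t\<bar> \<le> r \<Longrightarrow> \<bar>f (x + t *\<^sub>R j) - f x - partial_deriv j f x * t\<bar> \<le> 2 * C * t\<^sup>2"
proof -
  define \<phi> where "\<phi> t = f (x + t *\<^sub>R j)" for t
  have inS: "x + t *\<^sub>R j \<in> S" if "t \<in> {-r..r}" for t
    using xr that j by (auto simp: subset_iff dist_norm)
  have "continuous_on {-r..r} \<phi>"
    unfolding \<phi>_def by (rule continuous_on_compose2[OF cont]) (auto intro!: continuous_intros inS)
  moreover have "\<bar>\<phi> s + \<phi> t - 2 * \<phi> ((s + t) / 2)\<bar> \<le> C * (s - t)\<^sup>2" if st: "s \<in> {-r..r}" "t \<in> {-r..r}" for s t
  proof -
    have "midpoint (x + s *\<^sub>R j) (x + t *\<^sub>R j) = x + ((s + t) / 2) *\<^sub>R j"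
      by (simp add: midpoint_def scaleR_add_right scaleR_add_left add_divide_distrib flip: scaleR_2)
    moreover have "norm ((x + s *\<^sub>R j) - (x + t *\<^sub>R j)) = \<bar>s - t\<bar>"
      using j by (simp flip: scaleR_diff_left)
    ultimately show ?thesis using sd[OF inS[OF st(1)] inS[OF st(2)]] by (simp add: \<phi>_def)
  qed
  ultimately obtain D where D: "\<And>t. t \<in> {-r..r} \<Longrightarrow> \<bar>\<phi> t - \<phi> 0 - D * t\<bar> \<le> 2 * C * t\<^sup>2"
    using second_difference_imp_quadratic_remainder[OF r, of \<phi> C] by blast
  have der: "DERIV \<phi> 0 :> D"
    by (rule quadratic_remainder_imp_DERIV[OF r, of _ _ "2 * C"], rule D) auto
  then have "partial_deriv j f x = D" unfolding partial_deriv_def \<phi>_def by (rule DERIV_imp_deriv)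
  then show "DERIV (\<lambda>t. f (x + t *\<^sub>R j)) 0 :> partial_deriv j f x"
    using der by (simp add: \<phi>_def[abs_def])
  fix t assume "\<bar>t\<bar> \<le> r"
  then show "\<bar>f (x + t *\<^sub>R j) - f x - partial_deriv j f x * t\<bar> \<le> 2 * C * t\<^sup>2"
    using D[of t] \<open>partial_deriv j f x = D\<close> by (simp add: \<phi>_def abs_le_iff)
qed

text \<open>With t = |x - y|, the segments from x + t j to y and from x to y + t j share their
  midpoint and have length at most 2 t, so the increments of \<open>f\<close> along j at x and at y
  differ by at most 8 C t^2. The two quadratic remainders add 4 C t^2, whence 12. Since t <= 2 r,
  the ball of radius 4 r contains all points used.\<close>

lemma second_difference_imp_partial_deriv_lipschitz:
  fixes f :: "'a::euclidean_space \<Rightarrow> real"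
  assumes cont: "continuous_on (ball x0 (4 * r)) f" and r: "0 < r" and j: "norm j = 1" and C: "0 \<le> C"
    and sd: "\<And>x y. x \<in> ball x0 (4 * r) \<Longrightarrow> y \<in> ball x0 (4 * r) \<Longrightarrow> \<bar>f x + f y - 2 * f (midpoint x y)\<bar> \<le> C * (norm (x - y))\<^sup>2"
  shows "(12 * C)-lipschitz_on (cball x0 r) (partial_deriv j f)"
proof (rule lipschitz_onI)
  fix x y assume xy: "x \<in> cball x0 r" "y \<in> cball x0 r"
  let ?S = "ball x0 (4 * r)"
  define t where "t = norm (x - y)"
  show "dist (partial_deriv j f x) (partial_deriv j f y) \<le> 12 * C * dist x y"
  proof (cases "x = y")
    case False
    then have t: "0 < t" by (simp add: t_def)
    have t2: "t \<le> 2 * r" using xy norm_triangle_ineq4[of "x - x0" "y - x0"] by (simp add: t_def dist_norm norm_minus_commute)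
    have sub: "cball z t \<subseteq> ?S" if "z \<in> cball x0 r" for z
    proof
      fix w assume "w \<in> cball z t"
      then show "w \<in> ?S" using that dist_triangle[of x0 w z] t2 r by simp
    qed
    have q: "\<bar>f (z + t *\<^sub>R j) - f z - partial_deriv j f z * t\<bar> \<le> 2 * C * t\<^sup>2" if "z \<in> cball x0 r" for z
      using second_difference_imp_partial_deriv(2)[OF cont t sub[OF that] j sd, of t] t by simp
    have inS: "x \<in> ?S" "y \<in> ?S" "x + t *\<^sub>R j \<in> ?S" "y + t *\<^sub>R j \<in> ?S"
      using sub[OF xy(1)] sub[OF xy(2)] j t by (auto simp: subset_iff dist_norm)
    have n: "(norm v)\<^sup>2 \<le> 4 * t\<^sup>2" if "norm v \<le> t + t" for v :: 'a
      using power_mono[OF that, of 2] by (simp add: power2_eq_square algebra_simps)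
    have "norm (x + t *\<^sub>R j - y) \<le> t + t" "norm (x - (y + t *\<^sub>R j)) \<le> t + t"
      using norm_triangle_ineq[of "x - y" "t *\<^sub>R j"] norm_triangle_ineq4[of "x - y" "t *\<^sub>R j"] j t
      by (simp_all add: t_def algebra_simps)
    then have "C * (norm (x + t *\<^sub>R j - y))\<^sup>2 \<le> C * (4 * t\<^sup>2)" "C * (norm (x - (y + t *\<^sub>R j)))\<^sup>2 \<le> C * (4 * t\<^sup>2)"
      using n C by (auto intro!: mult_left_mono)
    moreover have "midpoint (x + t *\<^sub>R j) y = midpoint x (y + t *\<^sub>R j)"
      by (simp add: midpoint_def algebra_simps)
    ultimately have "\<bar>(f (x + t *\<^sub>R j) + f y) - (f x + f (y + t *\<^sub>R j))\<bar> \<le> 8 * C * t\<^sup>2"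
      using sd[OF inS(3,2)] sd[OF inS(1,4)] by (simp add: abs_le_iff)
    then have "\<bar>partial_deriv j f x * t - partial_deriv j f y * t\<bar> \<le> 12 * C * t\<^sup>2"
      using q[OF xy(1)] q[OF xy(2)] by (simp add: abs_le_iff)
    then have "\<bar>partial_deriv j f x - partial_deriv j f y\<bar> * t \<le> (12 * C * t) * t"
      using t by (simp add: power2_eq_square abs_mult flip: left_diff_distrib)
    then show ?thesis using t by (simp add: dist_real_def dist_norm flip: t_def)
  qed simp
qed (use C in simp)

section \<open>From semiconcavity and sub-mean values to a lower bound for second
  differences\<close>

lemma integral_cis_reflect:
  fixes F :: "complex \<Rightarrow> real"
  shows "integral {0..2*pi} (\<lambda>\<theta>. F (cis (- \<theta>))) = integral {0..2*pi} (\<lambda>\<theta>. F (cis \<theta>))"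
proof -
  have "integral {0..2*pi} (\<lambda>\<theta>. F (cis (- \<theta>))) = integral {-(2*pi)..-0} (\<lambda>\<theta>. F (cis \<theta>))"
    using Henstock_Kurzweil_Integration.integral_reflect_real[of "2*pi" 0 "\<lambda>\<theta>. F (cis (- \<theta>))"] by simp
  also have "\<dots> = integral {0..2*pi} (\<lambda>\<theta>. F (cis (\<theta> - 2*pi)))"
    using integral_shift_real_ivl[of "-(2*pi)" "-(2*pi)" 0 "\<lambda>\<theta>. F (cis \<theta>)"] by simp
  also have "(\<lambda>\<theta>. F (cis (\<theta> - 2*pi))) = (\<lambda>\<theta>. F (cis \<theta>))"
    by (simp add: cis_divide[symmetric])
  finally show ?thesis .
qed

lemma cis_vec_eq: "cis \<theta> *s (v::complex^'n) = cos \<theta> *\<^sub>R v + sin \<theta> *\<^sub>R (\<i> *s v)"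
  by (simp add: vec_eq_iff complex_eq_iff algebra_simps)

lemma norm_complex_scale: "norm (c *s (v::complex^'n)) = norm c * norm v"
  by (simp add: norm_vec_def norm_mult L2_set_right_distrib)

text \<open>With \<open>g = 2C\<bar>z\<bar>\<^sup>2 - f\<close> convex, \<open>G y = g (a + y) + g (a - y) - 2 g a\<close> is even and convex, and
  \<open>G (2 e\<^sup>i\<^sup>\<theta> y) + G (2 e\<^sup>-\<^sup>i\<^sup>\<theta> y) \<ge> 2 G (2 cos \<theta> y) \<ge> (4/3) (4 cos\<^sup>2 \<theta> - 1) G y\<close>, whose mean over
  \<open>\<theta>\<close> bounds \<open>G y\<close>.\<close>

lemma semiconcave_submean_imp_lower_bound:
  fixes f :: "complex^'n \<Rightarrow> real"
  assumes S: "convex S" and cont: "continuous_on S f" and C: "0 \<le> C"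
    and semi: "\<And>x y. x \<in> S \<Longrightarrow> y \<in> S \<Longrightarrow> f x + f y - 2 * f (midpoint x y) \<le> C * (norm (x - y))\<^sup>2"
    and disc: "\<And>\<xi>. norm \<xi> \<le> 1 \<Longrightarrow> a + \<xi> *s (2 *\<^sub>R y) \<in> S"
    and sub: "2 * pi * f a \<le> integral {0..2 * pi} (\<lambda>\<theta>. f (a + cis \<theta> *s (2 *\<^sub>R y)))"
      "2 * pi * f a \<le> integral {0..2 * pi} (\<lambda>\<theta>. f (a + cis \<theta> *s (- 2 *\<^sub>R y)))"
  shows "- (20 * C * (norm y)\<^sup>2) \<le> f (a + y) + f (a - y) - 2 * f a"
proof -
  define g where "g z = 2 * C * (norm z)\<^sup>2 - f z" for z
  have par: "(norm x)\<^sup>2 + (norm y)\<^sup>2 - 2 * (norm (midpoint x y))\<^sup>2 = (norm (x - y))\<^sup>2 / 2" for x y :: "complex^'n"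
    by (simp add: midpoint_def power2_norm_eq_inner inner_add_left inner_add_right inner_diff_left inner_diff_right inner_commute field_simps)
  have gmid: "2 * g (midpoint x y) \<le> g x + g y" if "x \<in> S" "y \<in> S" for x y
  proof -
    have "2 * C * ((norm x)\<^sup>2 + (norm y)\<^sup>2 - 2 * (norm (midpoint x y))\<^sup>2) = C * (norm (x - y))\<^sup>2"
      unfolding par by simp
    then show ?thesis using semi[OF that] by (simp add: g_def algebra_simps)
  qed
  have gconv: "convex_on S g"
    by (rule midpoint_convex_imp_convex[OF S _ gmid]) (auto simp: g_def intro!: continuous_intros cont)
  define G where "G v = g (a + v) + g (a - v) - 2 * g a" for v
  have inS: "a + \<xi> *s (2 *\<^sub>R y) \<in> S" "a - \<xi> *s (2 *\<^sub>R y) \<in> S" if "norm \<xi> \<le> 1" for \<xi>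
  proof -
    have "a - \<xi> *s (2 *\<^sub>R y) = a + (- \<xi>) *s (2 *\<^sub>R y)" by (simp add: vec_eq_iff)
    then show "a + \<xi> *s (2 *\<^sub>R y) \<in> S" "a - \<xi> *s (2 *\<^sub>R y) \<in> S"
      using disc[of \<xi>] disc[of "- \<xi>"] that by simp_all
  qed
  have r: "t *\<^sub>R y = complex_of_real (t/2) *s (2 *\<^sub>R y)" for t
    by (simp add: vec_eq_iff complex_eq_iff)
  have inSr: "a + t *\<^sub>R y \<in> S" "a - t *\<^sub>R y \<in> S" if "\<bar>t\<bar> \<le> 2" for t
    using inS[of "complex_of_real (t/2)"] that unfolding r[of t] by (auto simp: norm_divide)
  have aS: "a \<in> S" using inSr(1)[of 0] by simp
  have G0: "0 \<le> G (t *\<^sub>R y)" if "\<bar>t\<bar> \<le> 2" for t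
  proof -
    have "midpoint (a + t *\<^sub>R y) (a - t *\<^sub>R y) = a" by (simp add: midpoint_def flip: scaleR_2)
    then show ?thesis using gmid[OF inSr[OF that]] by (simp add: G_def)
  qed
  have G1: "t * G y \<le> G (t *\<^sub>R y)" if t: "1 \<le> t" "t \<le> 2" for t
  proof -
    have "g (a + y) \<le> (1 - 1/t) * g a + (1/t) * g (a + t *\<^sub>R y)"
      using convex_onD[OF gconv, of "1/t" a "a + t *\<^sub>R y"] t aS inSr(1)[of t] by (simp add: algebra_simps)
    moreover have "g (a - y) \<le> (1 - 1/t) * g a + (1/t) * g (a - t *\<^sub>R y)"
      using convex_onD[OF gconv, of "1/t" a "a - t *\<^sub>R y"] t aS inSr(2)[of t] by (simp add: algebra_simps)
    ultimately have "t * (g (a + y) + g (a - y)) \<le> t * (((1 - 1/t) * g a + (1/t) * g (a + t *\<^sub>R y)) + ((1 - 1/t) * g a + (1/t) * g (a - t *\<^sub>R y)))"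
      using t by (intro mult_left_mono add_mono) auto
    also have "\<dots> = 2 * t * g a - 2 * g a + (g (a + t *\<^sub>R y) + g (a - t *\<^sub>R y))"
      using t by (simp add: field_simps)
    finally show ?thesis by (simp add: G_def algebra_simps)
  qed
  have Geven: "G (- v) = G v" for v by (simp add: G_def)
  have Gy: "0 \<le> G y" using G0[of 1] by simp
  \<comment> \<open>A quadratic minorant of 2 |t| G y, the bound that convexity gives for |t| >=
    1/2; for smaller |t| it is nonpositive and G >= 0 suffices. It agrees with 2 |t| G y at |t| = 1,
    and for t = cos \<theta> its mean is elementary.\<close>
  have G2: "(2/3) * (4 * t\<^sup>2 - 1) * G y \<le> G ((2 * t) *\<^sub>R y)" if t: "\<bar>t\<bar> \<le> 1" for t
  proof -
    have ab: "G ((2 * t) *\<^sub>R y) = G ((2 * \<bar>t\<bar>) *\<^sub>R y)" using Geven[of "(2*t) *\<^sub>R y"] by (simp add: abs_if)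
    show ?thesis
    proof (cases "2 * \<bar>t\<bar> \<le> 1")
      case True
      have "4 * t\<^sup>2 - 1 = (2 * \<bar>t\<bar> - 1) * (2 * \<bar>t\<bar> + 1)" by (simp add: power2_eq_square algebra_simps)
      then have "4 * t\<^sup>2 - 1 \<le> 0" using True by (simp add: mult_nonpos_nonneg)
      then have "(2/3) * (4 * t\<^sup>2 - 1) * G y \<le> 0" using Gy by (simp add: mult_nonpos_nonneg)
      moreover have "0 \<le> G ((2 * t) *\<^sub>R y)" using t by (intro G0) (simp add: abs_mult)
      ultimately show ?thesis by linarith
    next
      case False
      have "2 * \<bar>t\<bar> - (2/3) * (4 * t\<^sup>2 - 1) = (1 - \<bar>t\<bar>) * (8 * \<bar>t\<bar> + 2) / 3"
        by (simp add: power2_eq_square algebra_simps flip: abs_mult)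
      then have "(2/3) * (4 * t\<^sup>2 - 1) \<le> 2 * \<bar>t\<bar>" using t
        by (smt (verit) divide_nonneg_pos mult_nonneg_nonneg abs_ge_zero)
      then have "(2/3) * (4 * t\<^sup>2 - 1) * G y \<le> 2 * \<bar>t\<bar> * G y" using Gy by (rule mult_right_mono)
      also have "\<dots> \<le> G ((2 * \<bar>t\<bar>) *\<^sub>R y)" using G1[of "2 * \<bar>t\<bar>"] False t by simp
      finally show ?thesis using ab by simp
    qed
  qed
  define E where "E \<theta> = cis \<theta> *s (2 *\<^sub>R y)" for \<theta>
  have G3: "(4/3) * (4 * (cos \<theta>)\<^sup>2 - 1) * G y \<le> G (E \<theta>) + G (E (- \<theta>))" for \<theta>
  proof -
    have m1: "midpoint (a + E \<theta>) (a + E (- \<theta>)) = a + (2 * cos \<theta>) *\<^sub>R y"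
      by (simp add: midpoint_def E_def cis_vec_eq vec_eq_iff complex_eq_iff algebra_simps)
    have m2: "midpoint (a - E \<theta>) (a - E (- \<theta>)) = a - (2 * cos \<theta>) *\<^sub>R y"
      by (simp add: midpoint_def E_def cis_vec_eq vec_eq_iff complex_eq_iff algebra_simps)
    have ES: "a + E \<theta> \<in> S" "a + E (- \<theta>) \<in> S" "a - E \<theta> \<in> S" "a - E (- \<theta>) \<in> S"
      by (simp_all add: E_def inS)
    have "2 * g (a + (2 * cos \<theta>) *\<^sub>R y) \<le> g (a + E \<theta>) + g (a + E (- \<theta>))"
      using gmid[OF ES(1,2)] unfolding m1 .
    moreover have "2 * g (a - (2 * cos \<theta>) *\<^sub>R y) \<le> g (a - E \<theta>) + g (a - E (- \<theta>))"
      using gmid[OF ES(3,4)] unfolding m2 .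
    ultimately have "2 * G ((2 * cos \<theta>) *\<^sub>R y) \<le> G (E \<theta>) + G (E (- \<theta>))" by (simp add: G_def)
    moreover have "(2/3) * (4 * (cos \<theta>)\<^sup>2 - 1) * G y \<le> G ((2 * cos \<theta>) *\<^sub>R y)" by (rule G2) simp
    ultimately show ?thesis by (simp add: algebra_simps)
  qed
  have nE: "norm (E \<theta>) = 2 * norm y" for \<theta> by (simp add: E_def norm_complex_scale)
  have GE: "G (E \<theta>) = 16 * C * (norm y)\<^sup>2 - (f (a + E \<theta>) + f (a - E \<theta>) - 2 * f a)" for \<theta>
  proof -
    have "(norm (a + E \<theta>))\<^sup>2 + (norm (a - E \<theta>))\<^sup>2 - 2 * (norm a)\<^sup>2 = 2 * (norm (E \<theta>))\<^sup>2"
      by (simp add: power2_norm_eq_inner inner_add_left inner_add_right inner_diff_left inner_diff_right inner_commute)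
    then have "2 * C * ((norm (a + E \<theta>))\<^sup>2 + (norm (a - E \<theta>))\<^sup>2 - 2 * (norm a)\<^sup>2) = 2 * C * (2 * (2 * norm y)\<^sup>2)"
      unfolding nE by simp
    then show ?thesis by (simp add: G_def g_def algebra_simps power2_eq_square)
  qed
  have contE: "continuous_on UNIV E" unfolding E_def cis_vec_eq by (intro continuous_intros)
  have cfp: "continuous_on T (\<lambda>\<theta>. f (a + E \<theta>))" and cfm: "continuous_on T (\<lambda>\<theta>. f (a - E \<theta>))" for T
    by (rule continuous_on_compose2[OF cont], auto simp: E_def inS intro!: continuous_intros continuous_on_subset[OF contE[unfolded E_def]])+
  have ip: "(\<lambda>\<theta>. f (a + E \<theta>)) integrable_on {0..2*pi}" "(\<lambda>\<theta>. f (a - E \<theta>)) integrable_on {0..2*pi}"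
    using cfp cfm by (auto intro!: integrable_continuous_real)
  have sub': "2 * pi * f a \<le> integral {0..2*pi} (\<lambda>\<theta>. f (a - E \<theta>))"
  proof -
    have "a + cis \<theta> *s (- 2 *\<^sub>R y) = a - E \<theta>" for \<theta> by (simp add: E_def vec_eq_iff)
    then show ?thesis using sub(2) by simp
  qed
  have iG: "integral {0..2*pi} (\<lambda>\<theta>. G (E \<theta>)) \<le> 2 * pi * (16 * C * (norm y)\<^sup>2)"
  proof -
    have "integral {0..2*pi} (\<lambda>\<theta>. G (E \<theta>)) = integral {0..2*pi} (\<lambda>\<theta>. (16 * C * (norm y)\<^sup>2 + 2 * f a) - (f (a + E \<theta>) + f (a - E \<theta>)))"
      unfolding GE by (simp add: algebra_simps)
    also have "\<dots> = integral {0..2*pi} (\<lambda>\<theta>. 16 * C * (norm y)\<^sup>2 + 2 * f a) - (integral {0..2*pi} (\<lambda>\<theta>. f (a + E \<theta>)) + integral {0..2*pi} (\<lambda>\<theta>. f (a - E \<theta>)))"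
      using ip by (subst integral_diff) (auto intro!: integrable_add simp: integral_add)
    also have "\<dots> \<le> 2 * pi * (16 * C * (norm y)\<^sup>2)"
      using sub(1) sub' by (simp add: E_def algebra_simps)
    finally show ?thesis .
  qed
  have cG: "continuous_on T (\<lambda>\<theta>. G (E \<theta>))" for T
    unfolding GE by (intro continuous_intros cfp cfm)
  have cGm: "continuous_on T (\<lambda>\<theta>. G (E (- \<theta>)))" for T
    by (rule continuous_on_compose2[OF cG[of UNIV]]) (auto intro!: continuous_intros)
  have refl: "integral {0..2*pi} (\<lambda>\<theta>. G (E (- \<theta>))) = integral {0..2*pi} (\<lambda>\<theta>. G (E \<theta>))"
    unfolding E_def by (rule integral_cis_reflect)
  have ftc: "((\<lambda>\<theta>. 4 * (cos \<theta>)\<^sup>2 - 1) has_integral (2*pi + sin (2 * (2*pi)) - (0 + sin (2 * 0)))) {0..2*pi}"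
  proof (rule fundamental_theorem_of_calculus)
    fix x :: real
    have "((\<lambda>x. x + sin (2 * x)) has_real_derivative 4 * (cos x)\<^sup>2 - 1) (at x within {0..2*pi})"
      by (auto intro!: derivative_eq_intros simp: cos_double_cos)
    then show "((\<lambda>x. x + sin (2 * x)) has_vector_derivative 4 * (cos x)\<^sup>2 - 1) (at x within {0..2*pi})"
      by (simp add: has_real_derivative_iff_has_vector_derivative)
  qed simp
  have s4: "sin (2 * (2 * pi)) = 0" using sin_npi[of 4] by (simp add: mult.assoc[symmetric])
  have "((\<lambda>\<theta>. (4/3) * G y * (4 * (cos \<theta>)\<^sup>2 - 1)) has_integral (4/3) * G y * (2 * pi)) {0..2*pi}"
    using has_integral_mult_right[OF ftc, of "(4/3) * G y"] s4 by simp
  moreover have "((\<lambda>\<theta>. G (E \<theta>) + G (E (- \<theta>))) has_integral (integral {0..2*pi} (\<lambda>\<theta>. G (E \<theta>)) + integral {0..2*pi} (\<lambda>\<theta>. G (E (-\<theta>))))) {0..2*pi}"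
    using cG cGm by (intro has_integral_add integrable_integral integrable_continuous_real)
  ultimately have "(4/3) * G y * (2 * pi) \<le> integral {0..2*pi} (\<lambda>\<theta>. G (E \<theta>)) + integral {0..2*pi} (\<lambda>\<theta>. G (E (-\<theta>)))"
    by (rule has_integral_le) (use G3 in \<open>simp add: mult_ac\<close>)
  also have "\<dots> \<le> 2 * (2 * pi * (16 * C * (norm y)\<^sup>2))" using iG refl by (simp add: mult_ac)
  \<comment> \<open>Since 4 cos^2 - 1 has mean 1 and \<open>G (E \<theta>)\<close> has mean at most
    16 C |y|^2, one gets (4/3) G y <= 32 C |y|^2. Of the resulting 24, the parabola in
    \<open>g\<close> accounts for 4, which leaves the 20 of the statement.\<close>
  finally have "G y * (8 * pi) \<le> (24 * C * (norm y)\<^sup>2) * (8 * pi)" by (simp add: algebra_simps)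
  then have "G y \<le> 24 * C * (norm y)\<^sup>2" using pi_gt_zero by (simp only: mult_le_cancel_right)
  moreover have "G y = 4 * C * (norm y)\<^sup>2 - (f (a + y) + f (a - y) - 2 * f a)"
  proof -
    have "(norm (a + y))\<^sup>2 + (norm (a - y))\<^sup>2 - 2 * (norm a)\<^sup>2 = 2 * (norm y)\<^sup>2"
      by (simp add: power2_norm_eq_inner inner_add_left inner_add_right inner_diff_left inner_diff_right inner_commute)
    then have "2 * C * ((norm (a + y))\<^sup>2 + (norm (a - y))\<^sup>2 - 2 * (norm a)\<^sup>2) = 2 * C * (2 * (norm y)\<^sup>2)" by simp
    then show ?thesis by (simp add: G_def g_def algebra_simps)
  qed
  ultimately show ?thesis by simp
qed

section \<open>Families of maps with uniform C^{1,1} bounds\<close>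

text \<open>A derivative-free form of C^{1,1} regularity in x with one constant for all parameters
  w. Stated by differences, it passes through sums, products and compositions, and its last clause
  is directly the estimate that the comparison of boundary values needs.\<close>

definition unif_C11_bound :: "real \<Rightarrow> 'w set \<Rightarrow> 'a::real_normed_vector set \<Rightarrow> ('w \<Rightarrow> 'a \<Rightarrow> 'b::real_normed_vector) \<Rightarrow> bool" where
  "unif_C11_bound B W S f \<longleftrightarrow> 0 \<le> B \<and> (\<forall>w\<in>W. \<forall>x\<in>S. norm (f w x) \<le> B) \<and>
     (\<forall>w\<in>W. \<forall>x\<in>S. \<forall>y\<in>S. norm (f w x - f w y) \<le> B * norm (x - y)) \<and>
     (\<forall>w\<in>W. \<forall>x\<in>S. \<forall>y\<in>S. norm (f w x + f w y - 2 *\<^sub>R f w (midpoint x y)) \<le> B * (norm (x - y))\<^sup>2)"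

definition unif_C11 :: "'w set \<Rightarrow> 'a::real_normed_vector set \<Rightarrow> ('w \<Rightarrow> 'a \<Rightarrow> 'b::real_normed_vector) \<Rightarrow> bool" where
  "unif_C11 W S f \<longleftrightarrow> (\<exists>B. unif_C11_bound B W S f)"

lemma unif_C11_boundD:
  assumes "unif_C11_bound B W S f"
  shows "0 \<le> B" "w \<in> W \<Longrightarrow> x \<in> S \<Longrightarrow> norm (f w x) \<le> B"
    "w \<in> W \<Longrightarrow> x \<in> S \<Longrightarrow> y \<in> S \<Longrightarrow> norm (f w x - f w y) \<le> B * norm (x - y)"
    "w \<in> W \<Longrightarrow> x \<in> S \<Longrightarrow> y \<in> S \<Longrightarrow> norm (f w x + f w y - 2 *\<^sub>R f w (midpoint x y)) \<le> B * (norm (x - y))\<^sup>2"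
  using assms unfolding unif_C11_bound_def by simp_all

lemma unif_C11I:
  assumes "\<And>w x. w \<in> W \<Longrightarrow> x \<in> S \<Longrightarrow> norm (f w x) \<le> B1"
    and "\<And>w x y. w \<in> W \<Longrightarrow> x \<in> S \<Longrightarrow> y \<in> S \<Longrightarrow> norm (f w x - f w y) \<le> B2 * norm (x - y)"
    and "\<And>w x y. w \<in> W \<Longrightarrow> x \<in> S \<Longrightarrow> y \<in> S \<Longrightarrow> norm (f w x + f w y - 2 *\<^sub>R f w (midpoint x y)) \<le> B3 * (norm (x - y))\<^sup>2"
  shows "unif_C11 W S f"
proof -
  define B where "B = Max {0, B1, B2, B3}"
  have B: "0 \<le> B" "B1 \<le> B" "B2 \<le> B" "B3 \<le> B" by (auto simp: B_def)
  show ?thesis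
    unfolding unif_C11_def unif_C11_bound_def
  proof (intro exI[of _ B] conjI ballI)
    fix w x assume *: "w \<in> W" "x \<in> S"
    show "norm (f w x) \<le> B" using assms(1)[OF *] B by simp
    fix y assume y: "y \<in> S"
    show "norm (f w x - f w y) \<le> B * norm (x - y)"
      using assms(2)[OF * y] mult_right_mono[OF B(3), of "norm (x - y)"] by simp
    show "norm (f w x + f w y - 2 *\<^sub>R f w (midpoint x y)) \<le> B * (norm (x - y))\<^sup>2"
      using assms(3)[OF * y] mult_right_mono[OF B(4), of "(norm (x - y))\<^sup>2"] by simp
  qed (rule B)
qed

lemma unif_C11_const: "bounded (c ` W) \<Longrightarrow> unif_C11 W S (\<lambda>w x. c w)"
proof -
  assume "bounded (c ` W)"
  then obtain B where "\<And>w. w \<in> W \<Longrightarrow> norm (c w) \<le> B" by (auto simp: bounded_iff)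
  then show ?thesis by (intro unif_C11I[of W S _ B 0 0]) (auto simp: scaleR_2)
qed

lemma unif_C11_id: "bounded S \<Longrightarrow> unif_C11 W S (\<lambda>w x. x)"
proof -
  assume "bounded S"
  then obtain B where "\<And>w. w \<in> S \<Longrightarrow> norm w \<le> B" by (auto simp: bounded_iff)
  then show ?thesis by (intro unif_C11I[of W S _ B 1 0]) (auto simp: midpoint_def)
qed

lemma unif_C11_add:
  assumes "unif_C11 W S f" "unif_C11 W S g"
  shows "unif_C11 W S (\<lambda>w x. f w x + g w x)"
proof -
  obtain B where "unif_C11_bound B W S f" using assms(1) unfolding unif_C11_def by blast
  note B = unif_C11_boundD[OF this]
  obtain C where "unif_C11_bound C W S g" using assms(2) unfolding unif_C11_def by blast
  note C = unif_C11_boundD[OF this]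
  show ?thesis
  proof (rule unif_C11I[of W S _ "B + C" "B + C" "B + C"])
    fix w x y assume *: "w \<in> W" "x \<in> S" "y \<in> S"
    have e1: "(f w x + g w x) - (f w y + g w y) = (f w x - f w y) + (g w x - g w y)" by simp
    have e2: "(f w x + g w x) + (f w y + g w y) - 2 *\<^sub>R (f w m + g w m) =
       (f w x + f w y - 2 *\<^sub>R f w m) + (g w x + g w y - 2 *\<^sub>R g w m)" for m by (simp add: algebra_simps)
    show "norm ((f w x + g w x) - (f w y + g w y)) \<le> (B + C) * norm (x - y)"
      unfolding e1 distrib_right by (intro norm_triangle_mono B(3) C(3) *)
    show "norm ((f w x + g w x) + (f w y + g w y) - 2 *\<^sub>R (f w (midpoint x y) + g w (midpoint x y))) \<le> (B + C) * (norm (x - y))\<^sup>2"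
      unfolding e2 distrib_right by (intro norm_triangle_mono B(4) C(4) *)
  qed (intro norm_triangle_mono B(2) C(2))
qed

lemma norm_diff_midpoint:
  fixes x y :: "'a::real_normed_vector"
  shows "norm (x - midpoint x y) = norm (x - y) / 2" "norm (y - midpoint x y) = norm (x - y) / 2"
  using dist_midpoint[of x y] by (simp_all add: dist_norm norm_minus_commute)

text \<open>The second difference of a product consists of each factor's second difference paired
  with the other factor's value at the midpoint, plus two products of first differences over half
  the segment, which are again quadratic in |x - y|. The constants add up to 1 + 1 + 1/4 +
  1/4.\<close>

lemma unif_C11_bilinear:
  assumes p: "bounded_bilinear p" and S: "convex S" and f: "unif_C11 W S f" and g: "unif_C11 W S g"
  shows "unif_C11 W S (\<lambda>w x. p (f w x) (g w x))"
proof -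
  interpret bounded_bilinear p by fact
  obtain K where K: "0 \<le> K" "\<And>a b. norm (p a b) \<le> norm a * norm b * K" using nonneg_bounded by blast
  obtain B where "unif_C11_bound B W S f" using f unfolding unif_C11_def by blast
  note B = unif_C11_boundD[OF this]
  obtain C where "unif_C11_bound C W S g" using g unfolding unif_C11_def by blast
  note C = unif_C11_boundD[OF this]
  have pb: "norm (p a b) \<le> c * d * K" if "norm a \<le> c" "norm b \<le> d" for a b c d
    using K(2)[of a b] mult_right_mono[OF mult_mono'[OF that norm_ge_zero norm_ge_zero] K(1)] by linarith
  show ?thesis
  proof (rule unif_C11I[of W S _ "B * C * K" "2 * B * C * K" "3 * B * C * K"])
    fix w x assume "w \<in> W" "x \<in> S"
    then show "norm (p (f w x) (g w x)) \<le> B * C * K" by (intro pb B C)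
  next
    fix w x y assume *: "w \<in> W" "x \<in> S" "y \<in> S"
    have m: "midpoint x y \<in> S" using * S by (meson convex_contains_segment midpoint_in_closed_segment subsetD)
    let ?n = "norm (x - y)" and ?m = "midpoint x y"
    have "p (f w x) (g w x) - p (f w y) (g w y) = p (f w x - f w y) (g w x) + p (f w y) (g w x - g w y)"
      by (simp add: diff_left diff_right)
    then have "norm (p (f w x) (g w x) - p (f w y) (g w y)) \<le> (B * ?n) * C * K + B * (C * ?n) * K"
      by (simp only:) (intro norm_triangle_mono pb B C *)
    then show "norm (p (f w x) (g w x) - p (f w y) (g w y)) \<le> 2 * B * C * K * ?n" by (simp add: mult_ac)
    have "p (f w x) (g w x) + p (f w y) (g w y) - 2 *\<^sub>R p (f w ?m) (g w ?m) =
       (p (f w ?m) (g w x + g w y - 2 *\<^sub>R g w ?m) + p (f w x + f w y - 2 *\<^sub>R f w ?m) (g w ?m)) +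
       (p (f w x - f w ?m) (g w x - g w ?m) + p (f w y - f w ?m) (g w y - g w ?m))"
      by (simp add: diff_left diff_right add_left add_right scaleR_left scaleR_right scaleR_2)
    moreover have "norm \<dots> \<le> (B * (C * ?n\<^sup>2) * K + B * ?n\<^sup>2 * C * K) + ((B * (?n/2)) * (C * (?n/2)) * K + (B * (?n/2)) * (C * (?n/2)) * K)"
      using B(3)[OF *(1,2) m] B(3)[OF *(1,3) m] C(3)[OF *(1,2) m] C(3)[OF *(1,3) m]
      unfolding norm_diff_midpoint
      by (intro norm_triangle_mono pb B(2,4) C(2,4) * m)
    ultimately have "norm (p (f w x) (g w x) + p (f w y) (g w y) - 2 *\<^sub>R p (f w ?m) (g w ?m)) \<le> (5/2) * (B * C * K * ?n\<^sup>2)"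
      by (simp add: power2_eq_square algebra_simps)
    also have "\<dots> \<le> 3 * (B * C * K * ?n\<^sup>2)" using B(1) C(1) K(1) by (intro mult_right_mono) auto
    finally show "norm (p (f w x) (g w x) + p (f w y) (g w y) - 2 *\<^sub>R p (f w ?m) (g w ?m)) \<le> 3 * B * C * K * ?n\<^sup>2"
      by (simp add: mult_ac)
  qed
qed

text \<open>Expanding \<open>F\<close> at the value of \<open>f\<close> in the midpoint, the linear
  parts of the two increments add up to \<open>F'\<close> applied to the second difference of
  \<open>f\<close>; the remainders are quadratic. The remainder is prescribed for all pairs in
  \<open>T\<close>, so the segment between them may leave \<open>T\<close>.\<close>

lemma unif_C11_compose:
  assumes S: "convex S" and f: "unif_C11 W S f"
    and fT: "\<And>w x. w \<in> W \<Longrightarrow> x \<in> S \<Longrightarrow> f w x \<in> T"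
    and F: "\<And>p. p \<in> T \<Longrightarrow> norm (F p) \<le> L" "\<And>p. p \<in> T \<Longrightarrow> linear (F' p)" "\<And>p v. p \<in> T \<Longrightarrow> norm (F' p v) \<le> L * norm v"
      "\<And>p q. p \<in> T \<Longrightarrow> q \<in> T \<Longrightarrow> norm (F p - F q - F' q (p - q)) \<le> L * (norm (p - q))\<^sup>2"
    and L: "0 \<le> L"
  shows "unif_C11 W S (\<lambda>w x. F (f w x))"
proof -
  obtain B where "unif_C11_bound B W S f" using f unfolding unif_C11_def by blast
  note B = unif_C11_boundD[OF this]
  show ?thesis
  proof (rule unif_C11I[of W S _ L "L * (2 * B + 1) * B" "L * B\<^sup>2 / 2 + L * B"])
    fix w x assume "w \<in> W" "x \<in> S"
    then show "norm (F (f w x)) \<le> L" by (intro F fT)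
  next
    fix w x y assume *: "w \<in> W" "x \<in> S" "y \<in> S"
    have m: "midpoint x y \<in> S" using * S by (meson convex_contains_segment midpoint_in_closed_segment subsetD)
    let ?n = "norm (x - y)" and ?m = "midpoint x y"
    let ?d = "f w x - f w y"
    have d2: "norm ?d \<le> 2 * B" using norm_triangle_ineq4[of "f w x" "f w y"] B(2)[OF *(1,2)] B(2)[OF *(1,3)] by linarith
    have "norm (F (f w x) - F (f w y)) \<le> norm (F (f w x) - F (f w y) - F' (f w y) ?d) + norm (F' (f w y) ?d)"
      using norm_triangle_ineq[of "F (f w x) - F (f w y) - F' (f w y) ?d" "F' (f w y) ?d"] by simp
    also have "\<dots> \<le> L * (norm ?d)\<^sup>2 + L * norm ?d" by (intro add_mono F fT *)
    also have "\<dots> = L * (norm ?d + 1) * norm ?d" by (simp add: power2_eq_square algebra_simps)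
    \<comment> \<open>The quadratic remainder is absorbed into a linear bound because the increment
      of \<open>f\<close> is at most 2 B.\<close>
    also have "\<dots> \<le> L * (2 * B + 1) * (B * ?n)" using d2 B(3)[OF *] L B(1) by (intro mult_mono) auto
    finally show "norm (F (f w x) - F (f w y)) \<le> L * (2 * B + 1) * B * ?n" by (simp add: mult_ac)
    let ?u = "f w x - f w ?m" and ?v = "f w y - f w ?m" and ?D = "F' (f w ?m)"
    have lin: "?D (f w x + f w y - 2 *\<^sub>R f w ?m) = ?D ?u + ?D ?v"
      using linear_add[OF F(2)[OF fT[OF *(1) m]], of ?u ?v] by (simp add: scaleR_2 algebra_simps)
    have "F (f w x) + F (f w y) - 2 *\<^sub>R F (f w ?m) =
      ((F (f w x) - F (f w ?m) - ?D ?u) + (F (f w y) - F (f w ?m) - ?D ?v)) + ?D (f w x + f w y - 2 *\<^sub>R f w ?m)"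
      unfolding lin by (simp add: scaleR_2)
    moreover have "norm \<dots> \<le> (L * (norm ?u)\<^sup>2 + L * (norm ?v)\<^sup>2) + L * norm (f w x + f w y - 2 *\<^sub>R f w ?m)"
      by (intro norm_triangle_mono F fT * m)
    moreover have "\<dots> \<le> (L * (B * (?n/2))\<^sup>2 + L * (B * (?n/2))\<^sup>2) + L * (B * ?n\<^sup>2)"
      using B(3)[OF *(1,2) m] B(3)[OF *(1,3) m] B(4)[OF *] L unfolding norm_diff_midpoint
      by (intro add_mono mult_left_mono power_mono) auto
    moreover have "\<dots> = (L * B\<^sup>2 / 2 + L * B) * ?n\<^sup>2" by (simp add: power2_eq_square algebra_simps)
    ultimately show "norm (F (f w x) + F (f w y) - 2 *\<^sub>R F (f w ?m)) \<le> (L * B\<^sup>2 / 2 + L * B) * ?n\<^sup>2"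
      by (simp only:)
  qed
qed

text \<open>The set of p with norm at least c is not convex, but the remainder has a closed form:
  1/p - 1/q + (p - q)/q^2 = (p - q)^2/(p q^2).\<close>

lemma unif_C11_inverse:
  fixes f :: "'w \<Rightarrow> 'a::real_normed_vector \<Rightarrow> 'b::real_normed_field"
  assumes S: "convex S" and f: "unif_C11 W S f" and c: "0 < c"
    and lb: "\<And>w x. w \<in> W \<Longrightarrow> x \<in> S \<Longrightarrow> c \<le> norm (f w x)"
  shows "unif_C11 W S (\<lambda>w x. inverse (f w x))"
proof (rule unif_C11_compose[OF S f, where T="{p. c \<le> norm p}" and F'="\<lambda>p v. - v / p\<^sup>2" and L="1/c + 1/c\<^sup>2 + 1/c^3"])
  fix p v :: 'b assume p: "p \<in> {p. c \<le> norm p}"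
  have "inverse (norm p) \<le> 1/c" using p c by (simp add: inverse_eq_divide frac_le)
  then show "norm (inverse p) \<le> 1/c + 1/c\<^sup>2 + 1/c^3" using c
    by (smt (verit) divide_nonneg_pos norm_inverse zero_less_power)
  show "linear (\<lambda>v. - v / p\<^sup>2)"
    by (intro linearI) (simp_all add: divide_inverse algebra_simps)
  have "norm (- v / p\<^sup>2) = norm v / (norm p)\<^sup>2" by (simp add: norm_divide norm_power)
  also have "\<dots> \<le> norm v / c\<^sup>2"
  proof -
    have "0 < norm p" using order.strict_trans2[OF c, of "norm p"] p by simp
    then show ?thesis using p c by (intro divide_left_mono power_mono mult_pos_pos zero_less_power) auto
  qed
  also have "\<dots> \<le> (1/c + 1/c\<^sup>2 + 1/c^3) * norm v" using c by (simp add: distrib_right)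
  finally show "norm (- v / p\<^sup>2) \<le> (1/c + 1/c\<^sup>2 + 1/c^3) * norm v" .
next
  fix p q :: 'b assume pq: "p \<in> {p. c \<le> norm p}" "q \<in> {p. c \<le> norm p}"
  then have "p \<noteq> 0" "q \<noteq> 0" using c by auto
  then have "inverse p - inverse q - - (p - q) / q\<^sup>2 = (p - q)\<^sup>2 / (p * q\<^sup>2)"
    by (simp add: field_simps power2_eq_square)
  then have "norm (inverse p - inverse q - - (p - q) / q\<^sup>2) = (norm (p - q))\<^sup>2 / (norm p * (norm q)\<^sup>2)"
    by (simp add: norm_divide norm_power norm_mult)
  also have "\<dots> \<le> (norm (p - q))\<^sup>2 / (c * c\<^sup>2)" using pq c by (intro divide_left_mono mult_mono power_mono mult_pos_pos) auto
  also have "\<dots> = (1/c^3) * (norm (p - q))\<^sup>2" by (simp add: power3_eq_cube power2_eq_square)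
  also have "\<dots> \<le> (1/c + 1/c\<^sup>2 + 1/c^3) * (norm (p - q))\<^sup>2" using c by (intro mult_right_mono) auto
  finally show "norm (inverse p - inverse q - - (p - q) / q\<^sup>2) \<le> (1/c + 1/c\<^sup>2 + 1/c^3) * (norm (p - q))\<^sup>2" .
qed (use lb c in auto)

text \<open>With u and v the roots of p and q, the remainder is -(u - v)^2/(2 v), and (u - v)^2 = (p
  - q)^2/(u + v)^2; the lower bound c for the roots makes this quadratic in p - q.\<close>

lemma unif_C11_sqrt:
  fixes f :: "'w \<Rightarrow> 'a::real_normed_vector \<Rightarrow> real"
  assumes S: "convex S" and f: "unif_C11 W S f" and c: "0 < c"
    and lb: "\<And>w x. w \<in> W \<Longrightarrow> x \<in> S \<Longrightarrow> c\<^sup>2 \<le> f w x" and ub: "\<And>w x. w \<in> W \<Longrightarrow> x \<in> S \<Longrightarrow> f w x \<le> 1"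
  shows "unif_C11 W S (\<lambda>w x. sqrt (f w x))"
proof (rule unif_C11_compose[OF S f, where T="{c\<^sup>2..1}" and F'="\<lambda>p v. v / (2 * sqrt p)" and L="1 + 1/c + 1/c^3"])
  have pos: "0 \<le> 1/c" "0 \<le> 1/c^3" using c by auto
  fix p v :: real assume p: "p \<in> {c\<^sup>2..1}"
  have p0: "0 < p" using p c by (smt (verit) atLeastAtMost_iff zero_less_power)
  have sp: "c \<le> sqrt p" using p c by (simp add: real_le_rsqrt)
  have "norm (sqrt p) \<le> 1" using p p0 by simp
  then show "norm (sqrt p) \<le> 1 + 1/c + 1/c^3" using pos by linarith
  show "linear (\<lambda>v. v / (2 * sqrt p))"
    by (intro linearI) (simp_all add: add_divide_distrib)
  have "norm (v / (2 * sqrt p)) = norm v / (2 * sqrt p)" using p0 by simp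
  also have "\<dots> \<le> norm v / (2 * c)" using sp c p0 by (intro divide_left_mono mult_mono mult_pos_pos) auto
  also have "\<dots> = (1/(2*c)) * norm v" by simp
  also have "\<dots> \<le> (1 + 1/c + 1/c^3) * norm v"
    using c pos by (intro mult_right_mono) (auto simp: field_simps intro: order_trans[of _ "1/c"])
  finally show "norm (v / (2 * sqrt p)) \<le> (1 + 1/c + 1/c^3) * norm v" .
next
  fix p q :: real assume pq: "p \<in> {c\<^sup>2..1}" "q \<in> {c\<^sup>2..1}"
  have pq0: "0 < p" "0 < q" using pq c by (smt (verit) atLeastAtMost_iff zero_less_power)+
  define u v where "u = sqrt p" and "v = sqrt q"
  have uv: "c \<le> u" "c \<le> v" "u\<^sup>2 = p" "v\<^sup>2 = q" using pq pq0 c by (auto simp: u_def v_def real_le_rsqrt)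
  have "u - v - (p - q) / (2 * v) = - (u - v)\<^sup>2 / (2 * v)"
    unfolding uv(3,4)[symmetric] using uv(2) c by (simp add: field_simps power2_eq_square)
  moreover have "0 \<le> (u - v)\<^sup>2 / (2 * v)" using uv(2) c by simp
  ultimately have "norm (u - v - (p - q) / (2 * v)) = (u - v)\<^sup>2 / (2 * v)"
    by (simp only: minus_divide_left[symmetric] norm_minus_cancel real_norm_def abs_of_nonneg)
  then have "norm (sqrt p - sqrt q - (p - q) / (2 * sqrt q)) = (u - v)\<^sup>2 / (2 * v)"
    by (simp only: u_def v_def)
  also have "(u - v)\<^sup>2 = (p - q)\<^sup>2 / (u + v)\<^sup>2"
  proof -
    have "p - q = (u - v) * (u + v)" by (simp add: uv(3,4)[symmetric] power2_eq_square algebra_simps)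
    then show ?thesis using uv c by (simp add: power_mult_distrib)
  qed
  also have "(p - q)\<^sup>2 / (u + v)\<^sup>2 / (2 * v) \<le> (p - q)\<^sup>2 / (c\<^sup>2 * c)"
    unfolding divide_divide_eq_left using uv c
    by (intro divide_left_mono mult_mono power_mono mult_pos_pos) auto
  also have "\<dots> \<le> (1 + 1/c + 1/c^3) * (norm (p - q))\<^sup>2"
    using c by (simp add: distrib_right power3_eq_cube power2_eq_square mult.assoc)
  finally show "norm (sqrt p - sqrt q - (p - q) / (2 * sqrt q)) \<le> (1 + 1/c + 1/c^3) * (norm (p - q))\<^sup>2" .
qed (use lb ub c in auto)

lemma C11_on_imp_continuous_on: "C11_on S f \<Longrightarrow> continuous_on S f"
  unfolding C11_on_def by (meson has_derivative_continuous_on)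

text \<open>The mean value inequality on the segment from q to p, with the Lipschitz bound for the
  derivative. Derivatives within \<open>S\<close> restrict to the segment, so boundary points are
  covered. The result has the shape that \<open>unif_C11_compose\<close> asks of its outer
  function.\<close>

lemma C11_on_quadratic_remainder:
  fixes f :: "'a::euclidean_space \<Rightarrow> real"
  assumes f: "C11_on S f" and S: "convex S" "compact S"
  shows "\<exists>F' L. 0 \<le> L \<and> (\<forall>p\<in>S. \<bar>f p\<bar> \<le> L \<and> linear (F' p) \<and> (\<forall>v. \<bar>F' p v\<bar> \<le> L * norm v)) \<and>
    (\<forall>p\<in>S. \<forall>q\<in>S. \<bar>f p - f q - F' q (p - q)\<bar> \<le> L * (norm (p - q))\<^sup>2)"
proof -
  obtain f' L where f': "\<And>x. x \<in> S \<Longrightarrow> (f has_derivative blinfun_apply (f' x)) (at x within S)" and L: "L-lipschitz_on S f'"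
    using f unfolding C11_on_def by blast
  have L0: "0 \<le> L" using L by (rule lipschitz_on_nonneg)
  have cf: "continuous_on S f" using f by (rule C11_on_imp_continuous_on)
  have cf': "continuous_on S f'" using L by (rule lipschitz_on_continuous_on)
  obtain B where B: "\<And>p. p \<in> S \<Longrightarrow> norm (f p) \<le> B" using compact_imp_bounded[OF compact_continuous_image[OF cf S(2)]] by (auto simp: bounded_iff)
  obtain B' where B': "\<And>p. p \<in> S \<Longrightarrow> norm (f' p) \<le> B'" using compact_imp_bounded[OF compact_continuous_image[OF cf' S(2)]] by (auto simp: bounded_iff)
  define C where "C = Max {0, L, B, B'}"
  have C: "0 \<le> C" "L \<le> C" "B \<le> C" "B' \<le> C" by (auto simp: C_def)
  show ?thesis
  proof (intro exI[of _ "\<lambda>p. blinfun_apply (f' p)"] exI[of _ C] conjI ballI allI)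
    fix p v assume p: "p \<in> S"
    show "\<bar>f p\<bar> \<le> C" using B[OF p] C by simp
    show "linear (blinfun_apply (f' p))" by (simp add: blinfun.bounded_linear_right bounded_linear.linear)
    have "\<bar>f' p v\<bar> \<le> norm (f' p) * norm v" using norm_blinfun[of "f' p" v] by simp
    also have "\<dots> \<le> C * norm v" using B'[OF p] C by (intro mult_right_mono) auto
    finally show "\<bar>f' p v\<bar> \<le> C * norm v" .
  next
    fix p q assume pq: "p \<in> S" "q \<in> S"
    have seg: "closed_segment q p \<subseteq> S" using pq S(1) by (simp add: closed_segment_subset)
    have "norm (f p - f q - f' q (p - q)) \<le> norm (p - q) * (L * norm (p - q))"
    proof (rule differentiable_bound_linearization[where a = q and b = p and f = f and S = "closed_segment q p" and f' = "\<lambda>x. blinfun_apply (f' x)" and ?x0.0 = q and B = "L * norm (p - q)"])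
      show "q + t *\<^sub>R (p - q) \<in> closed_segment q p" if "t \<in> {0..1}" for t
        using that by (auto simp: closed_segment_def algebra_simps intro!: exI[of _ t])
      show "(f has_derivative blinfun_apply (f' x)) (at x within closed_segment q p)" if "x \<in> closed_segment q p" for x
        using f' seg that has_derivative_subset by blast
      show "onorm (blinfun_apply (f' x) - blinfun_apply (f' q)) \<le> L * norm (p - q)" if x: "x \<in> closed_segment q p" for x
      proof -
        have "norm (f' x - f' q) \<le> L * dist x q" using lipschitz_onD[OF L, of x q] seg x pq by (auto simp: dist_norm)
        also have "\<dots> \<le> L * norm (p - q)" using segment_bound(1)[OF x] L0 by (intro mult_left_mono) (auto simp: dist_norm)
        also have "norm (f' x - f' q) = onorm (\<lambda>i. f' x i - f' q i)"
          unfolding norm_blinfun.rep_eq by (rule arg_cong[where f=onorm]) (simp add: fun_eq_iff blinfun.diff_left)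
        finally show ?thesis by (simp add: fun_diff_def)
      qed
    qed auto
    also have "\<dots> = L * (norm (p - q))\<^sup>2" by (simp add: power2_eq_square)
    also have "\<dots> \<le> C * (norm (p - q))\<^sup>2" using C by (intro mult_right_mono) auto
    finally show "\<bar>f p - f q - f' q (p - q)\<bar> \<le> C * (norm (p - q))\<^sup>2" by simp
  qed (use C in auto)
qed

subsection \<open>Automorphisms of the unit ball\<close>

text \<open>The Hermitian inner product, complex linear in the first argument; its real part is the
  Euclidean inner product.\<close>

definition hdot :: "complex^'n \<Rightarrow> complex^'n \<Rightarrow> complex" where
  "hdot x y = (\<Sum>k\<in>UNIV. x $ k * cnj (y $ k))"

lemma hdot_add_left: "hdot (x + y) z = hdot x z + hdot y z"
  and hdot_add_right: "hdot x (y + z) = hdot x y + hdot x z"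
  and hdot_diff_left: "hdot (x - y) z = hdot x z - hdot y z"
  and hdot_diff_right: "hdot x (y - z) = hdot x y - hdot x z"
  and hdot_minus_right: "hdot x (- y) = - hdot x y"
  and hdot_scale_left: "hdot (c *s x) y = c * hdot x y"
  and hdot_scale_right: "hdot x (c *s y) = cnj c * hdot x y"
  and hdot_scaleR_right: "hdot x (r *\<^sub>R y) = of_real r * hdot x y"
  and hdot_cnj: "cnj (hdot x y) = hdot y x"
  by (simp_all add: hdot_def algebra_simps sum.distrib sum_subtractf sum_negf sum_distrib_left cnj_sum scaleR_conv_of_real[where 'a=complex])

lemma hdot_self: "hdot x x = of_real ((norm x)\<^sup>2)"
proof -
  have "(norm x)\<^sup>2 = (\<Sum>k\<in>UNIV. (norm (x $ k))\<^sup>2)" by (simp add: norm_vec_def L2_set_def sum_nonneg)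
  then show ?thesis by (simp add: hdot_def complex_norm_square[symmetric])
qed

lemma Re_hdot: "Re (hdot x y) = x \<bullet> y"
  by (simp add: hdot_def inner_vec_def inner_complex_def)

text \<open>Multiplying x by a unit complex number makes the product real and nonnegative, which
  reduces the claim to the real Cauchy-Schwarz inequality.\<close>

lemma norm_hdot_le: "norm (hdot x y) \<le> norm x * norm y"
proof -
  obtain u where u: "norm u = 1" "u * hdot x y = of_real (norm (hdot x y))"
  proof (cases "hdot x y = 0")
    case False
    let ?h = "hdot x y"
    have "cnj ?h * ?h = of_real (norm ?h) * of_real (norm ?h)"
      using complex_norm_square[of ?h] by (simp add: power2_eq_square mult.commute)
    then have "cnj ?h / of_real (norm ?h) * ?h = of_real (norm ?h)" using False by (simp add: field_simps)
    moreover have "norm (cnj ?h / of_real (norm ?h)) = 1" using False by (simp add: norm_divide)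
    ultimately show ?thesis by (rule that[rotated])
  qed (use that[of 1] in auto)
  have "norm (hdot x y) = Re (hdot (u *s x) y)" using u(2) by (simp add: hdot_scale_left)
  also have "\<dots> \<le> norm (u *s x) * norm y" unfolding Re_hdot by (rule norm_cauchy_schwarz)
  also have "norm (u *s x) = norm x" using u(1) by (simp add: norm_complex_scale)
  finally show ?thesis .
qed

text \<open>With \<open>s = sqrt (1 - \<bar>a\<bar>\<^sup>2)\<close> and the projection \<open>P z = \<langle>z, a\<rangle> a / \<bar>a\<bar>\<^sup>2\<close>, the usual numerator
  \<open>a + P z + s (z - P z)\<close> equals \<open>a + s z + \<langle>z, a\<rangle> a / (1 + s)\<close>, which is smooth at \<open>a = 0\<close>.\<close>

definition ball_aut :: "complex^'n \<Rightarrow> complex^'n \<Rightarrow> complex^'n" where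
  "ball_aut a z = inverse (1 + hdot z a) *s
     (a + sqrt (1 - (norm a)\<^sup>2) *\<^sub>R z + hdot z a *s (inverse (1 + sqrt (1 - (norm a)\<^sup>2)) *\<^sub>R a))"

lemma one_plus_hdot_ge: "norm z \<le> 1 \<Longrightarrow> 1 - norm a \<le> norm (1 + hdot z a)"
proof -
  assume "norm z \<le> 1"
  then have "norm z * norm a \<le> 1 * norm a" by (intro mult_right_mono) auto
  then have "norm (hdot z a) \<le> norm a" using norm_hdot_le[of z a] by simp
  then show ?thesis using norm_triangle_ineq2[of 1 "- hdot z a"] by simp
qed

lemma ball_aut_0 [simp]: "ball_aut a 0 = a"
  by (simp add: ball_aut_def hdot_def)

lemma ball_aut_eq:
  assumes "norm a < 1"
  shows "ball_aut a z = inverse (1 + hdot z a) *s ((1 + hdot z a * inverse (1 + of_real (sqrt (1 - (norm a)\<^sup>2)))) *s a + of_real (sqrt (1 - (norm a)\<^sup>2)) *s z)"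
  by (simp add: ball_aut_def vec_eq_iff scaleR_conv_of_real[where 'a=complex] algebra_simps)

text \<open>Both sides measure distance from the sphere, so the open ball, the closed ball and the
  sphere are each mapped into themselves. For the numerator N one expands \<open>hdot N N\<close>;
  the relations u (1 + s) = 1 and |a|^2 = 1 - s^2 leave a polynomial identity.\<close>

lemma norm_ball_aut:
  fixes a z :: "complex^'n"
  assumes a: "norm a < 1" and z: "norm z \<le> 1"
  shows "(norm (1 + hdot z a))\<^sup>2 * (1 - (norm (ball_aut a z))\<^sup>2) = (1 - (norm a)\<^sup>2) * (1 - (norm z)\<^sup>2)"
proof -
  define s where "s = sqrt (1 - (norm a)\<^sup>2)"
  have a2: "(norm a)\<^sup>2 \<le> 1" using a by (simp add: power_le_one)
  have s: "0 \<le> s" "(norm a)\<^sup>2 = 1 - s\<^sup>2" using a2 by (auto simp: s_def)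
  define h where "h = hdot z a"
  have h0: "1 + h \<noteq> 0" using one_plus_hdot_ge[OF z, of a] a by (auto simp: h_def)
  define S where "S = complex_of_real s"
  define u where "u = inverse (1 + S)"
  have "1 + s \<noteq> 0" using s(1) by simp
  then have "1 + S \<noteq> 0" unfolding S_def by (metis of_real_1 of_real_add of_real_eq_0_iff)
  then have u: "u * (1 + S) = 1" by (simp add: u_def)
  have cS: "cnj S = S" "cnj u = u" by (simp_all add: S_def u_def)
  define N where "N = (1 + h * u) *s a + S *s z"
  have ba: "ball_aut a z = inverse (1 + h) *s N"
    unfolding N_def h_def u_def S_def s_def using ball_aut_eq[OF a] .
  have aa: "hdot a a = 1 - S\<^sup>2" unfolding hdot_self s S_def by simp
  have az: "hdot a z = cnj h" "hdot z a = h" by (simp_all add: h_def hdot_cnj)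
  have "hdot N N = (1 + h * u) * (1 + cnj h * u) * (1 - S\<^sup>2) + (1 + h * u) * S * cnj h + S * (1 + cnj h * u) * h + S * S * hdot z z"
    unfolding N_def by (simp add: hdot_add_left hdot_add_right hdot_scale_left hdot_scale_right aa az cS algebra_simps)
  then have "(1 + h) * (1 + cnj h) - hdot N N = S\<^sup>2 - S\<^sup>2 * hdot z z"
    using u by algebra
  moreover have "of_real ((norm (1 + h))\<^sup>2) = (1 + h) * (1 + cnj h)"
    by (simp only: complex_norm_square complex_cnj_add complex_cnj_one)
  ultimately have "of_real ((norm (1 + h))\<^sup>2 - (norm N)\<^sup>2) = S\<^sup>2 - S\<^sup>2 * hdot z z"
    by (simp only: of_real_diff hdot_self)
  then have "of_real ((norm (1 + h))\<^sup>2 - (norm N)\<^sup>2) = complex_of_real (s\<^sup>2 - s\<^sup>2 * (norm z)\<^sup>2)"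
    by (simp add: S_def hdot_self)
  then have N: "(norm (1 + h))\<^sup>2 - (norm N)\<^sup>2 = s\<^sup>2 - s\<^sup>2 * (norm z)\<^sup>2" unfolding of_real_eq_iff .
  have "norm (ball_aut a z) = norm N / norm (1 + h)"
    unfolding ba by (simp add: norm_complex_scale norm_inverse divide_inverse)
  then have "norm N = norm (1 + h) * norm (ball_aut a z)" using h0 by simp
  then have "(norm (1 + h))\<^sup>2 * (1 - (norm (ball_aut a z))\<^sup>2) = (norm (1 + h))\<^sup>2 - (norm N)\<^sup>2"
    by (simp add: power_mult_distrib algebra_simps)
  also have "\<dots> = s\<^sup>2 - s\<^sup>2 * (norm z)\<^sup>2" by (rule N)
  also have "\<dots> = (1 - (norm a)\<^sup>2) * (1 - (norm z)\<^sup>2)" by (simp add: s(2) algebra_simps)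
  finally show ?thesis unfolding h_def .
qed

lemma ball_aut_norm_le:
  assumes "norm a < 1" "norm z \<le> 1" shows "norm (ball_aut a z) \<le> 1"
proof -
  have "0 \<le> (1 - (norm a)\<^sup>2) * (1 - (norm z)\<^sup>2)" using assms by (intro mult_nonneg_nonneg) (auto simp: power_le_one)
  moreover have "0 < (norm (1 + hdot z a))\<^sup>2" using one_plus_hdot_ge[OF assms(2), of a] assms(1) by (auto simp: zero_less_power2)
  ultimately have "0 \<le> 1 - (norm (ball_aut a z))\<^sup>2" using norm_ball_aut[OF assms] by (metis zero_le_mult_iff linorder_not_le)
  then show ?thesis by (simp add: abs_square_le_1)
qed

lemma ball_aut_norm_less:
  assumes "norm a < 1" "norm z < 1" shows "norm (ball_aut a z) < 1"
proof -
  have z: "norm z \<le> 1" using assms by simp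
  have "0 < (1 - (norm a)\<^sup>2) * (1 - (norm z)\<^sup>2)" using assms by (intro mult_pos_pos) (auto simp: abs_square_less_1)
  then have "0 < 1 - (norm (ball_aut a z))\<^sup>2" using norm_ball_aut[OF assms(1) z] by (metis zero_less_mult_iff zero_le_power2 linorder_not_le)
  then show ?thesis by (simp add: abs_square_less_1)
qed

lemma ball_aut_norm_eq:
  assumes "norm a < 1" "norm z = 1" shows "norm (ball_aut a z) = 1"
proof -
  have "1 + hdot z a \<noteq> 0" using one_plus_hdot_ge[of z a] assms by auto
  then have "1 - (norm (ball_aut a z))\<^sup>2 = 0" using norm_ball_aut[OF assms(1), of z] assms(2) by simp
  then have "(norm (ball_aut a z))\<^sup>2 = 1\<^sup>2" by simp
  then show ?thesis by (rule power2_eq_imp_eq) auto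
qed

text \<open>For the inner image w one finds 1 + hdot w a = S^2 e, where e is the reciprocal of the
  inner denominator 1 - hdot z a; then the coefficient of a in the outer numerator vanishes and S^2
  e cancels. It serves to write a given point as the image of some w under an automorphism.\<close>

lemma ball_aut_inverse:
  fixes a z :: "complex^'n"
  assumes a: "norm a < 1" and z: "norm z \<le> 1"
  shows "ball_aut a (ball_aut (- a) z) = z"
proof -
  define s where "s = sqrt (1 - (norm a)\<^sup>2)"
  have "(norm a)\<^sup>2 < 1" using a by (simp add: abs_square_less_1)
  then have s: "0 < s" "(norm a)\<^sup>2 = 1 - s\<^sup>2" by (auto simp: s_def)
  define h where "h = hdot z a"
  define S where "S = complex_of_real s"
  define u where "u = inverse (1 + S)"
  have "1 + s \<noteq> 0" using s(1) by simp
  then have "1 + S \<noteq> 0" unfolding S_def by (metis of_real_1 of_real_add of_real_eq_0_iff)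
  then have u: "u * (1 + S) = 1" by (simp add: u_def)
  define e where "e = inverse (1 - h)"
  have "1 - h \<noteq> 0" using one_plus_hdot_ge[OF z, of "-a"] a by (auto simp: h_def hdot_minus_right)
  then have e: "e * (1 - h) = 1" "e \<noteq> 0" by (simp_all add: e_def)
  have S0: "S \<noteq> 0" using s(1) by (simp add: S_def)
  define w where "w = e *s ((-1 + h * u) *s a + S *s z)"
  have w: "ball_aut (- a) z = w"
    using ball_aut_eq[of "- a" z] a
    by (simp add: w_def e_def h_def u_def S_def s_def hdot_minus_right vec_eq_iff algebra_simps)
  have aa: "hdot a a = 1 - S\<^sup>2" unfolding hdot_self s S_def by simp
  have wa: "hdot w a = e * ((-1 + h * u) * (1 - S\<^sup>2) + S * h)"
    unfolding w_def by (simp add: hdot_scale_left hdot_add_left hdot_diff_left aa h_def algebra_simps)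
  have 1: "1 + hdot w a = S\<^sup>2 * e" unfolding wa using u e(1) by algebra
  have wa': "hdot w a = S\<^sup>2 * e - 1" using 1 by (simp add: algebra_simps)
  have "ball_aut a w = inverse (S\<^sup>2 * e) *s ((1 + (S\<^sup>2 * e - 1) * u) *s a + S *s w)"
    using ball_aut_eq[OF a, of w] unfolding 1 unfolding wa' u_def S_def s_def .
  also have "(1 + (S\<^sup>2 * e - 1) * u) *s a + S *s w = (S\<^sup>2 * e) *s z"
  proof -
    have "1 + (S\<^sup>2 * e - 1) * u + S * (e * (-1 + h * u)) = 0" using u e(1) by algebra
    then have "(1 + (S\<^sup>2 * e - 1) * u + S * (e * (-1 + h * u))) * a $ k + S\<^sup>2 * e * z $ k = S\<^sup>2 * e * z $ k" for k by simp
    then show ?thesis by (simp add: w_def vec_eq_iff algebra_simps power2_eq_square)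
  qed
  also have "inverse (S\<^sup>2 * e) *s ((S\<^sup>2 * e) *s z) = z"
  proof -
    have "inverse (S\<^sup>2 * e) * (S\<^sup>2 * e) = 1" by (rule left_inverse) (use S0 e(2) in simp)
    then show ?thesis by (simp only: vector_smult_assoc vector_smult_lid)
  qed
  finally show ?thesis by (simp add: w)
qed

lemma bounded_bilinear_vector_scale: "bounded_bilinear (\<lambda>(c::complex) (v::complex^'n). c *s v)"
  by (rule bounded_bilinear.intro)
    (auto simp: vec_eq_iff algebra_simps norm_complex_scale intro!: exI[of _ 1])

text \<open>Regularity is in the parameter a, with the point w as index. The formula is built from
  admissible operations: the root is safe since 1 - |a|^2 >= 1 - \<rho>^2 > 0, the inverses since 1
  + sqrt (1 - |a|^2) >= 1 and |1 + hdot w a| >= 1 - \<rho>.\<close>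

lemma unif_C11_ball_aut:
  assumes \<rho>: "0 < \<rho>" "\<rho> < 1"
  shows "unif_C11 (cball 0 1) (cball 0 \<rho>) (\<lambda>w a :: complex^'n. ball_aut a w)"
proof -
  let ?W = "cball 0 1 :: (complex^'n) set" and ?S = "cball 0 \<rho> :: (complex^'n) set"
  have S: "convex ?S" "bounded ?S" by auto
  have id: "unif_C11 ?W ?S (\<lambda>w x. x)" by (rule unif_C11_id[OF S(2)])
  have w: "unif_C11 ?W ?S (\<lambda>w x. w)" by (rule unif_C11_const) simp
  have c: "unif_C11 ?W ?S (\<lambda>w x. c)" for c :: "'b::real_normed_vector" by (rule unif_C11_const) (simp add: image_constant_conv)
  have h: "unif_C11 ?W ?S (\<lambda>w x. hdot w x)"
  proof (rule unif_C11I[of _ _ _ 1 1 0])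
    fix w x y :: "complex^'n" assume w: "w \<in> ?W" and x: "x \<in> ?S"
    have hb: "norm (hdot w v) \<le> norm v" for v
      using norm_hdot_le[of w v] mult_right_mono[of "norm w" 1 "norm v"] w by simp
    show "norm (hdot w x) \<le> 1" using hb[of x] x \<rho> by simp
    show "norm (hdot w x - hdot w y) \<le> 1 * norm (x - y)" using hb[of "x - y"] by (simp add: hdot_diff_right)
    show "norm (hdot w x + hdot w y - 2 *\<^sub>R hdot w (midpoint x y)) \<le> 0 * (norm (x - y))\<^sup>2"
      by (simp add: midpoint_def hdot_scaleR_right hdot_add_right scaleR_conv_of_real[where 'a=complex])
  qed
  have "unif_C11 ?W ?S (\<lambda>w x. (x \<bullet> x))"
    by (rule unif_C11_bilinear[OF bounded_bilinear_inner S(1) id id])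
  then have "unif_C11 ?W ?S (\<lambda>w x. (-1) *\<^sub>R (x \<bullet> x))"
    by (rule unif_C11_bilinear[OF bounded_bilinear_scaleR S(1) c])
  then have "unif_C11 ?W ?S (\<lambda>w x. 1 + (-1) *\<^sub>R (x \<bullet> x))"
    by (rule unif_C11_add[OF c])
  then have q: "unif_C11 ?W ?S (\<lambda>w x. 1 - (norm x)\<^sup>2)" by (simp add: power2_norm_eq_inner)
  have \<sigma>: "0 < 1 - \<rho>\<^sup>2" using \<rho> by (simp add: abs_square_less_1)
  have s: "unif_C11 ?W ?S (\<lambda>w x. sqrt (1 - (norm x)\<^sup>2))"
  proof (rule unif_C11_sqrt[OF S(1) q, of "sqrt (1 - \<rho>\<^sup>2)"])
    fix x :: "complex^'n" assume "x \<in> ?S"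
    then show "(sqrt (1 - \<rho>\<^sup>2))\<^sup>2 \<le> 1 - (norm x)\<^sup>2" using \<sigma> by (simp add: power_mono)
  qed (use \<sigma> in auto)
  have nx: "(norm x)\<^sup>2 \<le> 1" if "x \<in> ?S" for x using that \<rho> by (simp add: power_le_one)
  have i1: "unif_C11 ?W ?S (\<lambda>w x. inverse (1 + sqrt (1 - (norm x)\<^sup>2)))"
    by (rule unif_C11_inverse[OF S(1) unif_C11_add[OF c s], of 1]) (use nx in auto)
  have i2: "unif_C11 ?W ?S (\<lambda>w x. inverse (1 + hdot w x))"
  proof (rule unif_C11_inverse[OF S(1) unif_C11_add[OF c h], of "1 - \<rho>"])
    fix w x :: "complex^'n" assume "w \<in> ?W" "x \<in> ?S"
    then show "1 - \<rho> \<le> norm (1 + hdot w x)" using one_plus_hdot_ge[of w x] by simp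
  qed (use \<rho> in auto)
  note bs = unif_C11_bilinear[OF bounded_bilinear_vector_scale S(1)] and bR = unif_C11_bilinear[OF bounded_bilinear_scaleR S(1)]
  show ?thesis
    unfolding ball_aut_def
    by (rule bs[OF i2 unif_C11_add[OF unif_C11_add[OF id bR[OF s w]] bs[OF h bR[OF i1 id]]]])
qed

text \<open>The index w ranges over the whole closed ball; the C^{1,1} bound for \<phi> up to the
  sphere is what makes the constant uniform.\<close>

lemma unif_C11_compose_ball_aut:
  fixes \<phi> :: "complex^'n \<Rightarrow> real"
  assumes \<rho>: "0 < \<rho>" "\<rho> < 1" and \<phi>: "C11_on (cball 0 1) \<phi>"
  shows "unif_C11 (cball 0 1) (cball 0 \<rho>) (\<lambda>w a. \<phi> (ball_aut a w))"
proof -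
  obtain F' L where F: "0 \<le> L" "\<forall>p\<in>cball 0 1. \<bar>\<phi> p\<bar> \<le> L \<and> linear (F' p) \<and> (\<forall>v. \<bar>F' p v\<bar> \<le> L * norm v)"
    "\<forall>p\<in>cball 0 1. \<forall>q\<in>cball 0 1. \<bar>\<phi> p - \<phi> q - F' q (p - q)\<bar> \<le> L * (norm (p - q))\<^sup>2"
    using C11_on_quadratic_remainder[OF \<phi>] by auto
  show ?thesis
  proof (rule unif_C11_compose[where F=\<phi> and T="cball 0 1" and F'=F' and L=L, OF _ unif_C11_ball_aut[OF \<rho>]])
    fix w x :: "complex^'n" assume "w \<in> cball 0 1" "x \<in> cball 0 \<rho>"
    then show "ball_aut x w \<in> cball 0 1" using ball_aut_norm_le[of x w] \<rho> by simp
  qed (use F in auto)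
qed

subsection \<open>Plurisubharmonic functions along analytic discs\<close>

lemma holomorphic_circle_mean:
  assumes f: "f holomorphic_on S" and S: "cball z r \<subseteq> S" "open S" and r: "0 < r"
  shows "((\<lambda>\<theta>. f (z + of_real r * cis \<theta>)) has_integral 2 * of_real pi * f z) {0..2*pi}"
proof -
  have cont: "continuous_on (cball z r) f"
    using f S by (meson holomorphic_on_imp_continuous_on holomorphic_on_subset)
  have cont': "continuous_on {0..2*pi} (\<lambda>\<theta>. f (z + of_real r * cis \<theta>))"
    by (rule continuous_on_compose2[OF cont]) (use r in \<open>auto intro!: continuous_intros simp: dist_norm norm_mult\<close>)
  then have int: "(\<lambda>\<theta>. f (z + of_real r * cis \<theta>)) integrable_on {0..2*pi}"
    by (rule integrable_continuous_real)
  have "((\<lambda>u. f u / (u - z)) has_contour_integral 2 * of_real pi * \<i> * f z) (circlepath z r)"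
    by (rule Cauchy_integral_circlepath[OF cont]) (use f S r in \<open>auto intro: holomorphic_on_subset[OF _ order_trans[OF ball_subset_cball]]\<close>)
  then have "contour_integral (circlepath z r) (\<lambda>u. f u / (u - z)) = 2 * of_real pi * \<i> * f z"
    by (rule contour_integral_unique)
  then have "integral {0..2*pi} (\<lambda>t. f (z + of_real r * cis t) / (z + of_real r * cis t - z) * of_real r * \<i> * cis t) = 2 * of_real pi * \<i> * f z"
    by (simp add: circlepath_def contour_integral_part_circlepath_eq)
  also have "(\<lambda>t. f (z + of_real r * cis t) / (z + of_real r * cis t - z) * of_real r * \<i> * cis t) = (\<lambda>t. \<i> * f (z + of_real r * cis t))"
    using r by (auto simp: fun_eq_iff)
  also have "integral {0..2*pi} (\<lambda>t. \<i> * f (z + of_real r * cis t)) = \<i> * integral {0..2*pi} (\<lambda>t. f (z + of_real r * cis t))"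
    using integral_linear[OF int, of "\<lambda>x. \<i> * x"] by (simp add: o_def bounded_linear_mult_right)
  finally have "integral {0..2*pi} (\<lambda>t. f (z + of_real r * cis t)) = 2 * of_real pi * f z" by simp
  then show ?thesis using int by (metis integrable_integral)
qed

lemma has_integral_Re: "(f has_integral I) S \<Longrightarrow> ((\<lambda>x. Re (f x)) has_integral Re I) S"
  using has_integral_linear[OF _ bounded_linear_Re, of f I S] by (simp add: o_def)

lemma has_integral_inner_complex: "(f has_integral (I::complex)) S \<Longrightarrow> ((\<lambda>x. w \<bullet> f x) has_integral w \<bullet> I) S"
  using has_integral_linear[OF _ bounded_linear_inner_right, of f I S w] by (simp add: o_def)

text \<open>The Taylor remainder of first order is itself holomorphic and vanishes at z, so its
  circle means are zero. This cancellation, beyond the mere quadratic size, is what the argument on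
  analytic discs uses.\<close>

lemma holomorphic_quadratic_remainder:
  assumes f: "f holomorphic_on S" and S: "open S" "z \<in> S"
  shows "\<exists>\<delta> C. 0 < \<delta> \<and> 0 \<le> C \<and> (\<forall>t. norm t < \<delta> \<longrightarrow> norm (f (z + t) - f z - deriv f z * t) \<le> C * (norm t)\<^sup>2) \<and>
    (\<forall>r. 0 < r \<longrightarrow> r < \<delta> \<longrightarrow>
      ((\<lambda>\<theta>. f (z + of_real r * cis \<theta>) - f z - deriv f z * (of_real r * cis \<theta>)) has_integral 0) {0..2*pi})"
proof -
  obtain \<delta> where d: "0 < \<delta>" "cball z \<delta> \<subseteq> S" using S by (meson open_contains_cball)
  have h2: "(deriv (deriv f)) holomorphic_on S" using f S by (intro holomorphic_deriv)
  have "continuous_on (cball z \<delta>) (deriv (deriv f))"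
    using h2 d by (meson holomorphic_on_imp_continuous_on holomorphic_on_subset)
  then have "bounded (deriv (deriv f) ` cball z \<delta>)"
    by (intro compact_imp_bounded compact_continuous_image) auto
  then obtain C where C: "0 < C" "\<And>x. x \<in> cball z \<delta> \<Longrightarrow> norm (deriv (deriv f) x) \<le> C"
    by (auto simp: bounded_pos)
  show ?thesis
  proof (rule exI[of _ \<delta>], rule exI[of _ C], intro conjI allI impI)
    fix t :: complex assume t: "norm t < \<delta>"
    let ?F = "\<lambda>i::nat. if i = 0 then f else if i = 1 then deriv f else deriv (deriv f)"
    have "norm (?F 0 (z + t) - (\<Sum>i\<le>1. ?F i z * ((z + t) - z) ^ i / fact i)) \<le> C * norm ((z + t) - z) ^ (Suc 1) / fact 1"
    proof (rule complex_Taylor[of "cball z \<delta>" 1 ?F C z "z + t"])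
      fix i x assume "x \<in> cball z \<delta>" "i \<le> (1::nat)"
      then have x: "x \<in> S" "i = 0 \<or> i = 1" using d by auto
      have "(f has_field_derivative deriv f x) (at x)" "(deriv f has_field_derivative deriv (deriv f) x) (at x)"
        using x f S(1) by (auto intro!: holomorphic_derivI holomorphic_deriv)
      then show "(?F i has_field_derivative ?F (Suc i) x) (at x within cball z \<delta>)"
        using x(2) by (auto intro: has_field_derivative_at_within)
    qed (use C t d in \<open>auto simp: dist_norm\<close>)
    then show "norm (f (z + t) - f z - deriv f z * t) \<le> C * (norm t)\<^sup>2"
      by (simp add: numeral_2_eq_2 algebra_simps)
  next
    fix r :: real assume r: "0 < r" "r < \<delta>"
    have sub: "cball z r \<subseteq> S" using r d(2) by (meson less_imp_le order_trans subset_cball)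
    have 1: "((\<lambda>\<theta>. f (z + of_real r * cis \<theta>)) has_integral 2 * of_real pi * f z) {0..2*pi}"
      by (rule holomorphic_circle_mean[OF f sub S(1) r(1)])
    have 2: "((\<lambda>\<theta>. 0 + of_real r * cis \<theta>) has_integral 2 * of_real pi * 0) {0..2*pi}"
      by (rule holomorphic_circle_mean[where f="\<lambda>x. x" and S=UNIV]) (use r in \<open>auto intro!: holomorphic_intros\<close>)
    have 3: "((\<lambda>\<theta>. f z) has_integral 2 * of_real pi * f z) {0..2*pi}"
      using has_integral_const_real[of "f z" 0 "2*pi"] by (simp add: scaleR_conv_of_real)
    show "((\<lambda>\<theta>. f (z + of_real r * cis \<theta>) - f z - deriv f z * (of_real r * cis \<theta>)) has_integral 0) {0..2*pi}"
      using has_integral_diff[OF has_integral_diff[OF 1 3] has_integral_mult_right[OF 2, of "deriv f z"]] by simp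
  qed (use C d in auto)
qed

lemma mult_cnj_unit: "norm \<xi> = 1 \<Longrightarrow> \<xi> * cnj \<xi> = 1"
  by (metis complex_norm_square of_real_1 one_power2)

text \<open>On the unit circle conjugation inverts \<xi>, so the product is a multiple of a power of
  \<xi> or of its conjugate; in the latter case conjugating leaves the real part unchanged.\<close>

lemma Re_monomial_cnj_product_on_circle:
  "\<exists>p. \<forall>\<xi>. norm \<xi> = 1 \<longrightarrow> Re (a * \<xi> ^ m * cnj (b * \<xi> ^ k)) = Re (poly p \<xi>)"
proof (cases "k \<le> m")
  case True
  show ?thesis
  proof (intro exI[of _ "monom (a * cnj b) (m - k)"] allI impI)
    fix \<xi> :: complex assume "norm \<xi> = 1"
    then have "\<xi> ^ k * cnj (\<xi> ^ k) = 1" by (metis mult_cnj_unit complex_cnj_power power_mult_distrib power_one)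
    moreover have "\<xi> ^ m = \<xi> ^ (m - k) * \<xi> ^ k" using True by (simp flip: power_add)
    moreover have "a * (u * v) * cnj (b * v) = a * cnj b * u * (v * cnj v)" for u v by (simp add: mult_ac)
    ultimately have "a * \<xi> ^ m * cnj (b * \<xi> ^ k) = a * cnj b * \<xi> ^ (m - k)" by (metis mult.right_neutral)
    then show "Re (a * \<xi> ^ m * cnj (b * \<xi> ^ k)) = Re (poly (monom (a * cnj b) (m - k)) \<xi>)" by (simp only: poly_monom)
  qed
next
  case False
  show ?thesis
  proof (intro exI[of _ "monom (cnj a * b) (k - m)"] allI impI)
    fix \<xi> :: complex assume "norm \<xi> = 1"
    then have "\<xi> ^ m * cnj (\<xi> ^ m) = 1" by (metis mult_cnj_unit complex_cnj_power power_mult_distrib power_one)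
    moreover have "\<xi> ^ k = \<xi> ^ (k - m) * \<xi> ^ m" using False by (simp flip: power_add)
    moreover have "cnj (a * v * cnj (b * (u * v))) = cnj a * b * u * (v * cnj v)" for u v by (simp add: mult_ac)
    ultimately have "cnj (a * \<xi> ^ m * cnj (b * \<xi> ^ k)) = cnj a * b * \<xi> ^ (k - m)" by (metis mult.right_neutral)
    then show "Re (a * \<xi> ^ m * cnj (b * \<xi> ^ k)) = Re (poly (monom (cnj a * b) (k - m)) \<xi>)"
      by (metis cnj.sel(1) poly_monom)
  qed
qed

lemma Re_poly_sum: "(\<And>i. i \<in> I \<Longrightarrow> \<exists>p. \<forall>\<xi>. norm \<xi> = 1 \<longrightarrow> Re (f i \<xi>) = Re (poly p \<xi>)) \<Longrightarrow> finite I \<Longrightarrow>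
   \<exists>p. \<forall>\<xi>. norm \<xi> = 1 \<longrightarrow> Re (\<Sum>i\<in>I. f i \<xi>) = Re (poly p \<xi>)"
proof -
  assume a: "\<And>i. i \<in> I \<Longrightarrow> \<exists>p. \<forall>\<xi>. norm \<xi> = 1 \<longrightarrow> Re (f i \<xi>) = Re (poly p \<xi>)" "finite I"
  obtain p where "\<And>i. i \<in> I \<Longrightarrow> \<forall>\<xi>. norm \<xi> = 1 \<longrightarrow> Re (f i \<xi>) = Re (poly (p i) \<xi>)" using a(1) by metis
  then show ?thesis by (intro exI[of _ "\<Sum>i\<in>I. p i"]) (auto simp: poly_sum)
qed

text \<open>Re a Re b is half the real part of a b + a cnj b. Hence real parts of polynomials,
  restricted to the circle, are closed under products, as Stone-Weierstrass requires.\<close>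

lemma Re_poly_mult_on_circle:
  "\<exists>r. \<forall>\<xi>. norm \<xi> = 1 \<longrightarrow> Re (poly p \<xi>) * Re (poly q \<xi>) = Re (poly r \<xi>)"
proof -
  have "\<exists>s. \<forall>\<xi>. norm \<xi> = 1 \<longrightarrow> Re (\<Sum>m\<le>degree p. \<Sum>k\<le>degree q. coeff p m * \<xi> ^ m * cnj (coeff q k * \<xi> ^ k)) = Re (poly s \<xi>)"
    by (intro Re_poly_sum Re_monomial_cnj_product_on_circle) auto
  moreover have "(\<Sum>m\<le>degree p. \<Sum>k\<le>degree q. coeff p m * \<xi> ^ m * cnj (coeff q k * \<xi> ^ k)) = poly p \<xi> * cnj (poly q \<xi>)" for \<xi>
    by (simp add: poly_altdef sum_product cnj_sum)
  ultimately obtain s where s: "\<forall>\<xi>. norm \<xi> = 1 \<longrightarrow> Re (poly p \<xi> * cnj (poly q \<xi>)) = Re (poly s \<xi>)" by (simp only:) blast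
  show ?thesis
  proof (intro exI[of _ "smult (1/2) (p * q + s)"] allI impI)
    fix \<xi> :: complex assume "norm \<xi> = 1"
    have "Re (poly p \<xi>) * Re (poly q \<xi>) = Re (poly p \<xi> * poly q \<xi> + poly p \<xi> * cnj (poly q \<xi>)) / 2" by simp
    also have "\<dots> = Re (poly (smult (1/2) (p * q + s)) \<xi>)" using s[rule_format, OF \<open>norm \<xi> = 1\<close>] by simp
    finally show "Re (poly p \<xi>) * Re (poly q \<xi>) = Re (poly (smult (1/2) (p * q + s)) \<xi>)" .
  qed
qed

text \<open>A substitute for solving the Dirichlet problem: continuous values on the circle are
  matched up to e by an explicit function that is harmonic in the whole plane.\<close>

lemma harmonic_polynomial_approx_on_circle:
  fixes v :: "complex \<Rightarrow> real"
  assumes v: "continuous_on (sphere 0 1) v" and e: "0 < e"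
  shows "\<exists>p. \<forall>\<xi>\<in>sphere 0 1. \<bar>v \<xi> - Re (poly p \<xi>)\<bar> < e"
proof -
  define R where "R = {f. continuous_on (sphere 0 1) f \<and> (\<exists>p. \<forall>\<xi>. norm \<xi> = 1 \<longrightarrow> f \<xi> = Re (poly p \<xi>))}"
  have "function_ring_on R (sphere 0 1)"
  proof
    show "compact (sphere 0 (1::real) :: complex set)" by simp
  next
    fix f assume "f \<in> R" then show "continuous_on (sphere 0 1) f" by (simp add: R_def)
  next
    fix f g assume fg: "f \<in> R" "g \<in> R"
    then obtain p q where pq: "\<And>\<xi>. norm \<xi> = 1 \<Longrightarrow> f \<xi> = Re (poly p \<xi>)" "\<And>\<xi>. norm \<xi> = 1 \<Longrightarrow> g \<xi> = Re (poly q \<xi>)"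
      by (auto simp: R_def)
    then have "\<exists>p. \<forall>\<xi>. norm \<xi> = 1 \<longrightarrow> f \<xi> + g \<xi> = Re (poly p \<xi>)" by (intro exI[of _ "p + q"]) simp
    then show "(\<lambda>x. f x + g x) \<in> R" using fg by (auto simp: R_def intro!: continuous_intros)
    have "\<exists>p. \<forall>\<xi>. norm \<xi> = 1 \<longrightarrow> f \<xi> * g \<xi> = Re (poly p \<xi>)"
      using Re_poly_mult_on_circle[of p q] pq by auto
    then show "(\<lambda>x. f x * g x) \<in> R" using fg by (auto simp: R_def intro!: continuous_intros)
  next
    fix c :: real
    show "(\<lambda>_. c) \<in> R" by (auto simp: R_def intro!: exI[of _ "[:of_real c:]"])
  next
    fix x y :: complex assume xy: "x \<in> sphere 0 1" "y \<in> sphere 0 1" "x \<noteq> y"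
    have "Re \<in> R" by (auto simp: R_def intro!: continuous_intros exI[of _ "[:0, 1:]"])
    moreover have "Im \<in> R" by (auto simp: R_def intro!: continuous_intros exI[of _ "[:0, -\<i>:]"])
    ultimately show "\<exists>f\<in>R. f x \<noteq> f y" using xy(3) complex_eqI by blast
  qed
  then obtain g where "g \<in> R" "\<forall>x\<in>sphere 0 1. \<bar>v x - g x\<bar> < e"
    using function_ring_on.Stone_Weierstrass_basic[OF _ v e] by blast
  then show ?thesis by (fastforce simp: R_def)
qed

lemma plurisubharmonic_on_submean:
  assumes "plurisubharmonic_on sm \<Omega> u" and "\<And>\<xi>. norm \<xi> \<le> 1 \<Longrightarrow> a + sm \<xi> b \<in> \<Omega>"
  shows "(\<lambda>\<theta>. u (a + sm (cis \<theta>) b)) integrable_on {0..2*pi}"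
    and "2 * pi * u a \<le> integral {0..2*pi} (\<lambda>\<theta>. u (a + sm (cis \<theta>) b))"
proof -
  have *: "(\<lambda>\<theta>. u (a + sm (cis \<theta>) b)) absolutely_integrable_on {0..2*pi}"
    "u a \<le> integral {0..2*pi} (\<lambda>\<theta>. u (a + sm (cis \<theta>) b)) / (2 * pi)"
    using assms unfolding plurisubharmonic_on_def by blast+
  show "(\<lambda>\<theta>. u (a + sm (cis \<theta>) b)) integrable_on {0..2*pi}"
    using *(1) by (rule set_lebesgue_integral_eq_integral)
  show "2 * pi * u a \<le> integral {0..2*pi} (\<lambda>\<theta>. u (a + sm (cis \<theta>) b))"
    using *(2) by (simp add: field_simps)
qed

lemma prod_scale_prod_scale: "prod_scale a (prod_scale b p) = prod_scale (a * b) p"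
  by (simp add: prod_scale_def vector_smult_assoc)

text \<open>Doubling the variables avoids smoothing \<open>U\<close>: maximize
  \<open>U (\<gamma> \<xi> + w) - h \<xi> + \<eta> \<bar>\<xi>\<bar>\<^sup>2 - k \<bar>w\<bar>\<^sup>2\<close> over \<open>(w, \<xi>)\<close> and, at an interior maximum, let \<open>\<gamma> \<xi> + w\<close> run through the tangent disc of \<open>\<gamma>\<close>. Since the quadratic
  remainder of \<open>\<gamma>\<close> has mean zero on circles, the penalty changes only by \<open>O(r\<^sup>4)\<close>.\<close>

lemma psh_analytic_disc_max_principle:
  fixes U :: "(complex^'n) \<times> complex \<Rightarrow> real" and \<gamma> :: "complex \<Rightarrow> (complex^'n) \<times> complex"
  assumes psh: "plurisubharmonic_on prod_scale \<Omega> U" and Uc: "continuous_on \<Omega> U"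
    and gc: "continuous_on (cball 0 1) \<gamma>" and gO: "\<gamma> ` cball 0 1 \<subseteq> \<Omega>"
    and rem: "\<And>\<xi>. \<xi> \<in> ball 0 1 \<Longrightarrow> \<exists>b C \<delta>. 0 < \<delta> \<and>
        (\<forall>t. norm t < \<delta> \<longrightarrow> norm (\<gamma> (\<xi> + t) - \<gamma> \<xi> - prod_scale t b) \<le> C * (norm t)\<^sup>2) \<and>
        (\<forall>r w. 0 < r \<longrightarrow> r < \<delta> \<longrightarrow> ((\<lambda>\<theta>. w \<bullet> (\<gamma> (\<xi> + of_real r * cis \<theta>) - \<gamma> \<xi> - prod_scale (of_real r * cis \<theta>) b)) has_integral 0) {0..2*pi})"
    and hc: "continuous_on (cball 0 1) h"
    and hm: "\<And>\<xi> r. 0 < r \<Longrightarrow> cball \<xi> r \<subseteq> ball 0 1 \<Longrightarrow> ((\<lambda>\<theta>. h (\<xi> + of_real r * cis \<theta>)) has_integral 2 * pi * h \<xi>) {0..2*pi}"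
    and M: "\<And>\<xi>. norm \<xi> = 1 \<Longrightarrow> U (\<gamma> \<xi>) - h \<xi> \<le> M"
  shows "U (\<gamma> 0) - h 0 \<le> M"
proof (rule ccontr)
  assume neg: "\<not> U (\<gamma> 0) - h 0 \<le> M"
  define \<eta> where "\<eta> = (U (\<gamma> 0) - h 0 - M) / 2"
  have \<eta>: "0 < \<eta>" "U (\<gamma> 0) - h 0 = M + 2 * \<eta>" using neg by (auto simp: \<eta>_def field_simps)
  have "open \<Omega>" using psh by (simp add: plurisubharmonic_on_def)
  have cK: "compact (\<gamma> ` cball 0 1)" using gc by (intro compact_continuous_image) auto
  obtain \<delta>1 where d1: "0 < \<delta>1" "{x. infdist x (\<gamma> ` cball 0 1) \<le> \<delta>1} \<subseteq> \<Omega>"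
    using compact_in_open_separated[OF _ cK \<open>open \<Omega>\<close> gO] by auto
  have in\<Omega>: "\<gamma> \<xi> + w \<in> \<Omega>" if "norm w \<le> \<delta>1" "norm \<xi> \<le> 1" for \<xi> w
  proof -
    have "infdist (\<gamma> \<xi> + w) (\<gamma> ` cball 0 1) \<le> dist (\<gamma> \<xi> + w) (\<gamma> \<xi>)"
      using that by (intro infdist_le) auto
    then show ?thesis using d1 that by (auto simp: dist_norm)
  qed
  define V where "V x = U (\<gamma> (snd x) + fst x)" for x
  have Vc: "continuous_on (cball 0 \<delta>1 \<times> cball 0 1) V"
    unfolding V_def by (rule continuous_on_compose2[OF Uc])
      (auto intro!: continuous_intros continuous_on_compose2[OF gc] simp: in\<Omega>)
  have "uniformly_continuous_on (cball 0 \<delta>1 \<times> cball 0 1) V"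
    by (intro compact_uniformly_continuous Vc compact_Times) auto
  then obtain d where d: "0 < d" "\<And>x x'. x \<in> cball 0 \<delta>1 \<times> cball 0 1 \<Longrightarrow> x' \<in> cball 0 \<delta>1 \<times> cball 0 1 \<Longrightarrow> dist x' x < d \<Longrightarrow> dist (V x') (V x) < \<eta>/2"
    unfolding uniformly_continuous_on_def using \<eta>(1) by (meson half_gt_zero)
  define \<delta>0 where "\<delta>0 = min \<delta>1 (d/2)"
  have d0: "0 < \<delta>0" "\<delta>0 \<le> \<delta>1" "\<delta>0 < d" using d d1 by (auto simp: \<delta>0_def)
  have osc: "U (\<gamma> \<xi> + w) - U (\<gamma> \<xi>) \<le> \<eta>/2" if "norm w \<le> \<delta>0" "norm \<xi> \<le> 1" for \<xi> w
  proof -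
    have "dist (V (w,\<xi>)) (V (0,\<xi>)) < \<eta>/2" using that d0 d1 by (intro d(2)) (auto simp: dist_Pair_Pair)
    then have "\<bar>U (\<gamma> \<xi> + w) - U (\<gamma> \<xi>)\<bar> < \<eta>/2" unfolding V_def dist_real_def fst_conv snd_conv add_0_right .
    then show ?thesis using abs_ge_self[of "U (\<gamma> \<xi> + w) - U (\<gamma> \<xi>)"] by linarith
  qed
  \<comment> \<open>At |w| = \<delta>0 the penalty equals \<eta>, more than the \<eta>/2 that a
    displacement by w can gain. So the maximum is attained in the open ball of
    displacements.\<close>
  define k where "k = \<eta> / \<delta>0\<^sup>2"
  have k: "0 < k" "k * \<delta>0\<^sup>2 = \<eta>" using \<eta> d0 by (auto simp: k_def)
  define F where "F w \<xi> = U (\<gamma> \<xi> + w) - h \<xi> + \<eta> * (norm \<xi>)\<^sup>2 - k * (norm w)\<^sup>2" for w \<xi>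
  have "continuous_on (cball 0 \<delta>0 \<times> cball 0 1) (\<lambda>x. F (fst x) (snd x))"
    unfolding F_def using Vc[unfolded V_def] d0
    by (auto intro!: continuous_intros continuous_on_compose2[OF hc] elim: continuous_on_subset)
  moreover have "compact (cball 0 \<delta>0 \<times> cball 0 1 :: (((complex^'n) \<times> complex) \<times> complex) set)" by (intro compact_Times) auto
  moreover have "cball 0 \<delta>0 \<times> cball 0 1 \<noteq> ({} :: (((complex^'n) \<times> complex) \<times> complex) set)" using d0 by auto
  ultimately obtain x where x: "x \<in> cball 0 \<delta>0 \<times> cball 0 1" "\<And>y. y \<in> cball 0 \<delta>0 \<times> cball 0 1 \<Longrightarrow> F (fst y) (snd y) \<le> F (fst x) (snd x)"
    using continuous_attains_sup by (metis (no_types, lifting))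
  define w0 \<xi>0 where "w0 = fst x" and "\<xi>0 = snd x"
  have w0: "norm w0 \<le> \<delta>0" and \<xi>0: "norm \<xi>0 \<le> 1" using x(1) by (auto simp: w0_def \<xi>0_def)
  have mx: "F w \<xi> \<le> F w0 \<xi>0" if "norm w \<le> \<delta>0" "norm \<xi> \<le> 1" for w \<xi>
    using x(2)[of "(w,\<xi>)"] that by (simp add: w0_def \<xi>0_def)
  have "k * (norm w0)\<^sup>2 \<le> \<eta> / 2"
    using mx[of 0 \<xi>0] osc[OF w0 \<xi>0] \<xi>0 d0 by (simp add: F_def)
  then have "k * (norm w0)\<^sup>2 < k * \<delta>0\<^sup>2" using \<eta> k by simp
  then have "(norm w0)\<^sup>2 < \<delta>0\<^sup>2" unfolding mult_less_cancel_left_pos[OF k(1)] .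
  then have w0': "norm w0 < \<delta>0" by (rule power2_less_imp_less) (use d0 in simp)
  \<comment> \<open>On the unit circle \<open>F\<close> is at most M + 3 \<eta>/2, whereas F 0 0 = M
    + 2 \<eta>.\<close>
  have \<xi>0': "norm \<xi>0 < 1"
  proof (rule ccontr)
    assume "\<not> norm \<xi>0 < 1"
    then have n1: "norm \<xi>0 = 1" using \<xi>0 by simp
    have "M + 2 * \<eta> \<le> F w0 \<xi>0" using mx[of 0 0] d0 \<eta>(2) by (simp add: F_def)
    also have "\<dots> \<le> U (\<gamma> \<xi>0) + \<eta>/2 - h \<xi>0 + \<eta>"
    proof -
      have "0 \<le> k * (norm w0)\<^sup>2" using k by simp
      moreover have "F w0 \<xi>0 = U (\<gamma> \<xi>0 + w0) - h \<xi>0 + \<eta> - k * (norm w0)\<^sup>2" by (simp add: F_def n1)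
      ultimately show ?thesis using osc[OF w0 \<xi>0] by linarith
    qed
    also have "\<dots> \<le> M + \<eta>/2 + \<eta>" using M[OF n1] by simp
    finally show False using \<eta>(1) by simp
  qed
  have "\<xi>0 \<in> ball 0 1" using \<xi>0' by simp
  from rem[OF this] obtain b C \<delta> where R: "0 < \<delta> \<and>
        (\<forall>t. norm t < \<delta> \<longrightarrow> norm (\<gamma> (\<xi>0 + t) - \<gamma> \<xi>0 - prod_scale t b) \<le> C * (norm t)\<^sup>2) \<and>
        (\<forall>r w. 0 < r \<longrightarrow> r < \<delta> \<longrightarrow> ((\<lambda>\<theta>. w \<bullet> (\<gamma> (\<xi>0 + of_real r * cis \<theta>) - \<gamma> \<xi>0 - prod_scale (of_real r * cis \<theta>) b)) has_integral 0) {0..2*pi})"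
    by blast
  note \<delta> = R[THEN conjunct1] and q = R[THEN conjunct2, THEN conjunct1, rule_format]
    and qi = R[THEN conjunct2, THEN conjunct2, rule_format]
  define Q where "Q t = \<gamma> (\<xi>0 + t) - \<gamma> \<xi>0 - prod_scale t b" for t
  have C: "0 \<le> C" using order_trans[OF norm_ge_zero q[of "of_real (\<delta>/2)"]] \<delta> by (simp add: zero_le_mult_iff)
  define g where "g = \<delta>0 - norm w0"
  have g: "0 < g" using w0' by (simp add: g_def)
  \<comment> \<open>In order, the terms keep the expansion of \<gamma> valid, keep \<xi>0 + t in the
    disc, give r^2 <= r, keep the displacement w0 - Q t within \<delta>0, and make k C^2 r^2 at most
    \<eta>/2 for the final contradiction.\<close>
  define r where "r = Min {\<delta>/2, (1 - norm \<xi>0)/2, 1, g / (C + 1), \<eta> / (2 * (k * C\<^sup>2 + 1))}"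
  have kC: "0 < k * C\<^sup>2 + 1" using k by (simp add: add_nonneg_pos)
  have rpos: "0 < r" unfolding r_def using \<delta> \<xi>0' g C \<eta> kC by (subst Min_gr_iff) auto
  have rle: "r \<le> \<delta>/2" "r \<le> (1 - norm \<xi>0)/2" "r \<le> 1" "r \<le> g/(C+1)" "r \<le> \<eta> / (2 * (k * C\<^sup>2 + 1))"
    unfolding r_def by (rule Min_le; simp)+
  have r\<delta>: "r < \<delta>" using rle(1) \<delta> by simp
  have rsq: "r\<^sup>2 \<le> r" using rle(3) rpos by (simp add: power2_eq_square mult_left_le_one_le)
  have Qs: "norm (Q t) \<le> C * r\<^sup>2" "norm (Q t) \<le> g" "norm (\<xi>0 + t) \<le> 1" if t: "norm t \<le> r" for t
  proof -
    have "norm (Q t) \<le> C * (norm t)\<^sup>2" unfolding Q_def using q[of t] t r\<delta> by simp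
    also have "\<dots> \<le> C * r\<^sup>2" using C t by (intro mult_left_mono power_mono) auto
    finally show 1: "norm (Q t) \<le> C * r\<^sup>2" .
    also have "\<dots> \<le> (C + 1) * r" using rsq C rpos by (simp add: mult_mono)
    also have "\<dots> \<le> g" using rle(4) C by (simp add: field_simps)
    finally show "norm (Q t) \<le> g" .
    have "norm (\<xi>0 + t) \<le> norm \<xi>0 + r" using norm_triangle_ineq[of \<xi>0 t] t by simp
    also have "\<dots> \<le> 1" using rle(2) \<xi>0' by (simp add: field_simps)
    finally show "norm (\<xi>0 + t) \<le> 1" .
  qed
  define p0 where "p0 = \<gamma> \<xi>0 + w0"
  have wQ: "norm (w0 - Q t) \<le> \<delta>0" if "norm t \<le> r" for t
    using Qs(2)[OF that] norm_triangle_ineq4[of w0 "Q t"] by (simp add: g_def)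
  \<comment> \<open>The flat disc through p0 in direction b is traced by pairs (w0 - Q t, \<xi>0 +
    t), all of them admissible in \<open>F\<close>; so maximality of \<open>F\<close> bounds
    \<open>U\<close> on it.\<close>
  have pt: "p0 + prod_scale t b = \<gamma> (\<xi>0 + t) + (w0 - Q t)" for t
    by (simp add: p0_def Q_def)
  define br where "br = prod_scale (of_real r) b"
  have disc: "p0 + prod_scale \<xi> br \<in> \<Omega>" if "norm \<xi> \<le> 1" for \<xi>
  proof -
    have n: "norm (\<xi> * of_real r) \<le> r" using that rpos by (simp add: norm_mult mult_left_le_one_le)
    have "p0 + prod_scale \<xi> br = \<gamma> (\<xi>0 + \<xi> * of_real r) + (w0 - Q (\<xi> * of_real r))"
      unfolding br_def prod_scale_prod_scale by (rule pt)
    also have "\<dots> \<in> \<Omega>" using wQ[OF n] Qs(3)[OF n] d0 by (intro in\<Omega>) auto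
    finally show ?thesis .
  qed
  have sub: "(\<lambda>\<theta>. U (p0 + prod_scale (cis \<theta>) br)) integrable_on {0..2*pi}"
     "2 * pi * U p0 \<le> integral {0..2*pi} (\<lambda>\<theta>. U (p0 + prod_scale (cis \<theta>) br))"
    using plurisubharmonic_on_submean[OF psh, of p0 br] disc by blast+
  let ?e = "\<lambda>\<theta>. of_real r * cis \<theta>"
  have ne: "norm (?e \<theta>) \<le> r" for \<theta> using rpos by (simp add: norm_mult)
  \<comment> \<open>After integration over \<theta> the linear term and the cross term w0 \<bullet>
    Q vanish and h keeps its mean. Against the sub-mean inequality at p0 there remains \<eta> r^2 <=
    k C^2 r^4, which fails for the chosen r.\<close>
  have point: "U (p0 + prod_scale (cis \<theta>) br) \<le> (F w0 \<xi>0 - \<eta> * ((norm \<xi>0)\<^sup>2 + r\<^sup>2) + k * (norm w0)\<^sup>2 + k * C\<^sup>2 * r^4)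
      + (h (\<xi>0 + ?e \<theta>) - 2 * \<eta> * (\<xi>0 \<bullet> (0 + ?e \<theta>)) - 2 * k * (w0 \<bullet> Q (?e \<theta>)))" for \<theta>
  proof -
    have e1: "p0 + prod_scale (cis \<theta>) br = \<gamma> (\<xi>0 + ?e \<theta>) + (w0 - Q (?e \<theta>))"
      unfolding br_def prod_scale_prod_scale mult.commute[of "cis \<theta>"] by (rule pt)
    have "F (w0 - Q (?e \<theta>)) (\<xi>0 + ?e \<theta>) \<le> F w0 \<xi>0"
      by (rule mx[OF wQ[OF ne] Qs(3)[OF ne]])
    then have "U (p0 + prod_scale (cis \<theta>) br) \<le> F w0 \<xi>0 + h (\<xi>0 + ?e \<theta>) - \<eta> * (norm (\<xi>0 + ?e \<theta>))\<^sup>2 + k * (norm (w0 - Q (?e \<theta>)))\<^sup>2"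
      unfolding e1 by (simp add: F_def)
    moreover have "(norm (\<xi>0 + ?e \<theta>))\<^sup>2 = (norm \<xi>0)\<^sup>2 + r\<^sup>2 + 2 * (\<xi>0 \<bullet> ?e \<theta>)"
    proof -
      have "(norm (?e \<theta>))\<^sup>2 = r\<^sup>2" by (simp add: norm_mult power_mult_distrib)
      then show ?thesis using dot_norm[of \<xi>0 "?e \<theta>"] by (simp add: field_simps)
    qed
    moreover have "k * (norm (w0 - Q (?e \<theta>)))\<^sup>2 \<le> k * ((norm w0)\<^sup>2 - 2 * (w0 \<bullet> Q (?e \<theta>)) + C\<^sup>2 * r^4)"
    proof -
      have "(norm (Q (?e \<theta>)))\<^sup>2 \<le> (C * r\<^sup>2)\<^sup>2" using Qs(1)[OF ne] by (intro power_mono) auto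
      then have "(norm (Q (?e \<theta>)))\<^sup>2 \<le> C\<^sup>2 * r^4" by (simp add: power_mult_distrib flip: power_mult)
      moreover have "(norm (w0 - Q (?e \<theta>)))\<^sup>2 = (norm w0)\<^sup>2 - 2 * (w0 \<bullet> Q (?e \<theta>)) + (norm (Q (?e \<theta>)))\<^sup>2"
        by (simp add: power2_norm_eq_inner inner_diff_left inner_diff_right inner_commute)
      ultimately show ?thesis using k(1) by simp
    qed
    ultimately show ?thesis by (simp add: algebra_simps)
  qed
  have cb: "cball \<xi>0 r \<subseteq> ball 0 1"
  proof
    fix x assume "x \<in> cball \<xi>0 r"
    then have "norm x \<le> norm \<xi>0 + r" using norm_triangle_ineq2[of x \<xi>0] by (simp add: dist_norm norm_minus_commute)
    also have "\<dots> \<le> norm \<xi>0 + (1 - norm \<xi>0)/2" using rle(2) by simp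
    also have "\<dots> < 1" using \<xi>0' by (simp add: field_simps)
    finally show "x \<in> ball 0 1" by simp
  qed
  define K where "K = F w0 \<xi>0 - \<eta> * ((norm \<xi>0)\<^sup>2 + r\<^sup>2) + k * (norm w0)\<^sup>2 + k * C\<^sup>2 * r^4"
  have i1: "((\<lambda>\<theta>. h (\<xi>0 + ?e \<theta>)) has_integral 2 * pi * h \<xi>0) {0..2*pi}" by (rule hm[OF rpos cb])
  have ie: "((\<lambda>\<theta>. 0 + ?e \<theta>) has_integral 2 * of_real pi * 0) {0..2*pi}"
    by (rule holomorphic_circle_mean[where f="\<lambda>x. x" and S=UNIV]) (use rpos in \<open>auto intro!: holomorphic_intros\<close>)
  have i2: "((\<lambda>\<theta>. \<xi>0 \<bullet> (0 + ?e \<theta>)) has_integral 0) {0..2*pi}"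
    using has_integral_inner_complex[of _ _ _ \<xi>0, OF ie] by (simp only: mult_zero_right inner_zero_right)
  have i3: "((\<lambda>\<theta>. w0 \<bullet> Q (?e \<theta>)) has_integral 0) {0..2*pi}" unfolding Q_def by (rule qi[OF rpos r\<delta>])
  have i0: "((\<lambda>\<theta>. K) has_integral 2 * pi * K) {0..2*pi}" using has_integral_const_real[of K 0 "2*pi"] by simp
  have "((\<lambda>\<theta>. K + (h (\<xi>0 + ?e \<theta>) - 2 * \<eta> * (\<xi>0 \<bullet> (0 + ?e \<theta>)) - 2 * k * (w0 \<bullet> Q (?e \<theta>)))) has_integral
      2 * pi * K + (2 * pi * h \<xi>0 - 2 * \<eta> * 0 - 2 * k * 0)) {0..2*pi}"
    by (rule has_integral_add[OF i0 has_integral_diff[OF has_integral_diff[OF i1 has_integral_mult_right[OF i2]] has_integral_mult_right[OF i3]]])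
  with integrable_integral[OF sub(1)]
  have "integral {0..2*pi} (\<lambda>\<theta>. U (p0 + prod_scale (cis \<theta>) br)) \<le> 2 * pi * K + (2 * pi * h \<xi>0 - 2 * \<eta> * 0 - 2 * k * 0)"
    by (rule has_integral_le) (rule point[folded K_def])
  then have "2 * pi * U p0 \<le> 2 * pi * (K + h \<xi>0)" using sub(2) by (simp add: algebra_simps)
  then have "U p0 \<le> K + h \<xi>0" by simp
  moreover have "F w0 \<xi>0 = U p0 - h \<xi>0 + \<eta> * (norm \<xi>0)\<^sup>2 - k * (norm w0)\<^sup>2" by (simp add: F_def p0_def)
  ultimately have "\<eta> * r\<^sup>2 \<le> k * C\<^sup>2 * r^4" by (simp add: K_def algebra_simps)
  then have "\<eta> * r\<^sup>2 \<le> (k * C\<^sup>2 * r\<^sup>2) * r\<^sup>2" by (simp add: power_add[symmetric] mult.assoc)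
  then have "\<eta> \<le> k * C\<^sup>2 * r\<^sup>2" using rpos by simp
  also have "\<dots> \<le> (k * C\<^sup>2 + 1) * r" using rsq k rpos by (intro mult_mono) auto
  also have "\<dots> \<le> \<eta> / 2" using rle(5) kC by (simp add: field_simps)
  finally show False using \<eta>(1) by simp
qed

text \<open>A harmonic polynomial h within e/2 of U o \<gamma> on the circle is used in the maximum
  principle: U (\<gamma> 0) exceeds h 0 by at most e/2, and h 0, being the mean of h, exceeds the
  mean of U o \<gamma> by at most e/2.\<close>

lemma psh_submean_analytic_disc:
  fixes U :: "(complex^'n) \<times> complex \<Rightarrow> real" and \<gamma> :: "complex \<Rightarrow> (complex^'n) \<times> complex"
  assumes psh: "plurisubharmonic_on prod_scale \<Omega> U" and Uc: "continuous_on \<Omega> U"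
    and S: "open S" "cball 0 1 \<subseteq> S" and gO: "\<gamma> ` cball 0 1 \<subseteq> \<Omega>"
    and hol1: "\<And>k. (\<lambda>\<xi>. fst (\<gamma> \<xi>) $ k) holomorphic_on S" and hol2: "(\<lambda>\<xi>. snd (\<gamma> \<xi>)) holomorphic_on S"
  shows "U (\<gamma> 0) \<le> integral {0..2*pi} (\<lambda>\<theta>. U (\<gamma> (cis \<theta>))) / (2 * pi)"
proof -
  have gc: "continuous_on (cball 0 1) \<gamma>"
  proof -
    have "continuous_on (cball 0 1) (\<lambda>\<xi>. (\<chi> k. fst (\<gamma> \<xi>) $ k, snd (\<gamma> \<xi>)))"
      using hol1 hol2 S(2) by (intro continuous_intros holomorphic_on_imp_continuous_on) (auto intro: holomorphic_on_subset)
    then show ?thesis by simp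
  qed
  have rem: "\<exists>b C \<delta>. 0 < \<delta> \<and>
        (\<forall>t. norm t < \<delta> \<longrightarrow> norm (\<gamma> (\<xi> + t) - \<gamma> \<xi> - prod_scale t b) \<le> C * (norm t)\<^sup>2) \<and>
        (\<forall>r w. 0 < r \<longrightarrow> r < \<delta> \<longrightarrow> ((\<lambda>\<theta>. w \<bullet> (\<gamma> (\<xi> + of_real r * cis \<theta>) - \<gamma> \<xi> - prod_scale (of_real r * cis \<theta>) b)) has_integral 0) {0..2*pi})"
    if "\<xi> \<in> ball 0 1" for \<xi>
  proof -
    have \<xi>S: "\<xi> \<in> S" using that S(2) by auto
    let ?f = "\<lambda>k \<xi>. fst (\<gamma> \<xi>) $ k" and ?g = "\<lambda>\<xi>. snd (\<gamma> \<xi>)"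
    define P where "P k \<delta> C \<longleftrightarrow> 0 < \<delta> \<and> 0 \<le> C \<and> (\<forall>t. norm t < \<delta> \<longrightarrow> norm (?f k (\<xi> + t) - ?f k \<xi> - deriv (?f k) \<xi> * t) \<le> C * (norm t)\<^sup>2) \<and>
      (\<forall>r. 0 < r \<longrightarrow> r < \<delta> \<longrightarrow> ((\<lambda>\<theta>. ?f k (\<xi> + of_real r * cis \<theta>) - ?f k \<xi> - deriv (?f k) \<xi> * (of_real r * cis \<theta>)) has_integral 0) {0..2*pi})" for k \<delta> C
    have "\<exists>\<delta> C. P k \<delta> C" for k
      unfolding P_def by (rule holomorphic_quadratic_remainder[OF hol1[of k] S(1) \<xi>S])
    then obtain \<delta>1 C1 where PP: "\<And>k. P k (\<delta>1 k) (C1 k)" by metis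
    note f1 = PP[unfolded P_def, THEN conjunct1] and f2 = PP[unfolded P_def, THEN conjunct2, THEN conjunct1]
      and f3 = PP[unfolded P_def, THEN conjunct2, THEN conjunct2, THEN conjunct1, rule_format]
      and f4 = PP[unfolded P_def, THEN conjunct2, THEN conjunct2, THEN conjunct2, rule_format]
    from holomorphic_quadratic_remainder[OF hol2 S(1) \<xi>S] obtain \<delta>2 C2 where G: "0 < \<delta>2 \<and> 0 \<le> C2 \<and>
      (\<forall>t. norm t < \<delta>2 \<longrightarrow> norm (?g (\<xi> + t) - ?g \<xi> - deriv ?g \<xi> * t) \<le> C2 * (norm t)\<^sup>2) \<and>
      (\<forall>r. 0 < r \<longrightarrow> r < \<delta>2 \<longrightarrow> ((\<lambda>\<theta>. ?g (\<xi> + of_real r * cis \<theta>) - ?g \<xi> - deriv ?g \<xi> * (of_real r * cis \<theta>)) has_integral 0) {0..2*pi})"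
      by blast
    note g1 = G[THEN conjunct1] and g3 = G[THEN conjunct2, THEN conjunct2, THEN conjunct1, rule_format]
      and g4 = G[THEN conjunct2, THEN conjunct2, THEN conjunct2, rule_format]
    define b where "b = ((\<chi> k. deriv (?f k) \<xi>), deriv ?g \<xi>)"
    define \<delta> where "\<delta> = Min (insert \<delta>2 (range \<delta>1))"
    have \<delta>: "0 < \<delta>" "\<delta> \<le> \<delta>2" "\<And>k. \<delta> \<le> \<delta>1 k"
      unfolding \<delta>_def by (subst Min_gr_iff, use f1 g1 in \<open>auto simp del: Min_insert intro: Min_le\<close>)
    show ?thesis
    proof (rule exI[of _ b], rule exI[of _ "(\<Sum>k\<in>UNIV. C1 k) + C2"], rule exI[of _ \<delta>], intro conjI allI impI)
      fix t :: complex assume t: "norm t < \<delta>"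
      let ?q = "\<gamma> (\<xi> + t) - \<gamma> \<xi> - prod_scale t b"
      have "norm ?q \<le> norm (fst ?q) + norm (snd ?q)" using norm_Pair_le[of "fst ?q" "snd ?q"] unfolding prod.collapse .
      also have "norm (fst ?q) \<le> (\<Sum>k\<in>UNIV. norm (fst ?q $ k))" unfolding norm_vec_def by (rule L2_set_le_sum) simp
      also have "\<dots> \<le> (\<Sum>k\<in>UNIV. C1 k * (norm t)\<^sup>2)"
        using f3[of t] t \<delta>(3) by (intro sum_mono) (auto simp: prod_scale_def b_def mult.commute intro: order.strict_trans2)
      also have "norm (snd ?q) \<le> C2 * (norm t)\<^sup>2"
        using g3[of t] t \<delta>(2) by (auto simp: prod_scale_def b_def mult.commute)
      finally show "norm ?q \<le> ((\<Sum>k\<in>UNIV. C1 k) + C2) * (norm t)\<^sup>2" by (simp add: sum_distrib_right distrib_right)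
    next
      fix r :: real and w :: "(complex^'n) \<times> complex" assume r: "0 < r" "r < \<delta>"
      let ?e = "\<lambda>\<theta>. of_real r * cis \<theta>"
      have 1: "((\<lambda>\<theta>. (fst w $ k) \<bullet> (?f k (\<xi> + ?e \<theta>) - ?f k \<xi> - deriv (?f k) \<xi> * ?e \<theta>)) has_integral 0) {0..2*pi}" for k
        using has_integral_inner_complex[OF f4[of r k], of "fst w $ k"] r \<delta>(3)[of k] by simp
      have 2: "((\<lambda>\<theta>. snd w \<bullet> (?g (\<xi> + ?e \<theta>) - ?g \<xi> - deriv ?g \<xi> * ?e \<theta>)) has_integral 0) {0..2*pi}"
        using has_integral_inner_complex[OF g4[of r], of "snd w"] r \<delta>(2) by simp
      have "((\<lambda>\<theta>. (\<Sum>k\<in>UNIV. (fst w $ k) \<bullet> (?f k (\<xi> + ?e \<theta>) - ?f k \<xi> - deriv (?f k) \<xi> * ?e \<theta>))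
          + snd w \<bullet> (?g (\<xi> + ?e \<theta>) - ?g \<xi> - deriv ?g \<xi> * ?e \<theta>)) has_integral ((\<Sum>k\<in>(UNIV::'n set). 0) + 0)) {0..2*pi}"
        by (intro has_integral_add has_integral_sum 1 2) auto
      then show "((\<lambda>\<theta>. w \<bullet> (\<gamma> (\<xi> + ?e \<theta>) - \<gamma> \<xi> - prod_scale (?e \<theta>) b)) has_integral 0) {0..2*pi}"
        by (simp add: inner_prod_def inner_vec_def prod_scale_def b_def mult.commute)
    qed (rule \<delta>)
  qed
  have cU: "continuous_on (cball 0 1) (\<lambda>\<xi>. U (\<gamma> \<xi>))"
    by (rule continuous_on_compose2[OF Uc gc gO])
  have iU: "(\<lambda>\<theta>. U (\<gamma> (cis \<theta>))) integrable_on {0..2*pi}"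
    by (intro integrable_continuous_real continuous_on_compose2[OF cU]) (auto intro!: continuous_intros)
  have "U (\<gamma> 0) \<le> integral {0..2*pi} (\<lambda>\<theta>. U (\<gamma> (cis \<theta>))) / (2 * pi) + e" if e: "0 < e" for e
  proof -
    have "continuous_on (sphere 0 1) (\<lambda>\<xi>. U (\<gamma> \<xi>))" by (rule continuous_on_subset[OF cU]) auto
    then obtain p where p0: "\<forall>\<xi>\<in>sphere 0 1. \<bar>U (\<gamma> \<xi>) - Re (poly p \<xi>)\<bar> < e / 2"
      using harmonic_polynomial_approx_on_circle[of "\<lambda>\<xi>. U (\<gamma> \<xi>)" "e / 2"] half_gt_zero[OF e] by blast
    have p: "\<bar>U (\<gamma> \<xi>) - Re (poly p \<xi>)\<bar> < e / 2" if "norm \<xi> = 1" for \<xi> using p0 that by simp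
    have hm: "((\<lambda>\<theta>. Re (poly p (\<xi> + of_real r * cis \<theta>))) has_integral 2 * pi * Re (poly p \<xi>)) {0..2*pi}" if "0 < r" for \<xi> r
      using has_integral_Re[OF holomorphic_circle_mean[of "poly p" UNIV \<xi> r]] that by (simp add: poly_holomorphic_on)
    have M: "U (\<gamma> \<xi>) - Re (poly p \<xi>) \<le> e / 2" if "norm \<xi> = 1" for \<xi> using p[OF that] by linarith
    have "U (\<gamma> 0) - Re (poly p 0) \<le> e / 2"
      by (rule psh_analytic_disc_max_principle[OF psh Uc gc gO rem, where h="\<lambda>\<xi>. Re (poly p \<xi>)", OF _ _ hm M])
        (auto intro!: continuous_intros)
    moreover have "2 * pi * Re (poly p 0) \<le> integral {0..2*pi} (\<lambda>\<theta>. U (\<gamma> (cis \<theta>)) + e / 2)"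
    proof (rule has_integral_le)
      show "((\<lambda>\<theta>. Re (poly p (cis \<theta>))) has_integral 2 * pi * Re (poly p 0)) {0..2*pi}"
        using hm[of 1 0] by simp
      show "((\<lambda>\<theta>. U (\<gamma> (cis \<theta>)) + e / 2) has_integral integral {0..2*pi} (\<lambda>\<theta>. U (\<gamma> (cis \<theta>)) + e / 2)) {0..2*pi}"
        by (intro integrable_integral integrable_add iU) auto
      show "Re (poly p (cis \<theta>)) \<le> U (\<gamma> (cis \<theta>)) + e / 2" for \<theta>
        using p[of "cis \<theta>", OF norm_cis] by linarith
    qed
    moreover have "integral {0..2*pi} (\<lambda>\<theta>. U (\<gamma> (cis \<theta>)) + e / 2) = integral {0..2*pi} (\<lambda>\<theta>. U (\<gamma> (cis \<theta>))) + pi * e"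
      using iU by (subst integral_add) auto
    moreover have "2 * pi * U (\<gamma> 0) \<le> 2 * pi * (Re (poly p 0) + e / 2)" if "U (\<gamma> 0) - Re (poly p 0) \<le> e / 2"
      using that by (intro mult_left_mono) auto
    ultimately have "2 * pi * U (\<gamma> 0) \<le> integral {0..2*pi} (\<lambda>\<theta>. U (\<gamma> (cis \<theta>))) + 2 * pi * e"
      by (simp add: algebra_simps)
    then have "U (\<gamma> 0) \<le> (integral {0..2*pi} (\<lambda>\<theta>. U (\<gamma> (cis \<theta>))) + 2 * pi * e) / (2 * pi)"
      by (simp add: pos_le_divide_eq mult.commute)
    then show ?thesis by (simp add: add_divide_distrib)
  qed
  then show ?thesis by (rule field_le_epsilon)
qed

subsection \<open>The Perron-Bremermann envelope\<close>

lemma plurisubharmonic_on_continuousI: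
  assumes \<Omega>: "open \<Omega>" and u: "continuous_on \<Omega> u"
    and c: "\<And>a b. (\<And>\<xi>. norm \<xi> \<le> 1 \<Longrightarrow> a + sm \<xi> b \<in> \<Omega>) \<Longrightarrow> continuous_on UNIV (\<lambda>\<theta>. a + sm (cis \<theta>) b)"
    and sub: "\<And>a b. (\<And>\<xi>. norm \<xi> \<le> 1 \<Longrightarrow> a + sm \<xi> b \<in> \<Omega>) \<Longrightarrow>
      u a \<le> integral {0..2*pi} (\<lambda>\<theta>. u (a + sm (cis \<theta>) b)) / (2 * pi)"
  shows "plurisubharmonic_on sm \<Omega> u"
  unfolding plurisubharmonic_on_def
proof (intro conjI allI impI \<Omega>)
  fix k
  have "openin (top_of_set \<Omega>) (\<Omega> \<inter> u -` {..<k})" by (rule continuous_openin_preimage_gen[OF u]) simp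
  also have "\<Omega> \<inter> u -` {..<k} = {x \<in> \<Omega>. u x < k}" by auto
  finally show "openin (top_of_set \<Omega>) {x \<in> \<Omega>. u x < k}" .
next
  fix a b assume ab: "\<forall>\<xi>. norm \<xi> \<le> 1 \<longrightarrow> a + sm \<xi> b \<in> \<Omega>"
  have "continuous_on {0..2*pi} (\<lambda>\<theta>. u (a + sm (cis \<theta>) b))"
    by (rule continuous_on_compose2[OF u continuous_on_subset[OF c]]) (use ab in auto)
  then show "(\<lambda>\<theta>. u (a + sm (cis \<theta>) b)) absolutely_integrable_on {0..2*pi}"
    by (rule absolutely_integrable_continuous_real)
  show "u a \<le> integral {0..2*pi} (\<lambda>\<theta>. u (a + sm (cis \<theta>) b)) / (2 * pi)" by (rule sub) (use ab in auto)
qed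

lemma continuous_on_prod_scale_cis: "continuous_on UNIV (\<lambda>\<theta>. a + prod_scale (cis \<theta>) b)"
  unfolding prod_scale_def cis_vec_eq by (intro continuous_intros)

lemma open_annulus: "open annulus"
  unfolding annulus_def by (intro open_Collect_conj open_Collect_less continuous_intros)

lemma ball_aut_nonzero: "norm a < 1 \<Longrightarrow> norm z \<le> 1 \<Longrightarrow> 1 + hdot z a \<noteq> 0"
  using one_plus_hdot_ge[of z a] by auto

lemma continuous_on_ball_aut:
  fixes a :: "complex^'n"
  assumes "norm a < 1"
  shows "continuous_on (cball 0 1) (ball_aut a)"
proof -
  have c: "continuous_on (cball 0 1) (\<lambda>z. \<chi> k. inverse (1 + hdot z a) *
     (a $ k + complex_of_real (sqrt (1 - (norm a)\<^sup>2)) * z $ k + hdot z a * (inverse (1 + sqrt (1 - (norm a)\<^sup>2)) *\<^sub>R a) $ k))"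
    unfolding hdot_def
    by (intro continuous_intros) (use ball_aut_nonzero[OF assms] in \<open>auto simp: hdot_def\<close>)
  have e: "(\<lambda>z. \<chi> k. inverse (1 + hdot z a) *
     (a $ k + complex_of_real (sqrt (1 - (norm a)\<^sup>2)) * z $ k + hdot z a * (inverse (1 + sqrt (1 - (norm a)\<^sup>2)) *\<^sub>R a) $ k)) = ball_aut a"
    by (simp add: fun_eq_iff vec_eq_iff ball_aut_def scaleR_conv_of_real[where 'a=complex] algebra_simps)
  from c show ?thesis unfolding e .
qed

lemma hdot_line: "hdot (a + \<xi> *s b) c = hdot a c + \<xi> * hdot b c"
  by (simp add: hdot_add_left hdot_scale_left)

text \<open>The image of a flat disc under (\<open>ball_aut c\<close>, identity) is an analytic
  disc, to which the sub-mean inequality just extended applies.\<close>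

lemma plurisubharmonic_on_compose_ball_aut:
  fixes u :: "(complex^'n) \<times> complex \<Rightarrow> real"
  assumes u: "plurisubharmonic_on prod_scale (ball 0 1 \<times> A) u" "continuous_on (ball 0 1 \<times> A) u" and A: "open A"
    and c: "norm c < 1"
  shows "plurisubharmonic_on prod_scale (ball 0 1 \<times> A) (\<lambda>p. u (ball_aut c (fst p), snd p))"
    and "continuous_on (ball 0 1 \<times> A) (\<lambda>p. u (ball_aut c (fst p), snd p))"
proof -
  let ?D = "ball 0 1 \<times> A"
  have "continuous_on ?D (\<lambda>p. (ball_aut c (fst p), snd p))"
    by (intro continuous_intros continuous_on_compose2[OF continuous_on_ball_aut[OF c]]) auto
  then show cont: "continuous_on ?D (\<lambda>p. u (ball_aut c (fst p), snd p))"
    by (rule continuous_on_compose2[OF u(2)]) (use ball_aut_norm_less[OF c] in auto)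
  have D: "open ?D" using A by (intro open_Times) auto
  show "plurisubharmonic_on prod_scale ?D (\<lambda>p. u (ball_aut c (fst p), snd p))"
  proof (rule plurisubharmonic_on_continuousI[OF D cont continuous_on_prod_scale_cis])
    fix a b :: "(complex^'n) \<times> complex" assume ab: "\<And>\<xi>. norm \<xi> \<le> 1 \<Longrightarrow> a + prod_scale \<xi> b \<in> ?D"
    define \<gamma> where "\<gamma> \<xi> = (ball_aut c (fst (a + prod_scale \<xi> b)), snd (a + prod_scale \<xi> b))" for \<xi>
    \<comment> \<open>An open neighbourhood of the closed disc on which the denominator of the
      automorphism does not vanish. Only the ball constrains it, since the second component is
      affine in \<xi>.\<close>
    define S where "S = {\<xi>. norm (fst a + \<xi> *s fst b) < 1}"
    have ce: "continuous_on UNIV (\<lambda>\<xi>. fst a + \<xi> *s fst b)"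
    proof -
      have c: "continuous_on UNIV (\<lambda>\<xi>. \<chi> k. fst a $ k + \<xi> * fst b $ k)" by (intro continuous_intros)
      have e: "(\<lambda>\<xi>. \<chi> k. fst a $ k + \<xi> * fst b $ k) = (\<lambda>\<xi>. fst a + \<xi> *s fst b)" by (simp add: fun_eq_iff vec_eq_iff)
      from c show ?thesis unfolding e .
    qed
    have S: "open S" unfolding S_def by (intro open_Collect_less continuous_intros ce)
    have S1: "cball 0 1 \<subseteq> S" using ab by (auto simp: S_def prod_scale_def mem_Times_iff)
    have \<gamma>D: "\<gamma> ` cball 0 1 \<subseteq> ?D"
      using ab ball_aut_norm_less[OF c] by (auto simp: \<gamma>_def mem_Times_iff)
    have nz: "1 + (hdot (fst a) c + \<xi> * hdot (fst b) c) \<noteq> 0" if "\<xi> \<in> S" for \<xi>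
      using ball_aut_nonzero[OF c, of "fst a + \<xi> *s fst b"] that by (simp add: S_def hdot_line)
    have h1: "(\<lambda>\<xi>. fst (\<gamma> \<xi>) $ k) holomorphic_on S" for k
    proof -
      have "(\<lambda>\<xi>. inverse (1 + (hdot (fst a) c + \<xi> * hdot (fst b) c)) *
         (c $ k + complex_of_real (sqrt (1 - (norm c)\<^sup>2)) * (fst a $ k + \<xi> * fst b $ k)
          + (hdot (fst a) c + \<xi> * hdot (fst b) c) * (inverse (1 + sqrt (1 - (norm c)\<^sup>2)) *\<^sub>R c) $ k)) holomorphic_on S"
        by (intro holomorphic_intros nz)
      moreover have "(\<lambda>\<xi>. inverse (1 + (hdot (fst a) c + \<xi> * hdot (fst b) c)) *
         (c $ k + complex_of_real (sqrt (1 - (norm c)\<^sup>2)) * (fst a $ k + \<xi> * fst b $ k)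
          + (hdot (fst a) c + \<xi> * hdot (fst b) c) * (inverse (1 + sqrt (1 - (norm c)\<^sup>2)) *\<^sub>R c) $ k)) = (\<lambda>\<xi>. fst (\<gamma> \<xi>) $ k)"
        by (simp add: fun_eq_iff \<gamma>_def prod_scale_def ball_aut_def hdot_line scaleR_conv_of_real[where 'a=complex] algebra_simps)
      ultimately show ?thesis by simp
    qed
    have h2: "(\<lambda>\<xi>. snd (\<gamma> \<xi>)) holomorphic_on S"
      unfolding \<gamma>_def prod_scale_def by (simp, intro holomorphic_intros)
    have "u (\<gamma> 0) \<le> integral {0..2*pi} (\<lambda>\<theta>. u (\<gamma> (cis \<theta>))) / (2 * pi)"
      by (rule psh_submean_analytic_disc[OF u S S1 \<gamma>D h1 h2])
    then show "u (ball_aut c (fst a), snd a) \<le> integral {0..2*pi} (\<lambda>\<theta>. u (ball_aut c (fst (a + prod_scale (cis \<theta>) b)), snd (a + prod_scale (cis \<theta>) b))) / (2 * pi)"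
      by (simp add: \<gamma>_def prod_scale_def)
  qed
qed

lemma has_integral_inner_cis_zero:
  fixes x y :: "complex^'n"
  shows "((\<lambda>\<theta>. x \<bullet> (cis \<theta> *s y)) has_integral 0) {0..2*pi}"
proof -
  have "((\<lambda>\<theta>. x \<bullet> (cis \<theta> *s y)) has_integral ((sin (2*pi) * (x \<bullet> y) - cos (2*pi) * (x \<bullet> (\<i> *s y))) - (sin 0 * (x \<bullet> y) - cos 0 * (x \<bullet> (\<i> *s y))))) {0..2*pi}"
  proof (rule fundamental_theorem_of_calculus)
    fix \<theta> :: real
    have "((\<lambda>\<theta>. sin \<theta> * (x \<bullet> y) - cos \<theta> * (x \<bullet> (\<i> *s y))) has_real_derivative x \<bullet> (cis \<theta> *s y)) (at \<theta> within {0..2*pi})"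
      by (auto intro!: derivative_eq_intros simp: cis_vec_eq inner_add_right)
    then show "((\<lambda>\<theta>. sin \<theta> * (x \<bullet> y) - cos \<theta> * (x \<bullet> (\<i> *s y))) has_vector_derivative x \<bullet> (cis \<theta> *s y)) (at \<theta> within {0..2*pi})"
      by (simp add: has_real_derivative_iff_has_vector_derivative)
  qed simp
  then show ?thesis by simp
qed

locale envelope =
  fixes \<phi>0 \<phi>1 :: "complex^'n \<Rightarrow> real"
  assumes C0: "C11_on (cball 0 1) \<phi>0" and C1: "C11_on (cball 0 1) \<phi>1"
begin

abbreviation D :: "((complex^'n) \<times> complex) set" where "D \<equiv> ball 0 1 \<times> annulus"
abbreviation F where "F \<equiv> perron_family (boundary_data \<phi>0 \<phi>1) D"
definition \<Phi> where "\<Phi> = perron_envelope \<phi>0 \<phi>1"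

lemma open_D: "open D" by (intro open_Times open_annulus) auto

lemma closure_annulus_subset: "closure annulus \<subseteq> {\<zeta>. 1 \<le> norm \<zeta> \<and> norm \<zeta> \<le> exp 1}"
proof (rule closure_minimal)
  show "closed {\<zeta>::complex. 1 \<le> norm \<zeta> \<and> norm \<zeta> \<le> exp 1}"
    by (intro closed_Collect_conj closed_Collect_le continuous_intros)
qed (auto simp: annulus_def)

lemma closure_D: "closure D = cball 0 1 \<times> closure annulus"
  by (simp add: closure_Times)

lemma compact_closure_D: "compact (closure D)"
proof -
  have "bounded annulus" by (rule bounded_subset[of "cball 0 (exp 1)"]) (auto simp: annulus_def)
  then have "bounded D" by (intro bounded_Times) auto
  then show ?thesis by (simp add: compact_closure)
qed

lemma frontier_D_iff: "(z, \<zeta>) \<in> frontier D \<longleftrightarrow> norm z \<le> 1 \<and> \<zeta> \<in> closure annulus \<and> (norm z = 1 \<or> \<zeta> \<notin> annulus)"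
  using open_D by (auto simp: frontier_def interior_open closure_D)

lemma closure_annulus_cases: "\<zeta> \<in> closure annulus \<Longrightarrow> \<zeta> \<notin> annulus \<Longrightarrow> norm \<zeta> = 1 \<or> norm \<zeta> = exp 1"
  using closure_annulus_subset by (force simp: annulus_def)

lemma bounds_exist: "\<exists>M\<ge>0. \<forall>z\<in>cball 0 1. \<bar>\<phi>0 z\<bar> \<le> M \<and> \<bar>\<phi>1 z\<bar> \<le> M"
proof -
  have "bounded (\<phi>0 ` cball 0 1)" "bounded (\<phi>1 ` cball 0 1)"
    using C11_on_imp_continuous_on[OF C0] C11_on_imp_continuous_on[OF C1]
    by (auto intro!: compact_imp_bounded compact_continuous_image)
  then obtain M0 M1 where "\<forall>z\<in>cball 0 1. \<bar>\<phi>0 z\<bar> \<le> M0" "\<forall>z\<in>cball 0 1. \<bar>\<phi>1 z\<bar> \<le> M1"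
    by (auto simp: bounded_pos)
  then show ?thesis by (intro exI[of _ "max 0 (max M0 M1)"]) (auto simp: le_max_iff_disj)
qed

definition M where "M = (SOME M. 0 \<le> M \<and> (\<forall>z\<in>cball 0 1. \<bar>\<phi>0 z\<bar> \<le> M \<and> \<bar>\<phi>1 z\<bar> \<le> M))"

lemma M: "0 \<le> M" "z \<in> cball 0 1 \<Longrightarrow> \<bar>\<phi>0 z\<bar> \<le> M" "z \<in> cball 0 1 \<Longrightarrow> \<bar>\<phi>1 z\<bar> \<le> M"
  using someI_ex[OF bounds_exist[unfolded Bex_def]] unfolding M_def by auto

lemma boundary_data_bounds: "p \<in> frontier D \<Longrightarrow> \<bar>boundary_data \<phi>0 \<phi>1 p\<bar> \<le> M"
  using M by (cases p) (auto simp: frontier_D_iff boundary_data_def)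

text \<open>A member of the family: the least upper bound property of the real supremum needs a
  nonempty set.\<close>

lemma const_in_F: "(\<lambda>_. - M) \<in> F"
proof -
  have "plurisubharmonic_on prod_scale D (\<lambda>_. - M)"
    by (rule plurisubharmonic_on_continuousI[OF open_D _ continuous_on_prod_scale_cis]) auto
  then show ?thesis using boundary_data_bounds by (force simp: perron_family_def)
qed

lemma F_D:
  assumes "u \<in> F"
  shows "plurisubharmonic_on prod_scale D u" "continuous_on (closure D) u" "continuous_on D u"
    "\<And>p. p \<in> frontier D \<Longrightarrow> u p \<le> boundary_data \<phi>0 \<phi>1 p"
  using assms closure_subset[of D] by (auto simp: perron_family_def elim: continuous_on_subset)

text \<open>The maximum principle with the strictly subharmonic perturbation \<eta> |z|^2. The upper
  bound makes the real supremum meaningful; without it the envelope would be an unspecified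
  value.\<close>

lemma F_le:
  assumes u: "u \<in> F" and p: "p \<in> D"
  shows "u p \<le> M"
proof (rule ccontr)
  assume neg: "\<not> u p \<le> M"
  define \<eta> where "\<eta> = (u p - M) / 2"
  have \<eta>: "0 < \<eta>" using neg by (simp add: \<eta>_def)
  define v where "v q = u q + \<eta> * (norm (fst q))\<^sup>2" for q
  have "continuous_on (closure D) v" unfolding v_def by (intro continuous_intros F_D(2)[OF u])
  then obtain q where q: "q \<in> closure D" "\<And>x. x \<in> closure D \<Longrightarrow> v x \<le> v q"
    using continuous_attains_sup[OF compact_closure_D, of v] p closure_subset[of D] by blast
  have "p \<in> closure D" using p closure_subset[of D] by blast
  then have "v p \<le> v q" by (rule q(2))
  moreover have "0 \<le> \<eta> * (norm (fst p))\<^sup>2" using \<eta> by simp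
  ultimately have vp: "u p \<le> v q" unfolding v_def by linarith
  show False
  proof (cases "q \<in> D")
    case False
    then have qf: "q \<in> frontier D" using q(1) open_D by (simp add: frontier_def interior_open)
    have "u q \<le> M" using F_D(4)[OF u qf] boundary_data_bounds[OF qf] by simp
    moreover have "(norm (fst q))\<^sup>2 \<le> 1" using q(1) by (auto simp: closure_D power_le_one)
    then have "\<eta> * (norm (fst q))\<^sup>2 \<le> \<eta> * 1" using \<eta> by (intro mult_left_mono) auto
    ultimately show False using vp \<eta> by (simp add: v_def \<eta>_def field_simps)
  next
    case True
    define r where "r = (1 - norm (fst q)) / 2"
    have r: "0 < r" "norm (fst q) + r < 1" using True by (auto simp: r_def field_simps mem_Times_iff)
    \<comment> \<open>Any direction in z serves; on the circle of radius r the perturbation gains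
      \<eta> r^2 in the mean, which an interior maximum cannot allow.\<close>
    define b :: "complex^'n" where "b = r *\<^sub>R axis undefined 1"
    have nb: "norm b = r" using r by (simp add: b_def)
    have disc: "q + prod_scale \<xi> (b, 0) \<in> D" if "norm \<xi> \<le> 1" for \<xi>
    proof -
      have "norm (fst q + \<xi> *s b) \<le> norm (fst q) + norm \<xi> * r"
        using norm_triangle_ineq[of "fst q" "\<xi> *s b"] by (simp add: norm_complex_scale nb)
      also have "\<dots> \<le> norm (fst q) + r" using that r by (simp add: mult_left_le_one_le)
      finally show ?thesis using r True by (auto simp: prod_scale_def mem_Times_iff)
    qed
    have sub: "(\<lambda>\<theta>. u (q + prod_scale (cis \<theta>) (b, 0))) integrable_on {0..2*pi}"
       "2 * pi * u q \<le> integral {0..2*pi} (\<lambda>\<theta>. u (q + prod_scale (cis \<theta>) (b, 0)))"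
      using plurisubharmonic_on_submean[OF F_D(1)[OF u], of q "(b, 0)"] disc by blast+
    have "((\<lambda>\<theta>. (v q - \<eta> * ((norm (fst q))\<^sup>2 + r\<^sup>2)) - 2 * \<eta> * (fst q \<bullet> (cis \<theta> *s b))) has_integral
       (2 * pi * (v q - \<eta> * ((norm (fst q))\<^sup>2 + r\<^sup>2)) - 2 * \<eta> * 0)) {0..2*pi}"
      using has_integral_const_real[of "v q - \<eta> * ((norm (fst q))\<^sup>2 + r\<^sup>2)" 0 "2*pi"]
      by (intro has_integral_diff has_integral_mult_right has_integral_inner_cis_zero) simp
    from has_integral_le[OF integrable_integral[OF sub(1)] this]
    have "integral {0..2*pi} (\<lambda>\<theta>. u (q + prod_scale (cis \<theta>) (b, 0))) \<le> 2 * pi * (v q - \<eta> * ((norm (fst q))\<^sup>2 + r\<^sup>2)) - 2 * \<eta> * 0"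
    proof this
      fix \<theta> :: real
      let ?x = "q + prod_scale (cis \<theta>) (b, 0)"
      have "?x \<in> D" by (rule disc) simp
      then have "?x \<in> closure D" by (rule subsetD[OF closure_subset])
      then have "v ?x \<le> v q" by (rule q(2))
      moreover have "(norm (fst ?x))\<^sup>2 = (norm (fst q))\<^sup>2 + r\<^sup>2 + 2 * (fst q \<bullet> (cis \<theta> *s b))"
      proof -
        have "(norm (cis \<theta> *s b))\<^sup>2 = r\<^sup>2" by (simp add: norm_complex_scale nb)
        then show ?thesis using dot_norm[of "fst q" "cis \<theta> *s b"] by (simp add: prod_scale_def field_simps)
      qed
      ultimately show "u ?x \<le> (v q - \<eta> * ((norm (fst q))\<^sup>2 + r\<^sup>2)) - 2 * \<eta> * (fst q \<bullet> (cis \<theta> *s b))"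
        by (simp add: v_def algebra_simps)
    qed
    then have "2 * pi * u q \<le> 2 * pi * (v q - \<eta> * ((norm (fst q))\<^sup>2 + r\<^sup>2))" using sub(2) by linarith
    then have "u q \<le> v q - \<eta> * ((norm (fst q))\<^sup>2 + r\<^sup>2)" by simp
    then have "\<eta> * r\<^sup>2 \<le> 0" by (simp add: v_def algebra_simps)
    then show False using \<eta> r by (simp add: mult_le_0_iff)
  qed
qed

lemma Phi_upper: "u \<in> F \<Longrightarrow> p \<in> D \<Longrightarrow> u p \<le> \<Phi> p"
  unfolding \<Phi>_def perron_envelope_def by (rule cSUP_upper) (auto intro!: bdd_aboveI[of _ M] F_le)

lemma Phi_least: "(\<And>u. u \<in> F \<Longrightarrow> u p \<le> c) \<Longrightarrow> \<Phi> p \<le> c"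
  unfolding \<Phi>_def perron_envelope_def using const_in_F by (intro cSUP_least) auto

text \<open>Automorphisms of the ball, unlike translations, preserve the sphere and hence the boundary
  condition there.\<close>

lemma competitor:
  assumes a: "norm a1 < 1" "norm a2 < 1" "norm m < 1" and c: "0 \<le> c"
    and \<phi>0: "\<And>w. w \<in> cball 0 1 \<Longrightarrow> \<phi>0 (ball_aut a1 w) + \<phi>0 (ball_aut a2 w) \<le> 2 * \<phi>0 (ball_aut m w) + 2 * c"
    and \<phi>1: "\<And>w. w \<in> cball 0 1 \<Longrightarrow> \<phi>1 (ball_aut a1 w) + \<phi>1 (ball_aut a2 w) \<le> 2 * \<phi>1 (ball_aut m w) + 2 * c"
    and u1: "u1 \<in> F" and u2: "u2 \<in> F"
  shows "(\<lambda>p. (u1 (ball_aut a1 (ball_aut (-m) (fst p)), snd p) + u2 (ball_aut a2 (ball_aut (-m) (fst p)), snd p)) / 2 - c) \<in> F"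
    (is "?W \<in> F")
proof -
  have m: "norm (- m) < 1" using a by simp
  have v: "plurisubharmonic_on prod_scale D (\<lambda>p. u (ball_aut a (ball_aut (-m) (fst p)), snd p))"
      "continuous_on D (\<lambda>p. u (ball_aut a (ball_aut (-m) (fst p)), snd p))" if u: "u \<in> F" and a: "norm a < 1" for u a
    using plurisubharmonic_on_compose_ball_aut[OF plurisubharmonic_on_compose_ball_aut[OF F_D(1,3)[OF u] open_annulus a] open_annulus m] by simp_all
  have vc: "continuous_on (closure D) (\<lambda>p. u (ball_aut a (ball_aut (-m) (fst p)), snd p))" if u: "u \<in> F" and a: "norm a < 1" for u a
  proof (rule continuous_on_compose2[OF F_D(2)[OF u]])
    have c1: "continuous_on (closure D) (\<lambda>p. ball_aut (-m) (fst p))"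
      by (rule continuous_on_compose2[OF continuous_on_ball_aut[OF m]]) (auto simp: closure_D intro!: continuous_intros)
    show "continuous_on (closure D) (\<lambda>p. (ball_aut a (ball_aut (-m) (fst p)), snd p))"
      by (intro continuous_intros continuous_on_compose2[OF continuous_on_ball_aut[OF a] c1])
        (auto simp: closure_D intro!: ball_aut_norm_le[OF m])
    show "(\<lambda>p. (ball_aut a (ball_aut (-m) (fst p)), snd p)) ` closure D \<subseteq> closure D"
      by (auto simp: closure_D intro!: ball_aut_norm_le[OF m] ball_aut_norm_le[OF a])
  qed
  let ?v1 = "\<lambda>p. u1 (ball_aut a1 (ball_aut (-m) (fst p)), snd p)" and ?v2 = "\<lambda>p. u2 (ball_aut a2 (ball_aut (-m) (fst p)), snd p)"
  have cW: "continuous_on (closure D) ?W" by (intro continuous_intros vc u1 u2 a) auto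
  then have cW': "continuous_on D ?W" using closure_subset by (rule continuous_on_subset)
  have "plurisubharmonic_on prod_scale D ?W"
  proof (rule plurisubharmonic_on_continuousI[OF open_D cW' continuous_on_prod_scale_cis])
    fix x b :: "(complex^'n) \<times> complex" assume xb: "\<And>\<xi>. norm \<xi> \<le> 1 \<Longrightarrow> x + prod_scale \<xi> b \<in> D"
    note s1 = plurisubharmonic_on_submean[OF v(1)[OF u1 a(1)], OF xb] and s2 = plurisubharmonic_on_submean[OF v(1)[OF u2 a(2)], OF xb]
    have i: "integral {0..2*pi} (\<lambda>\<theta>. ?W (x + prod_scale (cis \<theta>) b)) =
       (integral {0..2*pi} (\<lambda>\<theta>. ?v1 (x + prod_scale (cis \<theta>) b)) + integral {0..2*pi} (\<lambda>\<theta>. ?v2 (x + prod_scale (cis \<theta>) b))) / 2 - 2 * pi * c"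
      (is "integral _ ?w = (integral _ ?w1 + integral _ ?w2) / 2 - _")
    proof -
      have "(?w1 has_integral integral {0..2*pi} ?w1) {0..2*pi}" "(?w2 has_integral integral {0..2*pi} ?w2) {0..2*pi}"
        using s1(1) s2(1) by (blast intro: integrable_integral)+
      from has_integral_diff[OF has_integral_divide[OF has_integral_add[OF this], of 2] has_integral_const_real[of c 0 "2*pi"]]
      show ?thesis by (intro integral_unique) simp
    qed
    have "2 * pi * ?W x \<le> integral {0..2*pi} (\<lambda>\<theta>. ?W (x + prod_scale (cis \<theta>) b))"
    proof -
      have "2 * pi * ?v1 x \<le> integral {0..2*pi} (\<lambda>\<theta>. ?v1 (x + prod_scale (cis \<theta>) b))"
           "2 * pi * ?v2 x \<le> integral {0..2*pi} (\<lambda>\<theta>. ?v2 (x + prod_scale (cis \<theta>) b))" using s1(2) s2(2) by blast+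
      then show ?thesis unfolding i by (simp add: algebra_simps)
    qed
    then show "?W x \<le> integral {0..2*pi} (\<lambda>\<theta>. ?W (x + prod_scale (cis \<theta>) b)) / (2 * pi)"
      by (simp add: pos_le_divide_eq mult.commute)
  qed
  moreover have "?W p \<le> boundary_data \<phi>0 \<phi>1 p" if p: "p \<in> frontier D" for p
  proof -
    obtain z \<zeta> where pz: "p = (z, \<zeta>)" by (cases p)
    have z: "norm z \<le> 1" "\<zeta> \<in> closure annulus" "norm z = 1 \<or> \<zeta> \<notin> annulus" using p by (auto simp: pz frontier_D_iff)
    \<comment> \<open>In terms of w the three points are the images of w under the automorphisms
      with parameters a1, a2 and m, the last being z itself; this is the form of the hypotheses on
      \<phi>0 and \<phi>1.\<close>
    define w where "w = ball_aut (- m) z"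
    have w: "norm w \<le> 1" using ball_aut_norm_le[OF m z(1)] by (simp add: w_def)
    have mw: "ball_aut m w = z" unfolding w_def by (rule ball_aut_inverse[OF a(3) z(1)])
    have fr: "(ball_aut b w, \<zeta>) \<in> frontier D" if b: "norm b < 1" for b
    proof -
      have "norm z = 1 \<Longrightarrow> norm (ball_aut b w) = 1" using ball_aut_norm_eq[OF m, of z] ball_aut_norm_eq[OF b, of w] by (simp add: w_def)
      then show ?thesis using z ball_aut_norm_le[OF b w] by (auto simp: frontier_D_iff)
    qed
    define t where "t = ?W p"
    have le: "t \<le> (boundary_data \<phi>0 \<phi>1 (ball_aut a1 w, \<zeta>) + boundary_data \<phi>0 \<phi>1 (ball_aut a2 w, \<zeta>)) / 2 - c"
      using F_D(4)[OF u1 fr[OF a(1)]] F_D(4)[OF u2 fr[OF a(2)]] by (simp add: t_def pz w_def)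
    have "t \<le> boundary_data \<phi>0 \<phi>1 p"
    \<comment> \<open>\<open>boundary_data\<close> tests the sphere first. Points on the sphere stay
      there under automorphisms and all values are 0; points inside stay inside, so the same clause
      for \<zeta> applies to all three points.\<close>
    proof (cases "norm z = 1")
      case True
      have w1: "norm w = 1" using ball_aut_norm_eq[OF m True] by (simp add: w_def)
      have "norm (ball_aut a1 w) = 1" "norm (ball_aut a2 w) = 1" using ball_aut_norm_eq[OF a(1) w1] ball_aut_norm_eq[OF a(2) w1] .
      then show ?thesis using le True c by (simp add: boundary_data_def pz)
    next
      case False
      then have z1: "norm z < 1" using z(1) by simp
      have w1: "norm w < 1" using ball_aut_norm_less[OF m z1] by (simp add: w_def)
      have n: "norm (ball_aut a1 w) \<noteq> 1" "norm (ball_aut a2 w) \<noteq> 1"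
        using ball_aut_norm_less[OF a(1) w1] ball_aut_norm_less[OF a(2) w1] by auto
      consider "norm \<zeta> = 1" | "norm \<zeta> = exp 1" using z False closure_annulus_cases by blast
      then show ?thesis
      proof cases
        case 1
        have "t \<le> (\<phi>0 (ball_aut a1 w) + \<phi>0 (ball_aut a2 w)) / 2 - c" using le n 1 by (simp add: boundary_data_def)
        moreover have "\<phi>0 (ball_aut a1 w) + \<phi>0 (ball_aut a2 w) \<le> 2 * \<phi>0 z + 2 * c" using \<phi>0[of w] w mw by simp
        moreover have "(\<phi>0 (ball_aut a1 w) + \<phi>0 (ball_aut a2 w)) = 2 * ((\<phi>0 (ball_aut a1 w) + \<phi>0 (ball_aut a2 w)) / 2)" by simp
        ultimately have "t \<le> \<phi>0 z" by (smt (verit))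
        then show ?thesis using False 1 by (simp add: boundary_data_def pz)
      next
        case 2
        have "t \<le> (\<phi>1 (ball_aut a1 w) + \<phi>1 (ball_aut a2 w)) / 2 - c" using le n 2 by (simp add: boundary_data_def)
        moreover have "\<phi>1 (ball_aut a1 w) + \<phi>1 (ball_aut a2 w) \<le> 2 * \<phi>1 z + 2 * c" using \<phi>1[of w] w mw by simp
        moreover have "(\<phi>1 (ball_aut a1 w) + \<phi>1 (ball_aut a2 w)) = 2 * ((\<phi>1 (ball_aut a1 w) + \<phi>1 (ball_aut a2 w)) / 2)" by simp
        ultimately have "t \<le> \<phi>1 z" by (smt (verit))
        then show ?thesis using False 2 by (simp add: boundary_data_def pz)
      qed
    qed
    then show ?thesis by (simp only: t_def)
  qed
  ultimately show ?thesis using cW by (simp add: perron_family_def)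
qed

text \<open>At z = m the inner automorphism gives 0, hence the competitor takes the values of u1 at
  a1 and of u2 at a2; then the suprema over u1 and u2 are taken in turn. As m is any point of the
  ball, a1 = a2 is allowed and yields a first-order comparison.\<close>

lemma Phi_compare:
  assumes a: "norm a1 < 1" "norm a2 < 1" "norm m < 1" and c: "0 \<le> c"
    and \<phi>0: "\<And>w. w \<in> cball 0 1 \<Longrightarrow> \<phi>0 (ball_aut a1 w) + \<phi>0 (ball_aut a2 w) \<le> 2 * \<phi>0 (ball_aut m w) + 2 * c"
    and \<phi>1: "\<And>w. w \<in> cball 0 1 \<Longrightarrow> \<phi>1 (ball_aut a1 w) + \<phi>1 (ball_aut a2 w) \<le> 2 * \<phi>1 (ball_aut m w) + 2 * c"
    and \<zeta>: "\<zeta> \<in> annulus"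
  shows "\<Phi> (a1, \<zeta>) + \<Phi> (a2, \<zeta>) \<le> 2 * \<Phi> (m, \<zeta>) + 2 * c"
proof -
  have m0: "ball_aut (-m) m = 0" using ball_aut_inverse[of "-m" 0] a(3) by simp
  have "u1 (a1, \<zeta>) + u2 (a2, \<zeta>) \<le> 2 * \<Phi> (m, \<zeta>) + 2 * c" if "u1 \<in> F" "u2 \<in> F" for u1 u2
  proof -
    have "(u1 (a1, \<zeta>) + u2 (a2, \<zeta>)) / 2 - c \<le> \<Phi> (m, \<zeta>)"
      using Phi_upper[OF competitor[OF a c \<phi>0 \<phi>1 that], of "(m, \<zeta>)"] a(3) \<zeta> by (simp add: m0)
    moreover have "u1 (a1, \<zeta>) + u2 (a2, \<zeta>) = 2 * ((u1 (a1, \<zeta>) + u2 (a2, \<zeta>)) / 2)" by simp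
    ultimately show ?thesis by (smt (verit))
  qed
  then have "\<Phi> (a1, \<zeta>) \<le> 2 * \<Phi> (m, \<zeta>) + 2 * c - u2 (a2, \<zeta>)" if "u2 \<in> F" for u2
    using that by (intro Phi_least) (simp add: algebra_simps)
  then have "\<Phi> (a2, \<zeta>) \<le> 2 * \<Phi> (m, \<zeta>) + 2 * c - \<Phi> (a1, \<zeta>)"
    by (intro Phi_least) (simp add: algebra_simps)
  then show ?thesis by simp
qed

lemma Phi_semiconcave_lipschitz:
  assumes \<rho>: "0 < \<rho>" "\<rho> < 1"
  shows "\<exists>C\<ge>0. \<forall>\<zeta>\<in>annulus. \<forall>x\<in>cball 0 \<rho>. \<forall>y\<in>cball 0 \<rho>.
    \<Phi> (x, \<zeta>) + \<Phi> (y, \<zeta>) - 2 * \<Phi> (midpoint x y, \<zeta>) \<le> C * (norm (x - y))\<^sup>2 \<and> \<bar>\<Phi> (x, \<zeta>) - \<Phi> (y, \<zeta>)\<bar> \<le> C * norm (x - y)"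
proof -
  obtain B0 where B0: "unif_C11_bound B0 (cball 0 1) (cball 0 \<rho>) (\<lambda>w a. \<phi>0 (ball_aut a w))"
    using unif_C11_compose_ball_aut[OF \<rho> C0] unfolding unif_C11_def by blast
  obtain B1 where B1: "unif_C11_bound B1 (cball 0 1) (cball 0 \<rho>) (\<lambda>w a. \<phi>1 (ball_aut a w))"
    using unif_C11_compose_ball_aut[OF \<rho> C1] unfolding unif_C11_def by blast
  define C where "C = max B0 B1"
  have C: "0 \<le> C" "B0 \<le> C" "B1 \<le> C" using unif_C11_boundD(1)[OF B0] by (auto simp: C_def)
  show ?thesis
  proof (intro exI[of _ C] conjI ballI C(1))
    fix \<zeta> and x y :: "complex^'n" assume \<zeta>: "\<zeta> \<in> annulus" and x: "x \<in> cball 0 \<rho>" and y: "y \<in> cball 0 \<rho>"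
    have m: "midpoint x y \<in> cball 0 \<rho>" using x y by (meson convex_cball convex_contains_segment midpoint_in_closed_segment subsetD)
    have n: "norm x < 1" "norm y < 1" "norm (midpoint x y) < 1" using x y m \<rho> by auto
    have b: "B * (norm (x - y))\<^sup>2 \<le> C * (norm (x - y))\<^sup>2" "B * norm (x - y) \<le> C * norm (x - y)" if "B \<le> C" for B
      using that by (auto intro: mult_right_mono)
    have "\<Phi> (x, \<zeta>) + \<Phi> (y, \<zeta>) \<le> 2 * \<Phi> (midpoint x y, \<zeta>) + 2 * (C * (norm (x - y))\<^sup>2 / 2)"
    proof (rule Phi_compare[OF n _ _ _ \<zeta>])
      fix w :: "complex^'n" assume w: "w \<in> cball 0 1"
      show "\<phi>0 (ball_aut x w) + \<phi>0 (ball_aut y w) \<le> 2 * \<phi>0 (ball_aut (midpoint x y) w) + 2 * (C * (norm (x - y))\<^sup>2 / 2)"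
        using unif_C11_boundD(4)[OF B0 w x y] b(1)[OF C(2)] by (simp add: abs_le_iff)
      show "\<phi>1 (ball_aut x w) + \<phi>1 (ball_aut y w) \<le> 2 * \<phi>1 (ball_aut (midpoint x y) w) + 2 * (C * (norm (x - y))\<^sup>2 / 2)"
        using unif_C11_boundD(4)[OF B1 w x y] b(1)[OF C(3)] by (simp add: abs_le_iff)
    qed (use C in simp)
    then show "\<Phi> (x, \<zeta>) + \<Phi> (y, \<zeta>) - 2 * \<Phi> (midpoint x y, \<zeta>) \<le> C * (norm (x - y))\<^sup>2" by simp
    \<comment> \<open>The comparison with a1 = a2 = x and m = y turns the Lipschitz clause for the
      boundary values into one for the envelope.\<close>
    have l: "\<Phi> (x, \<zeta>) - \<Phi> (y, \<zeta>) \<le> C * norm (x - y)" if x: "x \<in> cball 0 \<rho>" and y: "y \<in> cball 0 \<rho>" for x y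
    proof -
      have n: "norm x < 1" "norm y < 1" using x y \<rho> by auto
      have b: "B * norm (x - y) \<le> C * norm (x - y)" if "B \<le> C" for B using that by (auto intro: mult_right_mono)
      have "\<Phi> (x, \<zeta>) + \<Phi> (x, \<zeta>) \<le> 2 * \<Phi> (y, \<zeta>) + 2 * (C * norm (x - y))"
      proof (rule Phi_compare[OF n(1) n _ _ _ \<zeta>])
        fix w :: "complex^'n" assume w: "w \<in> cball 0 1"
        show "\<phi>0 (ball_aut x w) + \<phi>0 (ball_aut x w) \<le> 2 * \<phi>0 (ball_aut y w) + 2 * (C * norm (x - y))"
          using unif_C11_boundD(3)[OF B0 w x y] b[OF C(2)] by (simp add: abs_le_iff)
        show "\<phi>1 (ball_aut x w) + \<phi>1 (ball_aut x w) \<le> 2 * \<phi>1 (ball_aut y w) + 2 * (C * norm (x - y))"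
          using unif_C11_boundD(3)[OF B1 w x y] b[OF C(3)] by (simp add: abs_le_iff)
      qed (use C in simp)
      then show ?thesis by simp
    qed
    show "\<bar>\<Phi> (x, \<zeta>) - \<Phi> (y, \<zeta>)\<bar> \<le> C * norm (x - y)"
      using l[OF x y] l[OF y x] by (simp add: abs_le_iff norm_minus_commute)
  qed
qed

lemma Phi_continuous_cball:
  assumes \<rho>: "0 < \<rho>" "\<rho> < 1" and \<zeta>: "\<zeta> \<in> annulus"
  shows "continuous_on (cball 0 \<rho>) (\<lambda>z. \<Phi> (z, \<zeta>))"
proof -
  obtain C where "0 \<le> C" "\<And>x y. x \<in> cball 0 \<rho> \<Longrightarrow> y \<in> cball 0 \<rho> \<Longrightarrow> \<bar>\<Phi> (x, \<zeta>) - \<Phi> (y, \<zeta>)\<bar> \<le> C * norm (x - y)"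
    using Phi_semiconcave_lipschitz[OF \<rho>] \<zeta> by blast
  then have "C-lipschitz_on (cball 0 \<rho>) (\<lambda>z. \<Phi> (z, \<zeta>))"
    by (intro lipschitz_onI) (auto simp: dist_norm)
  then show ?thesis by (rule lipschitz_on_continuous_on)
qed

text \<open>Suprema inherit sub-mean inequalities as soon as the right-hand side is integrable.
  Continuity in z, already known from the Lipschitz bound, provides this, so the envelope needs no
  upper regularisation here.\<close>

lemma Phi_submean:
  assumes \<rho>: "0 < \<rho>" "\<rho> < 1" and \<zeta>: "\<zeta> \<in> annulus" and disc: "\<And>\<xi>. norm \<xi> \<le> 1 \<Longrightarrow> a + \<xi> *s b \<in> cball 0 \<rho>"
  shows "2 * pi * \<Phi> (a, \<zeta>) \<le> integral {0..2*pi} (\<lambda>\<theta>. \<Phi> (a + cis \<theta> *s b, \<zeta>))"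
proof -
  have c: "continuous_on {0..2*pi} (\<lambda>\<theta>. \<Phi> (a + cis \<theta> *s b, \<zeta>))"
  proof (rule continuous_on_compose2[OF Phi_continuous_cball[OF \<rho> \<zeta>]])
    show "continuous_on {0..2*pi} (\<lambda>\<theta>. a + cis \<theta> *s b)" unfolding cis_vec_eq by (intro continuous_intros)
  qed (use disc in auto)
  then have i: "(\<lambda>\<theta>. \<Phi> (a + cis \<theta> *s b, \<zeta>)) integrable_on {0..2*pi}" by (rule integrable_continuous_real)
  have "\<Phi> (a, \<zeta>) \<le> integral {0..2*pi} (\<lambda>\<theta>. \<Phi> (a + cis \<theta> *s b, \<zeta>)) / (2 * pi)"
  proof (rule Phi_least)
    fix u assume u: "u \<in> F"
    have e: "(a, \<zeta>) + prod_scale \<xi> (b, 0) = (a + \<xi> *s b, \<zeta>)" for \<xi> by (simp add: prod_scale_def)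
    have d: "(a, \<zeta>) + prod_scale \<xi> (b, 0) \<in> D" if "norm \<xi> \<le> 1" for \<xi>
      unfolding e using disc[OF that] \<rho> \<zeta> by auto
    have s: "(\<lambda>\<theta>. u (a + cis \<theta> *s b, \<zeta>)) integrable_on {0..2*pi}"
       "2 * pi * u (a, \<zeta>) \<le> integral {0..2*pi} (\<lambda>\<theta>. u (a + cis \<theta> *s b, \<zeta>))"
      using plurisubharmonic_on_submean[OF F_D(1)[OF u], of "(a, \<zeta>)" "(b, 0)"] d unfolding e by blast+
    have "u (a + cis \<theta> *s b, \<zeta>) \<le> \<Phi> (a + cis \<theta> *s b, \<zeta>)" for \<theta>
      using Phi_upper[OF u d[of "cis \<theta>"]] unfolding e by simp
    then have "integral {0..2*pi} (\<lambda>\<theta>. u (a + cis \<theta> *s b, \<zeta>)) \<le> integral {0..2*pi} (\<lambda>\<theta>. \<Phi> (a + cis \<theta> *s b, \<zeta>))"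
      by (intro integral_le s(1) i)
    then show "u (a, \<zeta>) \<le> integral {0..2*pi} (\<lambda>\<theta>. \<Phi> (a + cis \<theta> *s b, \<zeta>)) / (2 * pi)"
      using s(2) by (simp add: pos_le_divide_eq mult.commute)
  qed
  then show ?thesis by (simp add: pos_le_divide_eq mult.commute)
qed

text \<open>The upper bound is semiconcavity. The lower one uses sub-means over the circle of radius
  |x - y| about the midpoint; with half the difference as y, the constant 20 becomes 5.\<close>

lemma Phi_second_difference:
  assumes \<rho>: "0 < \<rho>" "\<rho> < 1"
  shows "\<exists>C\<ge>0. \<exists>r>0. \<rho> + 4 * r < 1 \<and> (\<forall>\<zeta>\<in>annulus. \<forall>x0\<in>cball 0 \<rho>. \<forall>x\<in>ball x0 (4 * r). \<forall>y\<in>ball x0 (4 * r).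
    \<bar>\<Phi> (x, \<zeta>) + \<Phi> (y, \<zeta>) - 2 * \<Phi> (midpoint x y, \<zeta>)\<bar> \<le> C * (norm (x - y))\<^sup>2)"
proof -
  define \<rho>1 where "\<rho>1 = (1 + \<rho>) / 2"
  have \<rho>1: "0 < \<rho>1" "\<rho>1 < 1" using \<rho> by (auto simp: \<rho>1_def)
  \<comment> \<open>The midpoint has norm below \<rho> + 4 r and the circle has radius below 8 r;
    the 24 makes \<rho> + 12 r equal to \<rho>1.\<close>
  define r where "r = (1 - \<rho>) / 24"
  have r: "0 < r" "\<rho> + 12 * r = \<rho>1" "\<rho> + 4 * r < 1" using \<rho> by (auto simp: r_def \<rho>1_def field_simps)
  obtain C where C: "0 \<le> C" "\<And>\<zeta> x y. \<zeta> \<in> annulus \<Longrightarrow> x \<in> cball 0 \<rho>1 \<Longrightarrow> y \<in> cball 0 \<rho>1 \<Longrightarrow>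
      \<Phi> (x, \<zeta>) + \<Phi> (y, \<zeta>) - 2 * \<Phi> (midpoint x y, \<zeta>) \<le> C * (norm (x - y))\<^sup>2"
    using Phi_semiconcave_lipschitz[OF \<rho>1] by blast
  have main: "\<bar>\<Phi> (x, \<zeta>) + \<Phi> (y, \<zeta>) - 2 * \<Phi> (midpoint x y, \<zeta>)\<bar> \<le> 5 * C * (norm (x - y))\<^sup>2"
    if \<zeta>: "\<zeta> \<in> annulus" and x0: "x0 \<in> cball 0 \<rho>" and x: "x \<in> ball x0 (4 * r)" and y: "y \<in> ball x0 (4 * r)" for \<zeta> x0 x y
  proof -
    have nb: "norm z \<le> \<rho> + 4 * r" if "z \<in> ball x0 (4 * r)" for z
      using that x0 norm_triangle_ineq2[of z x0] by (simp add: dist_norm norm_minus_commute)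
    define a where "a = midpoint x y"
    have ab: "a \<in> ball x0 (4 * r)" unfolding a_def using x y by (meson convex_ball convex_contains_segment midpoint_in_closed_segment subsetD)
    define v where "v = (1/2) *\<^sub>R (x - y)"
    have xy: "x = a + v" "y = a - v"
      by (simp_all add: a_def v_def midpoint_def algebra_simps flip: scaleR_add_left)
    have nxy: "norm (2 *\<^sub>R v) < 8 * r"
      using x y norm_triangle_ineq4[of "x - x0" "y - x0"] by (simp add: v_def dist_norm norm_minus_commute)
    have in1: "a + \<xi> *s (2 *\<^sub>R v) \<in> cball 0 \<rho>1" if "norm \<xi> \<le> 1" for \<xi>
    proof -
      have "norm (\<xi> *s (2 *\<^sub>R v)) \<le> 1 * norm (2 *\<^sub>R v)" unfolding norm_complex_scale using that by (intro mult_right_mono) auto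
      then show ?thesis using nb[OF ab] nxy norm_triangle_ineq[of a "\<xi> *s (2 *\<^sub>R v)"] r(2) by simp
    qed
    have in2: "a + \<xi> *s (- 2 *\<^sub>R v) \<in> cball 0 \<rho>1" if "norm \<xi> \<le> 1" for \<xi>
    proof -
      have "\<xi> *s (- 2 *\<^sub>R v) = (- \<xi>) *s (2 *\<^sub>R v)" by (simp add: vec_eq_iff)
      then show ?thesis using in1[of "- \<xi>"] that by simp
    qed
    have "- (20 * C * (norm v)\<^sup>2) \<le> \<Phi> (a + v, \<zeta>) + \<Phi> (a - v, \<zeta>) - 2 * \<Phi> (a, \<zeta>)"
      by (rule semiconcave_submean_imp_lower_bound[where S="cball 0 \<rho>1" and f="\<lambda>z. \<Phi> (z, \<zeta>)"])
        (use Phi_continuous_cball[OF \<rho>1 \<zeta>] C \<zeta> in1 in2 Phi_submean[OF \<rho>1 \<zeta> in1] Phi_submean[OF \<rho>1 \<zeta> in2] in auto)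
    moreover have "\<Phi> (x, \<zeta>) + \<Phi> (y, \<zeta>) - 2 * \<Phi> (a, \<zeta>) \<le> C * (norm (x - y))\<^sup>2"
      unfolding a_def using nb[OF x] nb[OF y] r by (intro C(2)[OF \<zeta>]) auto
    moreover have "20 * C * (norm v)\<^sup>2 = 5 * C * (norm (x - y))\<^sup>2" by (simp add: v_def power2_eq_square)
    moreover have "C * (norm (x - y))\<^sup>2 \<le> 5 * C * (norm (x - y))\<^sup>2" using C(1) by (intro mult_right_mono) auto
    ultimately show ?thesis
      unfolding a_def[symmetric] using xy by (simp add: abs_le_iff)
  qed
  have "0 \<le> 5 * C" using C by simp
  then show ?thesis using main r by blast
qed

text \<open>A supremum of continuous functions is lower semicontinuous. This gives joint
  measurability in (z, \<zeta>) with no modulus of continuity in \<zeta>.\<close>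

lemma Phi_borel: "(\<lambda>p. if p \<in> D then \<Phi> p else 0) \<in> borel_measurable borel"
proof -
  have D [measurable]: "D \<in> sets borel" using open_D by simp
  have o: "open {p \<in> D. c < \<Phi> p}" for c
  proof -
    have A: "\<exists>u\<in>F. c < u p" if p: "p \<in> D" "c < \<Phi> p" for p
    proof (rule ccontr)
      assume "\<not> (\<exists>u\<in>F. c < u p)"
      then have "\<And>u. u \<in> F \<Longrightarrow> u p \<le> c" by (simp add: not_less)
      then have "\<Phi> p \<le> c" by (rule Phi_least)
      then show False using p by simp
    qed
    have B: "c < \<Phi> p" if "p \<in> D" "u \<in> F" "c < u p" for p u
      using Phi_upper[OF that(2,1)] that(3) by simp
    have eq: "{p \<in> D. c < \<Phi> p} = (\<Union>u\<in>F. D \<inter> u -` {c<..})"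
    proof (intro equalityI subsetI)
      fix p assume "p \<in> {p \<in> D. c < \<Phi> p}"
      then have p: "p \<in> D" "c < \<Phi> p" by simp_all
      from A[OF this] obtain u where u: "u \<in> F" "c < u p" by (elim bexE)
      have "p \<in> D \<inter> u -` {c<..}" using p(1) u(2) by simp
      then show "p \<in> (\<Union>u\<in>F. D \<inter> u -` {c<..})" by (rule UN_I[OF u(1)])
    next
      fix p assume "p \<in> (\<Union>u\<in>F. D \<inter> u -` {c<..})"
      then obtain u where u: "u \<in> F" "p \<in> D \<inter> u -` {c<..}" by (elim UN_E)
      then have "p \<in> D" "c < u p" by simp_all
      then show "p \<in> {p \<in> D. c < \<Phi> p}" using B[OF _ u(1)] by simp
    qed
    have "open (D \<inter> u -` {c<..})" if "u \<in> F" for u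
      using F_D(3)[OF that] open_greaterThan by (rule continuous_open_preimage[OF _ open_D])
    then show ?thesis unfolding eq by (intro open_UN) blast
  qed
  show ?thesis
  proof (rule borel_measurableI_greater)
    fix c :: real
    have "{p \<in> space borel. c < (if p \<in> D then \<Phi> p else 0)} = {p \<in> D. c < \<Phi> p} \<union> (if c < 0 then - D else {})" by auto
    moreover have "\<dots> \<in> sets borel" using o[of c] D by (intro sets.Un) auto
    ultimately show "{p \<in> space borel. c < (if p \<in> D then \<Phi> p else 0)} \<in> sets borel" by simp
  qed
qed

end

section \<open>Operator norm of the Hessian and weak second derivatives\<close>

lemma onorm_le_iff:
  fixes f :: "'a::euclidean_space \<Rightarrow> 'b::euclidean_space"
  assumes "bounded_linear f"
  shows "onorm f \<le> c \<longleftrightarrow> (\<forall>h. norm (f h) \<le> c * norm h)"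
proof
  assume "onorm f \<le> c"
  then show "\<forall>h. norm (f h) \<le> c * norm h"
    using onorm[OF assms] by (meson mult_right_mono norm_ge_zero order_trans)
next
  assume "\<forall>h. norm (f h) \<le> c * norm h"
  then show "onorm f \<le> c" by (intro onorm_le) simp
qed

text \<open>For a continuous linear map, the bound on the operator norm need only be tested on a
  countable dense set of vectors.\<close>

lemma borel_measurable_onorm:
  fixes H :: "'x \<Rightarrow> 'a::euclidean_space \<Rightarrow> 'b::euclidean_space"
  assumes meas: "\<And>h. (\<lambda>x. H x h) \<in> borel_measurable M" and lin: "\<And>x. linear (H x)"
  shows "(\<lambda>x. onorm (H x)) \<in> borel_measurable M"
proof -
  obtain Q :: "'a set" where Q: "countable Q" "closure Q = UNIV"
  proof -
    obtain Q :: "'a set" where Q: "countable Q" "\<And>X. open X \<Longrightarrow> X \<noteq> {} \<Longrightarrow> \<exists>d\<in>Q. d \<in> X"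
      by (rule countable_dense_setE) blast
    have "closure Q = UNIV"
    proof (rule ccontr)
      assume "closure Q \<noteq> UNIV"
      then have "- closure Q \<noteq> {}" "open (- closure Q)" by auto
      then show False using Q(2)[of "- closure Q"] closure_subset by blast
    qed
    then show ?thesis using that Q(1) by blast
  qed
  have bl: "bounded_linear (H x)" for x using lin by (simp add: linear_conv_bounded_linear)
  have eq: "onorm (H x) \<le> c \<longleftrightarrow> (\<forall>h\<in>Q. norm (H x h) \<le> c * norm h)" for x c
  proof -
    have "norm (H x h) \<le> c * norm h" if all: "\<forall>h\<in>Q. norm (H x h) \<le> c * norm h" for h
    proof -
      have "continuous_on UNIV (H x)" using bl by (simp add: linear_continuous_on)
      then have "closed {h. norm (H x h) \<le> c * norm h}"
        by (intro closed_Collect_le continuous_intros) auto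
      then have "closure Q \<subseteq> {h. norm (H x h) \<le> c * norm h}" using all by (intro closure_minimal) auto
      then show ?thesis using Q(2) by auto
    qed
    then show ?thesis using onorm_le_iff[OF bl] by blast
  qed
  show ?thesis
    unfolding borel_measurable_iff_le
  proof
    fix c
    have "{x \<in> space M. \<not> norm (H x h) \<le> c * norm h} \<in> sets M" for h
      using meas[of h] by measurable
    then have "space M - (\<Union>h\<in>Q. {x \<in> space M. \<not> norm (H x h) \<le> c * norm h}) \<in> sets M"
      using Q(1) by (intro sets.Diff sets.top sets.countable_UN') auto
    also have "space M - (\<Union>h\<in>Q. {x \<in> space M. \<not> norm (H x h) \<le> c * norm h}) = {x \<in> space M. \<forall>h\<in>Q. norm (H x h) \<le> c * norm h}" by auto
    finally have "{x \<in> space M. \<forall>h\<in>Q. norm (H x h) \<le> c * norm h} \<in> sets M" .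
    then show "{x \<in> space M. onorm (H x) \<le> c} \<in> sets M" by (simp add: eq)
  qed
qed

lemma linear_hessian: "linear (hessian f x)"
  unfolding hessian_def
  by (intro linearI) (simp_all add: inner_add_left distrib_right sum.distrib scaleR_add_left scaleR_sum_right sum_distrib_left mult.assoc)

lemma onorm_hessian_le:
  fixes f :: "'a::euclidean_space \<Rightarrow> real"
  assumes L: "\<And>i j. i \<in> Basis \<Longrightarrow> j \<in> Basis \<Longrightarrow> \<bar>partial_deriv i (partial_deriv j f) x\<bar> \<le> L"
  shows "onorm (hessian f x) \<le> real DIM('a) * (real DIM('a) * L)"
proof (rule onorm_le)
  fix h :: 'a
  have "norm (hessian f x h) \<le> (\<Sum>i\<in>Basis. norm ((\<Sum>j\<in>Basis. (h \<bullet> j) * partial_deriv i (partial_deriv j f) x) *\<^sub>R i))"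
    unfolding hessian_def by (rule norm_sum)
  also have "\<dots> \<le> (\<Sum>i\<in>(Basis::'a set). \<Sum>j\<in>(Basis::'a set). norm h * L)"
  proof (rule sum_mono)
    fix i :: 'a assume i: "i \<in> Basis"
    have "norm ((\<Sum>j\<in>Basis. (h \<bullet> j) * partial_deriv i (partial_deriv j f) x) *\<^sub>R i) = \<bar>\<Sum>j\<in>Basis. (h \<bullet> j) * partial_deriv i (partial_deriv j f) x\<bar>"
      using i by simp
    also have "\<dots> \<le> (\<Sum>j\<in>Basis. \<bar>(h \<bullet> j) * partial_deriv i (partial_deriv j f) x\<bar>)" by (rule sum_abs)
    also have "\<dots> \<le> (\<Sum>j\<in>(Basis::'a set). norm h * L)"
      unfolding abs_mult by (intro sum_mono mult_mono Basis_le_norm L i) auto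
    finally show "norm ((\<Sum>j\<in>Basis. (h \<bullet> j) * partial_deriv i (partial_deriv j f) x) *\<^sub>R i) \<le> (\<Sum>j\<in>(Basis::'a set). norm h * L)" .
  qed
  also have "\<dots> = real DIM('a) * (real DIM('a) * L) * norm h" by simp
  finally show "norm (hessian f x h) \<le> real DIM('a) * (real DIM('a) * L) * norm h" .
qed

lemma DERIV_abs_le:
  fixes h :: "real \<Rightarrow> real"
  assumes d: "DERIV h 0 :> d" and r: "0 < r" and b: "\<And>t. \<bar>t\<bar> \<le> r \<Longrightarrow> \<bar>h t - h 0\<bar> \<le> L * \<bar>t\<bar>"
  shows "\<bar>d\<bar> \<le> L"
proof -
  have "((\<lambda>t. \<bar>(h t - h 0) / (t - 0)\<bar>) \<longlongrightarrow> \<bar>d\<bar>) (at 0)"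
    using d by (intro tendsto_rabs) (simp add: has_field_derivative_iff)
  moreover have "\<forall>\<^sub>F t in at 0. \<bar>(h t - h 0) / (t - 0)\<bar> \<le> L"
    unfolding eventually_at
  proof (intro exI[of _ r] conjI ballI impI r)
    fix t :: real assume "t \<noteq> 0 \<and> dist t 0 < r"
    then show "\<bar>(h t - h 0) / (t - 0)\<bar> \<le> L" using b[of t] by (simp add: field_simps)
  qed
  ultimately show ?thesis by (rule tendsto_upperbound) simp
qed

lemma compact_subset_unit_ball:
  fixes K :: "'a::euclidean_space set"
  assumes "compact K" "K \<subseteq> ball 0 1"
  shows "\<exists>\<rho>. 0 < \<rho> \<and> \<rho> < 1 \<and> K \<subseteq> cball 0 \<rho>"
proof (cases "K = {}")
  case True
  then show ?thesis by (intro exI[of _ "1/2"]) auto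
next
  case False
  have "continuous_on K norm" by (intro continuous_intros)
  then obtain x where x: "x \<in> K" "\<And>y. y \<in> K \<Longrightarrow> norm y \<le> norm x"
    using continuous_attains_sup[OF assms(1) False] by blast
  have "norm x < 1" using x(1) assms(2) by auto
  have "\<forall>y\<in>K. norm y \<le> max (norm x) (1/2)" using x(2) by (simp add: le_max_iff_disj)
  then show ?thesis using \<open>norm x < 1\<close> by (intro exI[of _ "max (norm x) (1/2)"]) auto
qed

lemma has_derivative_line:
  fixes F :: "'a::real_normed_vector \<Rightarrow> real"
  assumes "(F has_derivative F') (at x)"
  shows "DERIV (\<lambda>t. F (x + t *\<^sub>R v)) 0 :> F' v"
proof -
  have "((\<lambda>t. x + t *\<^sub>R v) has_derivative (\<lambda>t. t *\<^sub>R v)) (at 0)" by (auto intro!: derivative_eq_intros)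
  moreover have "(F has_derivative F') (at (x + 0 *\<^sub>R v))" using assms by simp
  ultimately have "((\<lambda>t. F (x + t *\<^sub>R v)) has_derivative (\<lambda>t. F' (t *\<^sub>R v))) (at 0)" by (rule has_derivative_compose)
  moreover have "(\<lambda>t. F' (t *\<^sub>R v)) = (\<lambda>t. t * F' v)"
    using linear_scale[OF has_derivative_linear[OF assms]] by (simp add: fun_eq_iff)
  ultimately show ?thesis by (simp add: has_field_derivative_def mult.commute[of "F' v"] mult_commute_abs)
qed

text \<open>The order of derivatives is the difficulty: integrating by parts first along i, then
  along j would produce the other mixed derivative of \<open>f\<close>. Instead the outer derivative
  of \<psi> along i is replaced by a difference quotient, which commutes with the derivative along
  j. One integrates by parts along j, lets the increment tend to 0, and then integrates by parts
  along i.\<close>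

lemma second_partials_weak:
  fixes f \<psi> :: "'a::euclidean_space \<Rightarrow> real"
  assumes i: "i \<in> Basis" and j: "j \<in> Basis"
    and f: "unit_ball_dir_lipschitz j f" and fj: "unit_ball_dir_lipschitz i (partial_deriv j f)"
    and \<psi>: "C2_test_function (ball 0 1) \<psi>"
  shows "set_integrable lebesgue (ball 0 1) (\<lambda>x. f x * partial_deriv i (partial_deriv j \<psi>) x)"
    "set_integrable lebesgue (ball 0 1) (\<lambda>x. partial_deriv i (partial_deriv j f) x * \<psi> x)"
    "(LINT x:ball 0 1|lebesgue. f x * partial_deriv i (partial_deriv j \<psi>) x) = (LINT x:ball 0 1|lebesgue. partial_deriv i (partial_deriv j f) x * \<psi> x)"
proof -
  have ni: "norm i = 1" and nj: "norm j = 1" using i j by auto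
  obtain g :: "'a \<Rightarrow> 'a" and H :: "'a \<Rightarrow> 'a \<Rightarrow>\<^sub>L 'a" where
    gd: "\<And>x. (\<psi> has_derivative (\<lambda>h. g x \<bullet> h)) (at x)" and
    Hd: "\<And>x. (g has_derivative blinfun_apply (H x)) (at x)" and Hc: "continuous_on UNIV H"
    and K: "compact (closure {x. \<psi> x \<noteq> 0})" "closure {x. \<psi> x \<noteq> 0} \<subseteq> ball 0 1"
    using \<psi> unfolding C2_test_function_def by blast
  obtain \<rho> where \<rho>: "0 < \<rho>" "\<rho> < 1" "closure {x. \<psi> x \<noteq> 0} \<subseteq> cball 0 \<rho>"
    using compact_subset_unit_ball[OF K] by blast
  have supp: "\<psi> x = 0" if "x \<notin> cball 0 \<rho>" for x
  proof (rule ccontr)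
    assume "\<psi> x \<noteq> 0"
    then have "x \<in> closure {x. \<psi> x \<noteq> 0}" by (intro subsetD[OF closure_subset]) simp
    then have "x \<in> cball 0 \<rho>" by (rule subsetD[OF \<rho>(3)])
    then show False using that by contradiction
  qed
  have d\<psi>: "DERIV (\<lambda>t. \<psi> (x + t *\<^sub>R v)) 0 :> g x \<bullet> v" for x v by (rule has_derivative_line[OF gd])
  have dg: "DERIV (\<lambda>t. g (x + t *\<^sub>R v) \<bullet> w) 0 :> H x v \<bullet> w" for x v w
  proof -
    have "((\<lambda>x. g x \<bullet> w) has_derivative (\<lambda>h. H x h \<bullet> w)) (at x)" using Hd by (rule has_derivative_inner_left)
    then show ?thesis by (rule has_derivative_line)
  qed
  have \<psi>c: "continuous_on UNIV \<psi>" by (intro continuous_at_imp_continuous_on ballI has_derivative_continuous[OF gd])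
  have "continuous_on UNIV g" by (intro continuous_at_imp_continuous_on ballI has_derivative_continuous[OF Hd])
  then have gc: "continuous_on UNIV (\<lambda>x. g x \<bullet> w)" for w by (intro continuous_intros)
  have Hvc: "continuous_on UNIV (\<lambda>x. H x v \<bullet> w)" for v w using Hc by (intro continuous_intros)
  have p1: "partial_deriv v \<psi> = (\<lambda>x. g x \<bullet> v)" for v
    unfolding partial_deriv_def by (intro ext DERIV_imp_deriv d\<psi>)
  have p2: "partial_deriv i (partial_deriv j \<psi>) = (\<lambda>x. H x i \<bullet> j)"
    unfolding p1 unfolding partial_deriv_def by (intro ext DERIV_imp_deriv dg)
  have gsupp: "g x \<bullet> v = 0" if "x \<notin> cball 0 \<rho>" for x v
  proof -
    have "open (- cball 0 \<rho> :: 'a set)" by (simp add: open_Compl)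
    moreover have "((\<lambda>t. x + t *\<^sub>R v) \<longlongrightarrow> x + 0 *\<^sub>R v) (nhds 0)" by (intro tendsto_intros filterlim_ident)
    ultimately have "\<forall>\<^sub>F t in nhds (0::real). x + t *\<^sub>R v \<in> - cball 0 \<rho>" using that by (intro topological_tendstoD) auto
    then have "\<forall>\<^sub>F t in nhds 0. \<psi> (x + t *\<^sub>R v) = 0" by eventually_elim (use supp in auto)
    then have "DERIV (\<lambda>t. \<psi> (x + t *\<^sub>R v)) 0 :> 0" by (subst DERIV_cong_ev[OF refl _ refl, where g="\<lambda>t. 0"]) auto
    then show ?thesis using d\<psi> DERIV_unique by blast
  qed
  define fe where "fe x = (if x \<in> ball 0 1 then f x else 0)" for x
  define fje where "fje x = (if x \<in> ball 0 1 then partial_deriv j f x else 0)" for x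
  define fije where "fije x = (if x \<in> ball 0 1 then partial_deriv i (partial_deriv j f) x else 0)" for x
  have fem [measurable]: "fe \<in> borel_measurable borel"
    unfolding fe_def using f unfolding unit_ball_dir_lipschitz_def by (intro borel_on_ball_if) auto
  have fjem [measurable]: "fje \<in> borel_measurable borel"
    unfolding fje_def using fj unfolding unit_ball_dir_lipschitz_def by (intro borel_on_ball_if) auto
  have feb: "\<exists>B. \<forall>x\<in>cball 0 \<sigma>. \<bar>fe x\<bar> \<le> B" if "\<sigma> < 1" for \<sigma>
    using unit_ball_dir_lipschitz_locally_bounded[OF f that] unfolding fe_def .
  have fjeb: "\<exists>B. \<forall>x\<in>cball 0 \<sigma>. \<bar>fje x\<bar> \<le> B" if "\<sigma> < 1" for \<sigma>
    using unit_ball_dir_lipschitz_locally_bounded[OF fj that] unfolding fje_def .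
  define e where "e = (1 - \<rho>) / 2"
  have e: "0 < e" using \<rho> by (simp add: e_def)
  define X where "X n = e * inverse (real (Suc n))" for n
  have X0: "X \<longlonglongrightarrow> 0" unfolding X_def using tendsto_mult_left[OF LIMSEQ_inverse_real_of_nat, of e] by simp
  have Xp: "0 < X n" for n using e by (simp add: X_def)
  have Xe: "X n \<le> (1 - \<rho>) / 2" for n using e unfolding e_def[symmetric] by (simp add: X_def field_simps)
  note A = difference_quotient_integral_tendsto[OF fem feb gc[of j] dg[where v=i and w=j] Hvc[of i j] \<rho>(2) gsupp[where v=j] ni X0 Xp Xe]
  note B = difference_quotient_integral_tendsto[OF fjem fjeb \<psi>c d\<psi>[where v=i] gc[of i] \<rho>(2) supp ni X0 Xp Xe]
  define \<rho>' where "\<rho>' = (1 + \<rho>) / 2"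
  have \<rho>': "\<rho>' < 1" using \<rho> by (simp add: \<rho>'_def)
  \<comment> \<open>The test function is the difference quotient of \<psi> along i; its support lies
    in the slightly larger ball of radius \<open>\<rho>'\<close>.\<close>
  have step: "(LINT x|lborel. fe x * ((g (x + X n *\<^sub>R i) \<bullet> j - g x \<bullet> j) / X n)) = - (LINT x|lborel. fje x * ((\<psi> (x + X n *\<^sub>R i) - \<psi> x) / X n))" for n
  proof -
    have 1: "continuous_on UNIV (\<lambda>x. (\<psi> (x + X n *\<^sub>R i) - \<psi> x) / X n)"
      using Xp[of n] by (intro continuous_intros continuous_on_compose2[OF \<psi>c]) auto
    have 2: "DERIV (\<lambda>t. (\<psi> (x + t *\<^sub>R j + X n *\<^sub>R i) - \<psi> (x + t *\<^sub>R j)) / X n) 0 :> (g (x + X n *\<^sub>R i) \<bullet> j - g x \<bullet> j) / X n" for x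
    proof -
      have "DERIV (\<lambda>t. \<psi> (x + X n *\<^sub>R i + t *\<^sub>R j)) 0 :> g (x + X n *\<^sub>R i) \<bullet> j" by (rule d\<psi>)
      moreover have "(\<lambda>t. \<psi> (x + X n *\<^sub>R i + t *\<^sub>R j)) = (\<lambda>t. \<psi> (x + t *\<^sub>R j + X n *\<^sub>R i))" by (simp add: algebra_simps)
      ultimately have "DERIV (\<lambda>t. \<psi> (x + t *\<^sub>R j + X n *\<^sub>R i)) 0 :> g (x + X n *\<^sub>R i) \<bullet> j" by simp
      then show ?thesis by (intro DERIV_cdivide DERIV_diff d\<psi>)
    qed
    have 3: "continuous_on UNIV (\<lambda>x. (g (x + X n *\<^sub>R i) \<bullet> j - g x \<bullet> j) / X n)"
      using Xp[of n] by (intro continuous_intros continuous_on_compose2[OF gc] gc) auto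
    have 4: "(\<psi> (x + X n *\<^sub>R i) - \<psi> x) / X n = 0" if "x \<notin> cball 0 \<rho>'" for x
    proof -
      have "norm x - X n \<le> norm (x + X n *\<^sub>R i)"
        using norm_triangle_ineq4[of "x + X n *\<^sub>R i" "X n *\<^sub>R i"] ni Xp[of n] by simp
      moreover have "norm x > \<rho>'" using that by simp
      ultimately have "norm (x + X n *\<^sub>R i) > \<rho>" "norm x > \<rho>" using Xe[of n] \<rho> by (auto simp: \<rho>'_def field_simps)
      then show ?thesis using supp by simp
    qed
    show ?thesis
      using unit_ball_integration_by_parts(3)[OF f nj 1 2 3 \<rho>' 4]
      unfolding fe_def fje_def partial_deriv_def .
  qed
  have "(\<lambda>n. LINT x|lborel. fe x * ((g (x + X n *\<^sub>R i) \<bullet> j - g x \<bullet> j) / X n)) \<longlonglongrightarrow> - (LINT x|lborel. fje x * (g x \<bullet> i))"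
    unfolding step by (intro tendsto_minus B(3))
  moreover have "(\<lambda>n. LINT x|lborel. fe x * ((g (x + X n *\<^sub>R i) \<bullet> j - g x \<bullet> j) / X n)) \<longlonglongrightarrow> (LINT x|lborel. fe x * (H x i \<bullet> j))"
    by (rule A(3))
  ultimately have E1: "(LINT x|lborel. fe x * (H x i \<bullet> j)) = - (LINT x|lborel. fje x * (g x \<bullet> i))"
    by (intro LIMSEQ_unique)
  note P = unit_ball_integration_by_parts[OF fj ni \<psi>c d\<psi>[where v=i] gc[of i] \<rho>(2) supp]
  have E2: "(LINT x|lborel. fje x * (g x \<bullet> i)) = - (LINT x|lborel. fije x * \<psi> x)"
    using P(3) unfolding fje_def fije_def partial_deriv_def[of i] .
  have I2: "integrable lborel (\<lambda>x. fije x * \<psi> x)"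
    using P(2) unfolding fije_def partial_deriv_def[of i] .
  have I1: "integrable lborel (\<lambda>x. fe x * (H x i \<bullet> j))" by (rule A(1))
  have r1: "(\<lambda>x. indicator (ball 0 1) x *\<^sub>R (f x * partial_deriv i (partial_deriv j \<psi>) x)) = (\<lambda>x. fe x * (H x i \<bullet> j))"
    unfolding p2 by (auto simp: fun_eq_iff fe_def indicator_def)
  have r2: "(\<lambda>x. indicator (ball 0 1) x *\<^sub>R (partial_deriv i (partial_deriv j f) x * \<psi> x)) = (\<lambda>x. fije x * \<psi> x)"
    by (auto simp: fun_eq_iff fije_def indicator_def)
  show "set_integrable lebesgue (ball 0 1) (\<lambda>x. f x * partial_deriv i (partial_deriv j \<psi>) x)"
    unfolding set_integrable_def r1 using I1 integrable_completion[of "\<lambda>x. fe x * (H x i \<bullet> j)" lborel] by (simp add: borel_measurable_integrable)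
  show "set_integrable lebesgue (ball 0 1) (\<lambda>x. partial_deriv i (partial_deriv j f) x * \<psi> x)"
    unfolding set_integrable_def r2 using I2 integrable_completion[of "\<lambda>x. fije x * \<psi> x" lborel] by (simp add: borel_measurable_integrable)
  show "(LINT x:ball 0 1|lebesgue. f x * partial_deriv i (partial_deriv j \<psi>) x) = (LINT x:ball 0 1|lebesgue. partial_deriv i (partial_deriv j f) x * \<psi> x)"
    unfolding set_lebesgue_integral_def r1 r2
    using integral_completion[of "\<lambda>x. fe x * (H x i \<bullet> j)" lborel] integral_completion[of "\<lambda>x. fije x * \<psi> x" lborel] I1 I2 E1 E2
    by (simp add: borel_measurable_integrable)
qed

lemma continuous_on_unit_ballI:
  fixes G :: "'a::euclidean_space \<Rightarrow> real"
  assumes "\<And>x. x \<in> ball 0 1 \<Longrightarrow> \<exists>r>0. continuous_on (ball x r) G"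
  shows "continuous_on (ball 0 1) G"
  unfolding continuous_on_eq_continuous_at[OF open_ball]
proof
  fix x :: 'a assume "x \<in> ball 0 1"
  then obtain r where "r > 0" "continuous_on (ball x r) G" using assms by blast
  then show "isCont G x" by (simp add: continuous_on_eq_continuous_at)
qed

section \<open>Regularity of the envelope in z: Lipschitz partials, weak derivatives and essential
  bounds\<close>

context envelope
begin

text \<open>One pair L, r serves all \<zeta>, j and centres because the second difference bound is
  uniform in them; r leaves the balls of radius 4 r inside the unit ball.\<close>

lemma Phi_partials:
  assumes \<rho>: "0 < \<rho>" "\<rho> < 1"
  shows "\<exists>L\<ge>0. \<exists>r>0. \<forall>\<zeta>\<in>annulus. \<forall>j\<in>Basis. \<forall>x0\<in>cball 0 \<rho>.
     L-lipschitz_on (cball x0 r) (partial_deriv j (\<lambda>w. \<Phi> (w, \<zeta>))) \<and>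
     DERIV (\<lambda>t. \<Phi> (x0 + t *\<^sub>R j, \<zeta>)) 0 :> partial_deriv j (\<lambda>w. \<Phi> (w, \<zeta>)) x0"
proof -
  obtain C r where C: "0 \<le> C" and r: "0 < r" "\<rho> + 4 * r < 1"
    and sd: "\<And>\<zeta> x0 x y. \<zeta> \<in> annulus \<Longrightarrow> x0 \<in> cball 0 \<rho> \<Longrightarrow> x \<in> ball x0 (4 * r) \<Longrightarrow> y \<in> ball x0 (4 * r) \<Longrightarrow>
      \<bar>\<Phi> (x, \<zeta>) + \<Phi> (y, \<zeta>) - 2 * \<Phi> (midpoint x y, \<zeta>)\<bar> \<le> C * (norm (x - y))\<^sup>2"
    using Phi_second_difference[OF \<rho>] by blast
  have main: "(12 * C)-lipschitz_on (cball x0 r) (partial_deriv j (\<lambda>w. \<Phi> (w, \<zeta>))) \<and>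
     DERIV (\<lambda>t. \<Phi> (x0 + t *\<^sub>R j, \<zeta>)) 0 :> partial_deriv j (\<lambda>w. \<Phi> (w, \<zeta>)) x0"
    if \<zeta>: "\<zeta> \<in> annulus" and j: "j \<in> Basis" and x0: "x0 \<in> cball 0 \<rho>" for \<zeta> j x0
  proof -
    have nj: "norm j = 1" using j by simp
    have p: "0 < \<rho> + 4 * r" using \<rho> r by simp
    have "ball x0 (4 * r) \<subseteq> cball 0 (\<rho> + 4 * r)"
    proof
      fix z assume "z \<in> ball x0 (4 * r)"
      then show "z \<in> cball 0 (\<rho> + 4 * r)" using x0 norm_triangle_ineq2[of z x0] by (simp add: dist_norm norm_minus_commute)
    qed
    then have cont: "continuous_on (ball x0 (4 * r)) (\<lambda>z. \<Phi> (z, \<zeta>))"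
      using Phi_continuous_cball[OF p r(2) \<zeta>] continuous_on_subset by blast
    have "(12 * C)-lipschitz_on (cball x0 r) (partial_deriv j (\<lambda>w. \<Phi> (w, \<zeta>)))"
      by (rule second_difference_imp_partial_deriv_lipschitz[OF cont r(1) nj C sd[OF \<zeta> x0]])
    moreover have "DERIV (\<lambda>t. \<Phi> (x0 + t *\<^sub>R j, \<zeta>)) 0 :> partial_deriv j (\<lambda>w. \<Phi> (w, \<zeta>)) x0"
      by (rule second_difference_imp_partial_deriv(1)[OF cont r(1) _ nj sd[OF \<zeta> x0]]) (use r in auto)
    ultimately show ?thesis by blast
  qed
  have "0 \<le> 12 * C" using C by simp
  then show ?thesis using main r(1) by blast
qed

lemma radius_exists:
  fixes x :: "complex^'n"
  assumes "x \<in> ball 0 1" obtains \<rho> where "0 < \<rho>" "\<rho> < 1" "x \<in> cball 0 \<rho>" "x \<in> ball 0 \<rho>"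
proof -
  have "norm x < 1" using assms by simp
  then show ?thesis by (intro that[of "(1 + norm x) / 2"]) (auto simp: field_simps add_pos_nonneg)
qed

lemma Phi_dir_lipschitz:
  assumes \<zeta>: "\<zeta> \<in> annulus" and v: "norm v = 1"
  shows "unit_ball_dir_lipschitz v (\<lambda>w. \<Phi> (w, \<zeta>))"
  unfolding unit_ball_dir_lipschitz_def
proof (intro conjI allI impI)
  show "continuous_on (ball 0 1) (\<lambda>w. \<Phi> (w, \<zeta>))"
  proof (rule continuous_on_unit_ballI)
    fix x :: "complex^'n" assume "x \<in> ball 0 1"
    then obtain \<rho> where \<rho>: "0 < \<rho>" "\<rho> < 1" "x \<in> ball 0 \<rho>" by (rule radius_exists)
    obtain r where r: "r > 0" "ball x r \<subseteq> ball 0 \<rho>" by (rule openE[OF open_ball \<rho>(3)])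
    have "ball x r \<subseteq> cball 0 \<rho>" using r(2) ball_subset_cball by blast
    then show "\<exists>r>0. continuous_on (ball x r) (\<lambda>w. \<Phi> (w, \<zeta>))"
      using r(1) continuous_on_subset[OF Phi_continuous_cball[OF \<rho>(1,2) \<zeta>]] by blast
  qed
next
  fix \<rho> :: real assume "\<rho> < 1"
  define \<rho>1 where "\<rho>1 = max \<rho> (1/2)"
  have \<rho>1: "0 < \<rho>1" "\<rho>1 < 1" "\<rho> \<le> \<rho>1" using \<open>\<rho> < 1\<close> by (auto simp: \<rho>1_def)
  define \<rho>2 where "\<rho>2 = (1 + \<rho>1) / 2"
  have \<rho>2: "0 < \<rho>2" "\<rho>2 < 1" using \<rho>1 by (auto simp: \<rho>2_def)
  obtain C where C: "0 \<le> C" "\<And>x y. x \<in> cball 0 \<rho>2 \<Longrightarrow> y \<in> cball 0 \<rho>2 \<Longrightarrow> \<bar>\<Phi> (x, \<zeta>) - \<Phi> (y, \<zeta>)\<bar> \<le> C * norm (x - y)"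
    using Phi_semiconcave_lipschitz[OF \<rho>2] \<zeta> by blast
  define r where "r = (1 - \<rho>1) / 2"
  have r: "0 < r" "\<rho>1 + r = \<rho>2" using \<rho>1 by (auto simp: r_def \<rho>2_def field_simps)
  have main: "\<bar>\<Phi> (x + t *\<^sub>R v, \<zeta>) - \<Phi> (x, \<zeta>)\<bar> \<le> C * \<bar>t\<bar>" if x: "x \<in> cball 0 \<rho>" and t: "\<bar>t\<bar> \<le> r" for x t
  proof -
    have "norm (x + t *\<^sub>R v) \<le> \<rho>2" using norm_triangle_ineq[of x "t *\<^sub>R v"] x t v r(2) \<rho>1 by simp
    moreover have "norm x \<le> \<rho>2" using x r \<rho>1 by simp
    ultimately show ?thesis using C(2)[of "x + t *\<^sub>R v" x] v by simp
  qed
  show "\<exists>r>0. \<exists>L\<ge>0. \<forall>x\<in>cball 0 \<rho>. \<forall>t. \<bar>t\<bar> \<le> r \<longrightarrow> \<bar>\<Phi> (x + t *\<^sub>R v, \<zeta>) - \<Phi> (x, \<zeta>)\<bar> \<le> L * \<bar>t\<bar>"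
    using main r(1) C(1) by blast
qed

lemma Phi_partial_line_bound:
  assumes \<rho>: "0 < \<rho>" "\<rho> < 1"
  shows "\<exists>L\<ge>0. \<exists>r>0. \<forall>\<zeta>\<in>annulus. \<forall>j\<in>Basis. \<forall>v. norm v = 1 \<longrightarrow> (\<forall>x\<in>cball 0 \<rho>. \<forall>t. \<bar>t\<bar> \<le> r \<longrightarrow>
     \<bar>partial_deriv j (\<lambda>w. \<Phi> (w, \<zeta>)) (x + t *\<^sub>R v) - partial_deriv j (\<lambda>w. \<Phi> (w, \<zeta>)) x\<bar> \<le> L * \<bar>t\<bar>)"
proof -
  obtain L r where L: "0 \<le> L" and r: "0 < r" and lip: "\<And>\<zeta> j x0. \<zeta> \<in> annulus \<Longrightarrow> j \<in> Basis \<Longrightarrow> x0 \<in> cball 0 \<rho> \<Longrightarrow>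
     L-lipschitz_on (cball x0 r) (partial_deriv j (\<lambda>w. \<Phi> (w, \<zeta>)))"
    using Phi_partials[OF \<rho>] by blast
  have main: "\<bar>partial_deriv j (\<lambda>w. \<Phi> (w, \<zeta>)) (x + t *\<^sub>R v) - partial_deriv j (\<lambda>w. \<Phi> (w, \<zeta>)) x\<bar> \<le> L * \<bar>t\<bar>"
    if "\<zeta> \<in> annulus" "j \<in> Basis" "norm v = 1" "x \<in> cball 0 \<rho>" "\<bar>t\<bar> \<le> r" for \<zeta> j v x t
    using lipschitz_onD[OF lip[OF that(1,2,4)], of "x + t *\<^sub>R v" x] that(3,5) r by (simp add: dist_norm)
  show ?thesis using main L r by blast
qed

lemma Phi_partial_dir_lipschitz:
  assumes \<zeta>: "\<zeta> \<in> annulus" and j: "j \<in> Basis" and v: "norm v = 1"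
  shows "unit_ball_dir_lipschitz v (partial_deriv j (\<lambda>w. \<Phi> (w, \<zeta>)))"
  unfolding unit_ball_dir_lipschitz_def
proof (intro conjI allI impI)
  show "continuous_on (ball 0 1) (partial_deriv j (\<lambda>w. \<Phi> (w, \<zeta>)))"
  proof (rule continuous_on_unit_ballI)
    fix x :: "complex^'n" assume "x \<in> ball 0 1"
    then obtain \<rho> where \<rho>: "0 < \<rho>" "\<rho> < 1" "x \<in> cball 0 \<rho>" by (rule radius_exists)
    obtain L r where r: "0 < r" "L-lipschitz_on (cball x r) (partial_deriv j (\<lambda>w. \<Phi> (w, \<zeta>)))"
      using Phi_partials[OF \<rho>(1,2)] \<zeta> j \<rho>(3) by blast
    have "continuous_on (ball x r) (partial_deriv j (\<lambda>w. \<Phi> (w, \<zeta>)))"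
      using lipschitz_on_continuous_on[OF r(2)] ball_subset_cball by (rule continuous_on_subset)
    then show "\<exists>r>0. continuous_on (ball x r) (partial_deriv j (\<lambda>w. \<Phi> (w, \<zeta>)))" using r(1) by blast
  qed
next
  fix \<rho> :: real assume "\<rho> < 1"
  define \<rho>1 where "\<rho>1 = max \<rho> (1/2)"
  have \<rho>1: "0 < \<rho>1" "\<rho>1 < 1" "cball 0 \<rho> \<subseteq> cball 0 \<rho>1" using \<open>\<rho> < 1\<close> by (auto simp: \<rho>1_def)
  show "\<exists>r>0. \<exists>L\<ge>0. \<forall>x\<in>cball 0 \<rho>. \<forall>t. \<bar>t\<bar> \<le> r \<longrightarrow>
     \<bar>partial_deriv j (\<lambda>w. \<Phi> (w, \<zeta>)) (x + t *\<^sub>R v) - partial_deriv j (\<lambda>w. \<Phi> (w, \<zeta>)) x\<bar> \<le> L * \<bar>t\<bar>"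
    using Phi_partial_line_bound[OF \<rho>1(1,2)] \<zeta> j v \<rho>1(3) by (meson subsetD)
qed

lemma Phi_weak:
  assumes \<zeta>: "\<zeta> \<in> annulus"
  shows "second_partials_weak_on (ball 0 1) (\<lambda>w. \<Phi> (w, \<zeta>))"
  unfolding second_partials_weak_on_def
proof (intro ballI allI impI)
  fix i j :: "complex^'n" and \<psi> :: "complex^'n \<Rightarrow> real"
  assume i: "i \<in> Basis" and j: "j \<in> Basis" and \<psi>: "C2_test_function (ball 0 1) \<psi>"
  have n: "norm i = 1" "norm j = 1" using i j by auto
  note W = second_partials_weak[OF i j Phi_dir_lipschitz[OF \<zeta> n(2)] Phi_partial_dir_lipschitz[OF \<zeta> j n(1)] \<psi>]
  show "set_integrable lebesgue (ball 0 1) (\<lambda>x. \<Phi> (x, \<zeta>) * partial_deriv i (partial_deriv j \<psi>) x) \<and>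
    set_integrable lebesgue (ball 0 1) (\<lambda>x. partial_deriv i (partial_deriv j (\<lambda>w. \<Phi> (w, \<zeta>))) x * \<psi> x) \<and>
    (LINT x:ball 0 1|lebesgue. \<Phi> (x, \<zeta>) * partial_deriv i (partial_deriv j \<psi>) x) =
    (LINT x:ball 0 1|lebesgue. partial_deriv i (partial_deriv j (\<lambda>w. \<Phi> (w, \<zeta>))) x * \<psi> x)"
    by (intro conjI W)
qed

lemma Phi_slice_null:
  assumes \<zeta>: "\<zeta> \<in> annulus" and i: "i \<in> Basis" and j: "j \<in> Basis"
  shows "{x \<in> ball 0 1. \<not> (\<lambda>t. partial_deriv j (\<lambda>w. \<Phi> (w, \<zeta>)) (x + t *\<^sub>R i)) differentiable at 0} \<in> null_sets lborel"
proof -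
  have n: "norm i = 1" using i by simp
  note G = Phi_partial_dir_lipschitz[OF \<zeta> j n]
  show ?thesis
    using G by (intro directional_nondifferentiable_null[OF open_ball borel_on_ball_if unit_ball_dir_lipschitz_line[OF G n]])
      (auto simp: unit_ball_dir_lipschitz_def)
qed

text \<open>The first partials exist at every point of the ball, hence near z; only the second ones
  can fail to exist.\<close>

lemma Phi_has_second_partials:
  assumes \<zeta>: "\<zeta> \<in> annulus" and z: "z \<in> ball 0 1"
    and d: "\<And>i j. i \<in> Basis \<Longrightarrow> j \<in> Basis \<Longrightarrow> (\<lambda>t. partial_deriv j (\<lambda>w. \<Phi> (w, \<zeta>)) (z + t *\<^sub>R i)) differentiable at 0"
  shows "has_second_partials_at (\<lambda>w. \<Phi> (w, \<zeta>)) z"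
  unfolding has_second_partials_at_def
proof (intro ballI conjI d)
  fix j :: "complex^'n" assume j: "j \<in> Basis"
  have "\<forall>\<^sub>F y in nhds z. y \<in> ball 0 1" using z by (intro eventually_nhds_in_open) auto
  then show "\<forall>\<^sub>F y in nhds z. (\<lambda>t. \<Phi> (y + t *\<^sub>R j, \<zeta>)) differentiable at 0"
  proof eventually_elim
    case (elim y)
    then obtain \<rho> where \<rho>: "0 < \<rho>" "\<rho> < 1" "y \<in> cball 0 \<rho>" by (rule radius_exists)
    have "DERIV (\<lambda>t. \<Phi> (y + t *\<^sub>R j, \<zeta>)) 0 :> partial_deriv j (\<lambda>w. \<Phi> (w, \<zeta>)) y"
      using Phi_partials[OF \<rho>(1,2)] \<zeta> j \<rho>(3) by blast
    then show ?case using real_differentiable_def by blast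
  qed
qed

lemma Phi_AE_has_second_partials:
  assumes \<zeta>: "\<zeta> \<in> annulus"
  shows "AE z in lebesgue_on (ball 0 1). has_second_partials_at (\<lambda>w. \<Phi> (w, \<zeta>)) z"
proof -
  let ?N = "\<lambda>i j. {x \<in> ball 0 1. \<not> (\<lambda>t. partial_deriv j (\<lambda>w. \<Phi> (w, \<zeta>)) (x + t *\<^sub>R i)) differentiable at 0}"
  have "AE z in lebesgue. \<forall>i\<in>Basis. \<forall>j\<in>Basis. z \<notin> ?N i j"
    using Phi_slice_null[OF \<zeta>] by (intro AE_finite_allI AE_not_in) (auto intro: null_sets_completionI)
  then have "AE z in lebesgue. z \<in> ball 0 1 \<longrightarrow> has_second_partials_at (\<lambda>w. \<Phi> (w, \<zeta>)) z"
  proof eventually_elim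
    case (elim z)
    then show ?case by (intro impI Phi_has_second_partials[OF \<zeta>]) auto
  qed
  then show ?thesis by (subst AE_restrict_space_iff) auto
qed

definition Phi_xx where "Phi_xx i j p = partial_deriv i (partial_deriv j (\<lambda>w. \<Phi> (w, snd p))) (fst p)"

text \<open>The direction (v, 0) moves z and freezes \<zeta>. The directional lemmas applied on
  \<open>D\<close> then give Borel measurability and null exceptional sets jointly in (z, \<zeta>),
  beyond what each single slice tells.\<close>

lemma product_line:
  assumes G: "unit_ball_dir_lipschitz v (\<lambda>z. G (z, snd p))" and v: "norm v = 1" and p: "p \<in> D"
  shows "\<exists>d>0. \<exists>L. L-lipschitz_on {-d..d} (\<lambda>t. G (p + t *\<^sub>R (v, 0)))"
proof -
  have e: "(\<lambda>t. G (p + t *\<^sub>R (v, 0))) = (\<lambda>t. G (fst p + t *\<^sub>R v, snd p))" by (cases p) simp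
  have "fst p \<in> ball 0 1" using p by (simp only: mem_Times_iff)
  then show ?thesis unfolding e by (rule unit_ball_dir_lipschitz_line[OF G v])
qed

lemma Phi_partial_borel:
  assumes j: "j \<in> Basis"
  shows "(\<lambda>p. if p \<in> D then partial_deriv j (\<lambda>w. \<Phi> (w, snd p)) (fst p) else 0) \<in> borel_measurable borel"
proof -
  have n: "norm j = 1" using j by simp
  have b: "(\<lambda>p. if p \<in> D then deriv (\<lambda>t. \<Phi> (p + t *\<^sub>R (j, 0))) 0 else 0) \<in> borel_measurable borel"
    by (rule directional_deriv_borel[OF open_D Phi_borel product_line[OF Phi_dir_lipschitz n]]) (auto simp: n)
  have e: "deriv (\<lambda>t. \<Phi> (p + t *\<^sub>R (j, 0))) 0 = partial_deriv j (\<lambda>w. \<Phi> (w, snd p)) (fst p)" for p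
    by (cases p) (simp add: partial_deriv_def)
  from b show ?thesis unfolding e .
qed

lemma Phi_xx_borel_null:
  assumes i: "i \<in> Basis" and j: "j \<in> Basis"
  shows "(\<lambda>p. if p \<in> D then Phi_xx i j p else 0) \<in> borel_measurable borel"
    and "{p \<in> D. \<not> (\<lambda>t. partial_deriv j (\<lambda>w. \<Phi> (w, snd p)) (fst p + t *\<^sub>R i)) differentiable at 0} \<in> null_sets lborel"
proof -
  have n: "norm i = 1" using i by simp
  define G where "G p = partial_deriv j (\<lambda>w. \<Phi> (w, snd p)) (fst p)" for p
  have Gb: "(\<lambda>p. if p \<in> D then G p else 0) \<in> borel_measurable borel" unfolding G_def by (rule Phi_partial_borel[OF j])
  have line: "\<exists>d>0. \<exists>L. L-lipschitz_on {-d..d} (\<lambda>t. G (p + t *\<^sub>R (i, 0)))" if p: "p \<in> D" for p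
    by (rule product_line[OF _ n p]) (use Phi_partial_dir_lipschitz[OF _ j n] p in \<open>auto simp: G_def mem_Times_iff\<close>)
  have e: "(\<lambda>t. G (p + t *\<^sub>R (i, 0))) = (\<lambda>t. partial_deriv j (\<lambda>w. \<Phi> (w, snd p)) (fst p + t *\<^sub>R i))" for p
    by (cases p) (simp add: G_def)
  show "(\<lambda>p. if p \<in> D then Phi_xx i j p else 0) \<in> borel_measurable borel"
    using directional_deriv_borel[OF open_D Gb line] unfolding e Phi_xx_def partial_deriv_def[of i] .
  show "{p \<in> D. \<not> (\<lambda>t. partial_deriv j (\<lambda>w. \<Phi> (w, snd p)) (fst p + t *\<^sub>R i)) differentiable at 0} \<in> null_sets lborel"
    using directional_nondifferentiable_null[OF open_D Gb line] unfolding e .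
qed

text \<open>A derivative is bounded by the Lipschitz constant of the first partial. The
  differentiability premise excludes points where \<open>partial_deriv\<close> is only a default
  value.\<close>

lemma Phi_xx_bound:
  assumes \<rho>: "0 < \<rho>" "\<rho> < 1"
  shows "\<exists>L\<ge>0. \<forall>\<zeta>\<in>annulus. \<forall>i\<in>Basis. \<forall>j\<in>Basis. \<forall>z\<in>cball 0 \<rho>.
    (\<lambda>t. partial_deriv j (\<lambda>w. \<Phi> (w, \<zeta>)) (z + t *\<^sub>R i)) differentiable at 0 \<longrightarrow>
    \<bar>partial_deriv i (partial_deriv j (\<lambda>w. \<Phi> (w, \<zeta>))) z\<bar> \<le> L"
proof -
  obtain L r where L: "0 \<le> L" and r: "0 < r" and b: "\<And>\<zeta> j v x t. \<zeta> \<in> annulus \<Longrightarrow> j \<in> Basis \<Longrightarrow> norm v = 1 \<Longrightarrow> x \<in> cball 0 \<rho> \<Longrightarrow> \<bar>t\<bar> \<le> r \<Longrightarrow>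
     \<bar>partial_deriv j (\<lambda>w. \<Phi> (w, \<zeta>)) (x + t *\<^sub>R v) - partial_deriv j (\<lambda>w. \<Phi> (w, \<zeta>)) x\<bar> \<le> L * \<bar>t\<bar>"
    using Phi_partial_line_bound[OF \<rho>] by blast
  have main: "\<bar>partial_deriv i (partial_deriv j (\<lambda>w. \<Phi> (w, \<zeta>))) z\<bar> \<le> L"
    if h: "\<zeta> \<in> annulus" "i \<in> Basis" "j \<in> Basis" "z \<in> cball 0 \<rho>"
      and d: "(\<lambda>t. partial_deriv j (\<lambda>w. \<Phi> (w, \<zeta>)) (z + t *\<^sub>R i)) differentiable at 0" for \<zeta> i j z
  proof -
    have n: "norm i = 1" using h(2) by simp
    obtain d where d: "DERIV (\<lambda>t. partial_deriv j (\<lambda>w. \<Phi> (w, \<zeta>)) (z + t *\<^sub>R i)) 0 :> d"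
      using d real_differentiable_def by blast
    then have e: "partial_deriv i (partial_deriv j (\<lambda>w. \<Phi> (w, \<zeta>))) z = d"
      unfolding partial_deriv_def[of i] by (rule DERIV_imp_deriv)
    show ?thesis
      unfolding e by (rule DERIV_abs_le[OF d r]) (use b[OF h(1,3) n h(4)] in simp)
  qed
  show ?thesis using main L by blast
qed

text \<open>Bounding an essential supremum requires a measurable function, at the exceptional points
  as well; this is why the Borel lemmas keep track of the default value of \<open>deriv\<close>. The
  same C, built from the uniform bound L, serves every slice and the product.\<close>

lemma Phi_hessian_esssup:
  assumes K: "compact K" "K \<subseteq> ball 0 1"
  shows "\<exists>C::real. (\<forall>\<zeta>\<in>annulus. esssup (lebesgue_on K) (\<lambda>z. ereal (onorm (hessian (\<lambda>w. \<Phi> (w, \<zeta>)) z))) \<le> ereal C) \<and>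
     esssup (lebesgue_on (K \<times> annulus)) (\<lambda>(z, \<zeta>). ereal (onorm (hessian (\<lambda>w. \<Phi> (w, \<zeta>)) z))) \<le> ereal C"
proof -
  obtain \<rho> where \<rho>: "0 < \<rho>" "\<rho> < 1" "K \<subseteq> cball 0 \<rho>" using compact_subset_unit_ball[OF K] by blast
  obtain L where L: "0 \<le> L" "\<And>\<zeta> i j z. \<zeta> \<in> annulus \<Longrightarrow> i \<in> Basis \<Longrightarrow> j \<in> Basis \<Longrightarrow> z \<in> cball 0 \<rho> \<Longrightarrow>
    (\<lambda>t. partial_deriv j (\<lambda>w. \<Phi> (w, \<zeta>)) (z + t *\<^sub>R i)) differentiable at 0 \<Longrightarrow>
    \<bar>partial_deriv i (partial_deriv j (\<lambda>w. \<Phi> (w, \<zeta>))) z\<bar> \<le> L"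
    using Phi_xx_bound[OF \<rho>(1,2)] by blast
  define C where "C = real DIM(complex^'n) * (real DIM(complex^'n) * L)"
  have Ks: "K \<in> sets lebesgue" using K(1) by (simp add: compact_imp_closed)
  have KA: "K \<times> annulus \<in> sets lebesgue"
  proof -
    have "K \<times> annulus \<in> sets borel" using K(1) open_annulus by (intro borel_Times) (auto simp: compact_imp_closed)
    then show ?thesis by simp
  qed
  have hess: "onorm (hessian (\<lambda>w. \<Phi> (w, \<zeta>)) z) \<le> C"
    if "\<zeta> \<in> annulus" "z \<in> K" "\<And>i j. i \<in> Basis \<Longrightarrow> j \<in> Basis \<Longrightarrow> (\<lambda>t. partial_deriv j (\<lambda>w. \<Phi> (w, \<zeta>)) (z + t *\<^sub>R i)) differentiable at 0" for \<zeta> z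
    unfolding C_def by (rule onorm_hessian_le) (use L(2)[OF that(1)] that \<rho>(3) in blast)
  have 1: "esssup (lebesgue_on K) (\<lambda>z. ereal (onorm (hessian (\<lambda>w. \<Phi> (w, \<zeta>)) z))) \<le> ereal C" if \<zeta>: "\<zeta> \<in> annulus" for \<zeta>
  proof (rule esssup_I)
    have "(\<lambda>z. onorm (hessian (\<lambda>w. \<Phi> (w, \<zeta>)) z)) \<in> borel_measurable (lebesgue_on K)"
    proof (rule borel_measurable_onorm[OF _ linear_hessian])
      fix h :: "complex^'n"
      \<comment> \<open>Sections of a Borel function are Borel for every \<zeta>. This is where
        joint Borel measurability matters: a Lebesgue measurable function may have bad
        sections.\<close>
      have m: "(\<lambda>z. partial_deriv i (partial_deriv j (\<lambda>w. \<Phi> (w, \<zeta>))) z) \<in> borel_measurable (lebesgue_on K)" if i: "i \<in> Basis" and j: "j \<in> Basis" for i j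
      proof -
        have "(\<lambda>z. (z, \<zeta>)) \<in> measurable borel borel"
          by (intro borel_measurable_continuous_onI continuous_intros)
        from measurable_compose[OF this Phi_xx_borel_null(1)[OF i j]]
        have "(\<lambda>z. if (z, \<zeta>) \<in> D then Phi_xx i j (z, \<zeta>) else 0) \<in> borel_measurable lebesgue"
          by (simp add: measurable_completion)
        then have "(\<lambda>z. if (z, \<zeta>) \<in> D then Phi_xx i j (z, \<zeta>) else 0) \<in> borel_measurable (lebesgue_on K)"
          by (rule measurable_restrict_space1)
        then show ?thesis
          by (rule measurable_cong[THEN iffD1, rotated]) (use K(2) \<zeta> in \<open>auto simp: Phi_xx_def\<close>)
      qed
      show "(\<lambda>z. hessian (\<lambda>w. \<Phi> (w, \<zeta>)) z h) \<in> borel_measurable (lebesgue_on K)"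
        unfolding hessian_def by (intro borel_measurable_sum borel_measurable_scaleR borel_measurable_times m) auto
    qed
    then show "(\<lambda>z. ereal (onorm (hessian (\<lambda>w. \<Phi> (w, \<zeta>)) z))) \<in> borel_measurable (lebesgue_on K)" by simp
    let ?N = "\<lambda>i j. {x \<in> ball 0 1. \<not> (\<lambda>t. partial_deriv j (\<lambda>w. \<Phi> (w, \<zeta>)) (x + t *\<^sub>R i)) differentiable at 0}"
    have "AE z in lebesgue. \<forall>i\<in>Basis. \<forall>j\<in>Basis. z \<notin> ?N i j"
      using Phi_slice_null[OF \<zeta>] by (intro AE_finite_allI AE_not_in) (auto intro: null_sets_completionI)
    then have "AE z in lebesgue. z \<in> K \<longrightarrow> ereal (onorm (hessian (\<lambda>w. \<Phi> (w, \<zeta>)) z)) \<le> ereal C"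
    proof eventually_elim
      case (elim z)
      then show ?case using K(2) by (auto intro!: hess[OF \<zeta>])
    qed
    then show "AE z in lebesgue_on K. ereal (onorm (hessian (\<lambda>w. \<Phi> (w, \<zeta>)) z)) \<le> ereal C"
      using Ks by (subst AE_restrict_space_iff) auto
  qed
  have 2: "esssup (lebesgue_on (K \<times> annulus)) (\<lambda>p. ereal (onorm (hessian (\<lambda>w. \<Phi> (w, snd p)) (fst p)))) \<le> ereal C"
  proof (rule esssup_I)
    have "(\<lambda>p. onorm (hessian (\<lambda>w. \<Phi> (w, snd p)) (fst p))) \<in> borel_measurable (lebesgue_on (K \<times> annulus))"
    proof (rule borel_measurable_onorm[OF _ linear_hessian])
      fix h :: "complex^'n"
      have m: "(\<lambda>p. partial_deriv i (partial_deriv j (\<lambda>w. \<Phi> (w, snd p))) (fst p)) \<in> borel_measurable (lebesgue_on (K \<times> annulus))" if i: "i \<in> Basis" and j: "j \<in> Basis" for i j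
      proof -
        have "(\<lambda>p. if p \<in> D then Phi_xx i j p else 0) \<in> borel_measurable lebesgue"
          using Phi_xx_borel_null(1)[OF i j] by (simp add: measurable_completion)
        then have "(\<lambda>p. if p \<in> D then Phi_xx i j p else 0) \<in> borel_measurable (lebesgue_on (K \<times> annulus))"
          by (rule measurable_restrict_space1)
        then show ?thesis
          by (rule measurable_cong[THEN iffD1, rotated]) (use K(2) in \<open>auto simp: Phi_xx_def\<close>)
      qed
      show "(\<lambda>p. hessian (\<lambda>w. \<Phi> (w, snd p)) (fst p) h) \<in> borel_measurable (lebesgue_on (K \<times> annulus))"
        unfolding hessian_def by (intro borel_measurable_sum borel_measurable_scaleR borel_measurable_times m) auto
    qed
    then show "(\<lambda>p. ereal (onorm (hessian (\<lambda>w. \<Phi> (w, snd p)) (fst p)))) \<in> borel_measurable (lebesgue_on (K \<times> annulus))" by simp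
    let ?N = "\<lambda>i j. {p \<in> D. \<not> (\<lambda>t. partial_deriv j (\<lambda>w. \<Phi> (w, snd p)) (fst p + t *\<^sub>R i)) differentiable at 0}"
    have "AE p in lebesgue. \<forall>i\<in>Basis. \<forall>j\<in>Basis. p \<notin> ?N i j"
      using Phi_xx_borel_null(2) by (intro AE_finite_allI AE_not_in) (auto intro: null_sets_completionI)
    then have "AE p in lebesgue. p \<in> K \<times> annulus \<longrightarrow> ereal (onorm (hessian (\<lambda>w. \<Phi> (w, snd p)) (fst p))) \<le> ereal C"
    proof eventually_elim
      case (elim p)
      then show ?case using K(2) by (auto intro!: hess simp: mem_Times_iff)
    qed
    then show "AE p in lebesgue_on (K \<times> annulus). ereal (onorm (hessian (\<lambda>w. \<Phi> (w, snd p)) (fst p))) \<le> ereal C"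
      using KA by (subst AE_restrict_space_iff) auto
  qed
  show ?thesis
  proof (intro exI[of _ C] conjI ballI 1)
    show "esssup (lebesgue_on (K \<times> annulus)) (\<lambda>(z, \<zeta>). ereal (onorm (hessian (\<lambda>w. \<Phi> (w, \<zeta>)) z))) \<le> ereal C"
      using 2 unfolding split_beta' .
  qed
qed

end

theorem theoremB:
  fixes \<phi>0 \<phi>1 :: "complex ^ 'n \<Rightarrow> real"
    and \<Phi> :: "(complex ^ 'n) \<times> complex \<Rightarrow> real"
  assumes "C11_on (cball 0 1) \<phi>0" and "C11_on (cball 0 1) \<phi>1"
    and "plurisubharmonic_on (*s) (ball 0 1) \<phi>0"
    and "plurisubharmonic_on (*s) (ball 0 1) \<phi>1"
    and "\<forall>z\<in>sphere 0 1. \<phi>0 z = 0" and "\<forall>z\<in>sphere 0 1. \<phi>1 z = 0"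
  defines "\<Phi> \<equiv> perron_envelope \<phi>0 \<phi>1"
  shows "(\<forall>\<zeta>\<in>annulus.
            (AE z in lebesgue_on (ball 0 1). has_second_partials_at (\<lambda>w. \<Phi> (w, \<zeta>)) z) \<and>
            second_partials_weak_on (ball 0 1) (\<lambda>w. \<Phi> (w, \<zeta>))) \<and>
         (\<forall>K. compact K \<and> K \<subseteq> ball 0 1 \<longrightarrow>
            (\<exists>C::real.
               (\<forall>\<zeta>\<in>annulus.
                  esssup (lebesgue_on K)
                    (\<lambda>z. ereal (onorm (hessian (\<lambda>w. \<Phi> (w, \<zeta>)) z))) \<le> ereal C) \<and>
               esssup (lebesgue_on (K \<times> annulus))
                 (\<lambda>(z, \<zeta>). ereal (onorm (hessian (\<lambda>w. \<Phi> (w, \<zeta>)) z))) \<le> ereal C))"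
proof -
  interpret E: envelope \<phi>0 \<phi>1 using assms(1,2) by unfold_locales
  have r: "E.\<Phi> = \<Phi>" unfolding E.\<Phi>_def assms(7) ..
  show ?thesis
  proof (intro conjI ballI allI impI)
    fix K :: "(complex ^ 'n) set" assume "compact K \<and> K \<subseteq> ball 0 1"
    then have K: "compact K" "K \<subseteq> ball 0 1" by simp_all
    show "\<exists>C::real. (\<forall>\<zeta>\<in>annulus. esssup (lebesgue_on K) (\<lambda>z. ereal (onorm (hessian (\<lambda>w. \<Phi> (w, \<zeta>)) z))) \<le> ereal C) \<and>
        esssup (lebesgue_on (K \<times> annulus)) (\<lambda>(z, \<zeta>). ereal (onorm (hessian (\<lambda>w. \<Phi> (w, \<zeta>)) z))) \<le> ereal C"
      using E.Phi_hessian_esssup[OF K] unfolding r .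
  qed (rule E.Phi_AE_has_second_partials[unfolded r] E.Phi_weak[unfolded r]; assumption)+
qed

end
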